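(* Let $(M,\omega)$ be a compact Hermitian manifold of complex dimension $n$. If $\omega$ is $k$-Gauduchon for some $1\le k\le n-2$ and also balanced, then $(M,\omega)$ is K\"ahler.
   Context: $\omega$ denotes the fundamental $(1,1)$-form of the Hermitian metric. The metric $\omega$ is $k$-Gauduchon ($1\le k\le n-1$) if $\sqrt{-1}\,\omega^{n-k-1}\wedge\partial\bar\partial\omega^k=0$; it is balanced if $d^*\omega=0$ (equivalently $d\omega^{n-1}=0$), where $d^*$ is the adjoint of $d$ with respect to the metric. *)

theory Defs
  imports "HOL-Analysis.Analysis"
begin

section \<open>Smooth and holomorphic maps\<close>

text \<open>On an open set in a Euclidean space this is \<open>C\<^sup>\<infinity>\<close>: all iterated directional
  derivatives exist and are again differentiable.\<close>

coinductive smooth_on ::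
  "'a::real_normed_vector set \<Rightarrow> ('a \<Rightarrow> 'b::real_normed_vector) \<Rightarrow> bool" for S where
  "\<lbrakk>\<And>x. x \<in> S \<Longrightarrow> f differentiable (at x);
    \<And>v. smooth_on S (\<lambda>x. frechet_derivative f (at x) v)\<rbrakk> \<Longrightarrow> smooth_on S f"

type_synonym 'n cvec = "(complex, 'n) vec"
type_synonym 'n cmat = "((complex, 'n) vec, 'n) vec"

text \<open>The complex covectors \<open>dz\<^sub>j\<close>, \<open>d\<zeta>\<^sub>j\<close> (with \<open>\<zeta>\<^sub>j\<close> the conjugate of \<open>z\<^sub>j\<close>) form a
  basis of the complexified cotangent space of \<open>\<complex>\<^sup>n\<close>. The linear order only fixes the order of the
  factors in basis monomials: all \<open>dz\<^sub>j\<close> come before all \<open>d\<zeta>\<^sub>j\<close>.\<close>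

datatype 'n covec = Dz 'n | Dzbar 'n

instance covec :: (finite) finite
proof
  have "(UNIV :: 'a::finite covec set) = range Dz \<union> range Dzbar"
    by (auto simp: image_iff) (metis covec.exhaust)
  then show "finite (UNIV :: 'a::finite covec set)"
    by (metis finite_Un finite_imageI finite_class.finite_UNIV)
qed

instantiation covec :: (linorder) linorder
begin

fun less_eq_covec :: "'a covec \<Rightarrow> 'a covec \<Rightarrow> bool" where
  "less_eq_covec (Dz i) (Dz j) \<longleftrightarrow> i \<le> j"
| "less_eq_covec (Dz i) (Dzbar j) \<longleftrightarrow> True"
| "less_eq_covec (Dzbar i) (Dz j) \<longleftrightarrow> False"
| "less_eq_covec (Dzbar i) (Dzbar j) \<longleftrightarrow> i \<le> j"

definition less_covec :: "'a covec \<Rightarrow> 'a covec \<Rightarrow> bool" where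
  "less_covec x y \<longleftrightarrow> x \<le> y \<and> \<not> y \<le> x"

instance
proof
  fix x y z :: "'a covec"
  show "x < y \<longleftrightarrow> x \<le> y \<and> \<not> y \<le> x" by (fact less_covec_def)
  show "x \<le> x" by (cases x) auto
  show "x \<le> y \<Longrightarrow> y \<le> z \<Longrightarrow> x \<le> z" by (cases x; cases y; cases z) auto
  show "x \<le> y \<Longrightarrow> y \<le> x \<Longrightarrow> x = y" by (cases x; cases y) auto
  show "x \<le> y \<or> y \<le> x" by (cases x; cases y) auto
qed

end

text \<open>Wirtinger derivatives \<open>\<partial>/\<partial>z\<^sub>j = (\<partial>/\<partial>x\<^sub>j - \<i> \<partial>/\<partial>y\<^sub>j)/2\<close> and
  \<open>\<partial>/\<partial>\<zeta>\<^sub>j = (\<partial>/\<partial>x\<^sub>j + \<i> \<partial>/\<partial>y\<^sub>j)/2\<close> of vector-valued functions.\<close>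

fun wirtinger :: "'n::finite covec \<Rightarrow> ('n cvec \<Rightarrow> complex^'m::finite) \<Rightarrow> 'n cvec \<Rightarrow> complex^'m"
where
  "wirtinger (Dz j) f x = (1/2) *s (frechet_derivative f (at x) (axis j 1)
                                     - \<i> *s frechet_derivative f (at x) (axis j \<i>))"
| "wirtinger (Dzbar j) f x = (1/2) *s (frechet_derivative f (at x) (axis j 1)
                                     + \<i> *s frechet_derivative f (at x) (axis j \<i>))"

definition holomorphic_map_on :: "'n::finite cvec set \<Rightarrow> ('n cvec \<Rightarrow> complex^'m::finite) \<Rightarrow> bool"
  where "holomorphic_map_on S f \<longleftrightarrow>
    smooth_on S f \<and> (\<forall>x\<in>S. \<forall>j. wirtinger (Dzbar j) f x = 0)"

section \<open>Differential forms on open subsets of complex coordinate space\<close>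

text \<open>An element \<open>a\<close> of the exterior algebra is given by its coefficients \<open>a $ K\<close> with respect to
  the monomials \<open>e\<^sub>1 \<and> \<dots> \<and> e\<^sub>p\<close>, where \<open>K = {e\<^sub>1 < \<dots> < e\<^sub>p}\<close>. A form on a subset of \<open>\<complex>\<^sup>n\<close> is a
  function into this space.\<close>

type_synonym 'n cform = "(complex, 'n covec set) vec"

text \<open>\<open>shuffle_sign I J\<close> is the sign of the permutation sorting the concatenation of the increasing
  enumerations of the disjoint sets \<open>I\<close> and \<open>J\<close>.\<close>

definition shuffle_sign :: "'b::linorder set \<Rightarrow> 'b set \<Rightarrow> complex" where
  "shuffle_sign I J = (-1) ^ card {(i, j). i \<in> I \<and> j \<in> J \<and> j < i}"

definition wedge :: "'n::{finite,linorder} cform \<Rightarrow> 'n cform \<Rightarrow> 'n cform" (infixl "\<^bold>\<and>" 75) where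
  "a \<^bold>\<and> b = (\<chi> K. \<Sum>I\<in>Pow K. shuffle_sign I (K - I) * a $ I * b $ (K - I))"

definition wedge_one :: "'n::{finite,linorder} cform" where
  "wedge_one = axis {} 1"

definition wedge_power :: "'n::{finite,linorder} cform \<Rightarrow> nat \<Rightarrow> 'n cform" where
  "wedge_power a k = ((\<lambda>b. a \<^bold>\<and> b) ^^ k) wedge_one"

definition covector :: "'n::{finite,linorder} covec \<Rightarrow> 'n cform" where
  "covector e = axis {e} 1"

definition del :: "('n cvec \<Rightarrow> 'n::{finite,linorder} cform) \<Rightarrow> 'n cvec \<Rightarrow> 'n cform" where
  "del a x = (\<Sum>j\<in>UNIV. covector (Dz j) \<^bold>\<and> wirtinger (Dz j) a x)"

definition delbar :: "('n cvec \<Rightarrow> 'n::{finite,linorder} cform) \<Rightarrow> 'n cvec \<Rightarrow> 'n cform" where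
  "delbar a x = (\<Sum>j\<in>UNIV. covector (Dzbar j) \<^bold>\<and> wirtinger (Dzbar j) a x)"

definition ext_d :: "('n cvec \<Rightarrow> 'n::{finite,linorder} cform) \<Rightarrow> 'n cvec \<Rightarrow> 'n cform" where
  "ext_d a x = del a x + delbar a x"

text \<open>The minor with rows \<open>I\<close> and columns \<open>J\<close> (both in increasing order) of the matrix \<open>m\<close>,
  given by the Leibniz formula.\<close>

definition minor :: "('b::linorder \<Rightarrow> 'b \<Rightarrow> complex) \<Rightarrow> 'b set \<Rightarrow> 'b set \<Rightarrow> complex" where
  "minor m I J = (if card I = card J
     then \<Sum>\<pi> | \<pi> permutes {..<card I}. of_int (sign \<pi>) *
            (\<Prod>i<card I. m (sorted_list_of_set I ! i) (sorted_list_of_set J ! \<pi> i))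
     else 0)"

text \<open>\<open>T\<^sup>*e = (\<Sum>f. jacobian T x e f \<cdot> f)\<close> for basis covectors \<open>e\<close>; hence the coefficients of
  \<open>T\<^sup>*(e\<^sub>1 \<and> \<dots> \<and> e\<^sub>p)\<close> are minors of the Jacobian.\<close>

definition jacobian ::
  "('n cvec \<Rightarrow> 'n::finite cvec) \<Rightarrow> 'n cvec \<Rightarrow> 'n covec \<Rightarrow> 'n covec \<Rightarrow> complex" where
  "jacobian T x e f =
     wirtinger f (\<lambda>y. \<chi> e'. case e' of Dz j \<Rightarrow> T y $ j | Dzbar j \<Rightarrow> cnj (T y $ j)) x $ e"

definition pullback ::
  "('n cvec \<Rightarrow> 'n cvec) \<Rightarrow> ('n cvec \<Rightarrow> 'n::{finite,linorder} cform) \<Rightarrow> 'n cvec \<Rightarrow> 'n cform"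
  where "pullback T a x = (\<chi> J. \<Sum>I\<in>UNIV. a (T x) $ I * minor (jacobian T x) I J)"

section \<open>Complex manifolds\<close>

text \<open>A chart is a pair of its domain and its coordinate map. Second countability is not required
  explicitly: it is automatic for compact locally Euclidean spaces.\<close>

type_synonym ('a, 'n) chart = "'a set \<times> ('a \<Rightarrow> 'n cvec)"

definition chart_image :: "('a, 'n::finite) chart \<Rightarrow> 'n cvec set" where
  "chart_image c = snd c ` fst c"

definition transition :: "('a, 'n::finite) chart \<Rightarrow> ('a, 'n) chart \<Rightarrow> 'n cvec \<Rightarrow> 'n cvec" where
  "transition c d = snd d \<circ> inv_into (fst c) (snd c)"

definition overlap :: "('a, 'n::finite) chart \<Rightarrow> ('a, 'n) chart \<Rightarrow> 'n cvec set" where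
  "overlap c d = snd c ` (fst c \<inter> fst d)"

definition complex_chart :: "'a topology \<Rightarrow> ('a, 'n::finite) chart \<Rightarrow> bool" where
  "complex_chart X c \<longleftrightarrow> openin X (fst c) \<and> open (chart_image c) \<and>
     homeomorphic_map (subtopology X (fst c)) (top_of_set (chart_image c)) (snd c)"

definition complex_atlas :: "'a topology \<Rightarrow> ('a, 'n::finite) chart set \<Rightarrow> bool" where
  "complex_atlas X A \<longleftrightarrow> (\<forall>c\<in>A. complex_chart X c) \<and> (\<Union>c\<in>A. fst c) = topspace X \<and>
     (\<forall>c\<in>A. \<forall>d\<in>A. holomorphic_map_on (overlap c d) (transition c d))"

definition compact_complex_manifold :: "'a topology \<Rightarrow> ('a, 'n::finite) chart set \<Rightarrow> bool" where
  "compact_complex_manifold X A \<longleftrightarrow> compact_space X \<and> Hausdorff_space X \<and> complex_atlas X A"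

text \<open>Smooth complex-valued \<open>p\<close>-forms on the manifold: families of local forms, one on each chart
  image, that correspond under the transition maps.\<close>

definition global_form ::
  "('a, 'n::{finite,linorder}) chart set \<Rightarrow> nat \<Rightarrow> (('a, 'n) chart \<Rightarrow> 'n cvec \<Rightarrow> 'n cform) \<Rightarrow> bool"
  where "global_form A p \<alpha> \<longleftrightarrow>
    (\<forall>c\<in>A. smooth_on (chart_image c) (\<alpha> c) \<and>
           (\<forall>x\<in>chart_image c. \<forall>I. card I \<noteq> p \<longrightarrow> \<alpha> c x $ I = 0)) \<and>
    (\<forall>c\<in>A. \<forall>d\<in>A. \<forall>x\<in>overlap c d. \<alpha> c x = pullback (transition c d) (\<alpha> d) x)"

section \<open>Hermitian metrics\<close>

text \<open>A Hermitian metric is given in each chart by the matrix \<open>h\<^sub>j\<^sub>k = g(\<partial>/\<partial>z\<^sub>j, \<partial>/\<partial>\<zeta>\<^sub>k)\<close>, where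
  \<open>g\<close> is the complex bilinear extension of the Riemannian metric. The flat metric has
  \<open>h\<^sub>j\<^sub>k = \<delta>\<^sub>j\<^sub>k / 2\<close>.\<close>

type_synonym ('a, 'n) metric = "('a, 'n) chart \<Rightarrow> 'n cvec \<Rightarrow> 'n cmat"

definition hermitian_metric :: "('a, 'n::finite) chart set \<Rightarrow> ('a, 'n) metric \<Rightarrow> bool" where
  "hermitian_metric A h \<longleftrightarrow>
    (\<forall>c\<in>A. smooth_on (chart_image c) (h c) \<and>
      (\<forall>x\<in>chart_image c.
         (\<forall>j k. h c x $ k $ j = cnj (h c x $ j $ k)) \<and>
         (\<forall>v. v \<noteq> 0 \<longrightarrow> 0 < Re (\<Sum>j\<in>UNIV. \<Sum>k\<in>UNIV. h c x $ j $ k * v $ j * cnj (v $ k))))) \<and>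
    (\<forall>c\<in>A. \<forall>d\<in>A. \<forall>x\<in>overlap c d. \<forall>j k.
       h c x $ j $ k =
         (\<Sum>l\<in>UNIV. \<Sum>m\<in>UNIV. h d (transition c d x) $ l $ m *
            wirtinger (Dz j) (transition c d) x $ l * cnj (wirtinger (Dz k) (transition c d) x $ m)))"

definition compact_hermitian_manifold ::
  "'a topology \<Rightarrow> ('a, 'n::finite) chart set \<Rightarrow> ('a, 'n) metric \<Rightarrow> bool" where
  "compact_hermitian_manifold X A h \<longleftrightarrow> compact_complex_manifold X A \<and> hermitian_metric A h"

text \<open>The fundamental form \<open>\<omega> = \<i> (\<Sum>j k. h\<^sub>j\<^sub>k dz\<^sub>j \<and> d\<zeta>\<^sub>k)\<close>.\<close>

definition fundamental_form ::
  "('a, 'n) metric \<Rightarrow> ('a, 'n) chart \<Rightarrow> 'n cvec \<Rightarrow> 'n::{finite,linorder} cform" where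
  "fundamental_form h c x =
     (\<Sum>j\<in>UNIV. \<Sum>k\<in>UNIV. (\<i> * h c x $ j $ k) *s (covector (Dz j) \<^bold>\<and> covector (Dzbar k)))"

section \<open>The adjoint of the exterior derivative\<close>

text \<open>The Hermitian inner product induced on covectors, for the metric matrix \<open>H\<close> at a point. It is
  linear in the first argument, whence \<open>\<langle>dz\<^sub>j, dz\<^sub>k\<rangle>\<close> is the \<open>(k, j)\<close> entry of the inverse of \<open>H\<close>.\<close>

fun covec_inner :: "'n cmat \<Rightarrow> 'n::finite covec \<Rightarrow> 'n covec \<Rightarrow> complex" where
  "covec_inner H (Dz j) (Dz k) = matrix_inv H $ k $ j"
| "covec_inner H (Dzbar j) (Dzbar k) = matrix_inv H $ j $ k"
| "covec_inner H (Dz j) (Dzbar k) = 0"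
| "covec_inner H (Dzbar j) (Dz k) = 0"

definition form_inner :: "'n cmat \<Rightarrow> 'n::{finite,linorder} cform \<Rightarrow> 'n cform \<Rightarrow> complex" where
  "form_inner H a b =
     (\<Sum>I\<in>UNIV. \<Sum>J\<in>UNIV. a $ I * cnj (b $ J) * minor (covec_inner H) I J)"

text \<open>The density of the Riemannian volume form \<open>\<omega>\<^sup>n / n!\<close> with respect to Lebesgue measure in the
  real coordinates.\<close>

definition volume_density :: "'n::finite cmat \<Rightarrow> real" where
  "volume_density H = 2 ^ CARD('n) * Re (det H)"

text \<open>Integration over the manifold is reduced to integration in charts by cutting the manifold
  into finitely many Borel pieces, each lying in the domain of a chart.\<close>

definition chart_partition ::
  "'a topology \<Rightarrow> ('a, 'n::finite) chart set \<Rightarrow> (('a, 'n) chart \<times> 'a set) set \<Rightarrow> bool" where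
  "chart_partition X A P \<longleftrightarrow> finite P \<and>
     (\<forall>(c, B)\<in>P. c \<in> A \<and> B \<subseteq> fst c \<and> B \<in> sigma_sets (topspace X) {U. openin X U}) \<and>
     (\<forall>p\<in>topspace X. \<exists>!cB. cB \<in> P \<and> p \<in> snd cB)"

text \<open>\<open>has_L2_inner X A h \<alpha> \<beta> s\<close>: the integral of \<open>\<langle>\<alpha>, \<beta>\<rangle>\<close> over the manifold against the
  Riemannian volume is \<open>s\<close>. By the change of variables formula the sum does not depend on the
  partition.\<close>

definition has_L2_inner ::
  "'a topology \<Rightarrow> ('a, 'n) chart set \<Rightarrow> ('a, 'n) metric \<Rightarrow>
   (('a, 'n) chart \<Rightarrow> 'n cvec \<Rightarrow> 'n cform) \<Rightarrow>
   (('a, 'n) chart \<Rightarrow> 'n cvec \<Rightarrow> 'n::{finite,linorder} cform) \<Rightarrow> complex \<Rightarrow> bool" where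
  "has_L2_inner X A h \<alpha> \<beta> s \<longleftrightarrow>
    (\<forall>P. chart_partition X A P \<longrightarrow>
       (\<Sum>(c, B)\<in>P. LINT x:snd c ` B|lborel.
          volume_density (h c x) *\<^sub>R form_inner (h c x) (\<alpha> c x) (\<beta> c x)) = s)"

text \<open>\<open>is_codifferential X A h p \<beta> \<eta>\<close>: the \<open>p\<close>-form \<open>\<eta>\<close> is \<open>d\<^sup>*\<beta>\<close> for the \<open>(p+1)\<close>-form \<open>\<beta>\<close>,
  i.e. \<open>(d\<alpha>, \<beta>) = (\<alpha>, \<eta>)\<close> for every smooth \<open>p\<close>-form \<open>\<alpha>\<close>.\<close>

definition is_codifferential ::
  "'a topology \<Rightarrow> ('a, 'n) chart set \<Rightarrow> ('a, 'n) metric \<Rightarrow> nat \<Rightarrow>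
   (('a, 'n) chart \<Rightarrow> 'n cvec \<Rightarrow> 'n cform) \<Rightarrow>
   (('a, 'n) chart \<Rightarrow> 'n cvec \<Rightarrow> 'n::{finite,linorder} cform) \<Rightarrow> bool" where
  "is_codifferential X A h p \<beta> \<eta> \<longleftrightarrow> global_form A p \<eta> \<and>
    (\<forall>\<alpha>. global_form A p \<alpha> \<longrightarrow>
       (\<exists>s. has_L2_inner X A h (\<lambda>c. ext_d (\<alpha> c)) \<beta> s \<and> has_L2_inner X A h \<alpha> \<eta> s))"

section \<open>Special Hermitian metrics\<close>

definition k_gauduchon ::
  "nat \<Rightarrow> ('a, 'n::{finite,linorder}) chart set \<Rightarrow> ('a, 'n) metric \<Rightarrow> bool" where
  "k_gauduchon k A h \<longleftrightarrow> 1 \<le> k \<and> k \<le> CARD('n) - 1 \<and>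
    (\<forall>c\<in>A. \<forall>x\<in>chart_image c.
       \<i> *s (wedge_power (fundamental_form h c x) (CARD('n) - k - 1) \<^bold>\<and>
             del (delbar (\<lambda>y. wedge_power (fundamental_form h c y) k)) x) = 0)"

definition balanced ::
  "'a topology \<Rightarrow> ('a, 'n::{finite,linorder}) chart set \<Rightarrow> ('a, 'n) metric \<Rightarrow> bool" where
  "balanced X A h \<longleftrightarrow> is_codifferential X A h 1 (fundamental_form h) (\<lambda>_ _. 0)"

definition kaehler :: "('a, 'n::{finite,linorder}) chart set \<Rightarrow> ('a, 'n) metric \<Rightarrow> bool" where
  "kaehler A h \<longleftrightarrow> (\<forall>c\<in>A. \<forall>x\<in>chart_image c. ext_d (fundamental_form h c) x = 0)"

end

theory Submission
  imports Defs
begin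

text \<open>
  Let \<open>\<omega>\<close> be the fundamental form and \<open>n\<close> the dimension. The metric is balanced iff
  \<open>\<omega>\<^sup>n\<^sup>-\<^sup>2 \<and> \<partial>\<omega> = 0\<close>, equivalently \<open>\<omega>\<^sup>n\<^sup>-\<^sup>2 \<and> \<delta>\<omega> = 0\<close>, where \<open>\<delta>\<close> denotes the \<open>(0,1)\<close>-part of \<open>d\<close>.
  Applying \<open>\<partial>\<close> to the second equation gives
    \<open>(n-2) X + Y = 0\<close> for \<open>X = \<omega>\<^sup>n\<^sup>-\<^sup>3 \<and> \<partial>\<omega> \<and> \<delta>\<omega>\<close> and \<open>Y = \<omega>\<^sup>n\<^sup>-\<^sup>2 \<and> \<partial>\<delta>\<omega>\<close>,
  and expanding the \<open>k\<close>-Gauduchon equation gives \<open>(k-1) X + Y = 0\<close>. As \<open>k \<noteq> n-1\<close>, this forces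
  \<open>X = 0\<close>. But the balanced condition also says that the \<open>(2,1)\<close>-form \<open>\<partial>\<omega>\<close> is primitive, and for
  such forms the Hodge--Riemann relation identifies \<open>X\<close> with a nonzero multiple of
  \<open>|\<partial>\<omega>|\<^sup>2 \<omega>\<^sup>n\<close>. Hence \<open>\<partial>\<omega> = 0\<close>, and \<open>d\<omega> = 0\<close> by conjugation. This is
  \<open>torsion_trace_gauduchon_imp_closed\<close>; all of it happens pointwise in a chart.

  The Hodge--Riemann relation (\<open>hodge_riemann_trace_free\<close>) is obtained in a unitary coframe
  \<open>\<theta>\<^sub>a\<close>. There \<open>\<omega>\<close> is the sum of the elements \<open>\<i> \<theta>\<^sub>a \<and> cnj \<theta>\<^sub>a\<close>, which are central and have square zero,
  so that products with powers of \<open>\<omega>\<close> are evaluated by counting indices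
  (\<open>sum_nilpotent_power_vanishes\<close>, \<open>sum_nilpotent_power_factor\<close>). Primitivity becomes the
  vanishing of a trace of the torsion coefficients.

  It remains to extract this trace condition from \<open>d\<^sup>*\<omega> = 0\<close>, which is a weak equation, tested
  against global one-forms (\<open>balanced_torsion_trace\<close>). The test forms are \<open>\<phi> d\<zeta>\<^sub>b\<close> in one chart,
  with a bump function \<open>\<phi>\<close>, extended by zero. Cutting the manifold so that this chart is one of the
  pieces leaves a single integral over an open subset of \<open>\<complex>\<^sup>n\<close>. Integration by parts and the
  fundamental lemma of the calculus of variations then show that the rows of the adjugate matrix of the metric
  have zero divergence, and Jacobi's formula for the derivative of a determinant rewrites this as the trace condition.
\<close>

text \<open>Sums mostly run over a whole finite type; the binder for infinite series is reused for them.\<close>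

no_notation suminf (binder "\<Sum>" 10)

abbreviation sum_all :: "('i::finite \<Rightarrow> 'b::comm_monoid_add) \<Rightarrow> 'b" (binder "\<Sum>" 10) where
  "sum_all f \<equiv> sum f UNIV"

section \<open>The exterior algebra as a ring\<close>

lemma shuffle_sign_Un_left:
  assumes "I \<inter> J = {}" "finite I" "finite J" "finite (M::'b::linorder set)"
  shows "shuffle_sign (I \<union> J) M = shuffle_sign I M * shuffle_sign J M"
proof -
  have "{(i, j). i \<in> I \<union> J \<and> j \<in> M \<and> j < i} = {(i, j). i \<in> I \<and> j \<in> M \<and> j < i} \<union> {(i, j). i \<in> J \<and> j \<in> M \<and> j < i}"
    by auto
  moreover have "finite {(i, j). i \<in> I \<and> j \<in> M \<and> j < i}"
    by (rule finite_subset[of _ "I \<times> M"]) (use assms in auto)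
  moreover have "finite {(i, j). i \<in> J \<and> j \<in> M \<and> j < i}"
    by (rule finite_subset[of _ "J \<times> M"]) (use assms in auto)
  moreover have "{(i, j). i \<in> I \<and> j \<in> M \<and> j < i} \<inter> {(i, j). i \<in> J \<and> j \<in> M \<and> j < i} = {}"
    using assms by auto
  ultimately have "card {(i, j). i \<in> I \<union> J \<and> j \<in> M \<and> j < i} =
      card {(i, j). i \<in> I \<and> j \<in> M \<and> j < i} + card {(i, j). i \<in> J \<and> j \<in> M \<and> j < i}"
    by (simp add: card_Un_disjoint)
  then show ?thesis by (simp add: shuffle_sign_def power_add)
qed

lemma shuffle_sign_Un_right:
  assumes "I \<inter> J = {}" "finite I" "finite J" "finite (M::'b::linorder set)"
  shows "shuffle_sign M (I \<union> J) = shuffle_sign M I * shuffle_sign M J"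
proof -
  have "{(i, j). i \<in> M \<and> j \<in> I \<union> J \<and> j < i} = {(i, j). i \<in> M \<and> j \<in> I \<and> j < i} \<union> {(i, j). i \<in> M \<and> j \<in> J \<and> j < i}"
    by auto
  moreover have "finite {(i, j). i \<in> M \<and> j \<in> I \<and> j < i}"
    by (rule finite_subset[of _ "M \<times> I"]) (use assms in auto)
  moreover have "finite {(i, j). i \<in> M \<and> j \<in> J \<and> j < i}"
    by (rule finite_subset[of _ "M \<times> J"]) (use assms in auto)
  moreover have "{(i, j). i \<in> M \<and> j \<in> I \<and> j < i} \<inter> {(i, j). i \<in> M \<and> j \<in> J \<and> j < i} = {}"
    using assms by auto
  ultimately have "card {(i, j). i \<in> M \<and> j \<in> I \<union> J \<and> j < i} =
      card {(i, j). i \<in> M \<and> j \<in> I \<and> j < i} + card {(i, j). i \<in> M \<and> j \<in> J \<and> j < i}"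
    by (simp add: card_Un_disjoint)
  then show ?thesis by (simp add: shuffle_sign_def power_add)
qed

text \<open>Every pair in \<open>I \<times> J\<close> is an inversion for exactly one of the two orders of the
  blocks.\<close>

lemma shuffle_sign_swap:
  assumes "I \<inter> J = {}" "finite I" "finite (J::'b::linorder set)"
  shows "shuffle_sign I J * shuffle_sign J I = (-1) ^ (card I * card J)"
proof -
  let ?A = "{(i, j). i \<in> I \<and> j \<in> J \<and> j < i}" and ?B = "{(i, j). i \<in> I \<and> j \<in> J \<and> i < j}"
  have fin: "finite ?A" "finite ?B"
    by (rule finite_subset[of _ "I \<times> J"]; use assms in auto)+
  have "I \<times> J = ?A \<union> ?B" using assms by (auto simp: neq_iff)
  moreover have "?A \<inter> ?B = {}" by auto
  ultimately have "card I * card J = card ?A + card ?B"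
    using card_Un_disjoint[OF fin] by (metis card_cartesian_product)
  moreover have "card {(i, j). i \<in> J \<and> j \<in> I \<and> j < i} = card ?B"
    by (rule bij_betw_same_card[of prod.swap]) (auto simp: bij_betw_def inj_on_def image_iff)
  ultimately show ?thesis by (simp add: shuffle_sign_def power_add)
qed

text \<open>Both sides are sums over the ordered partitions of \<open>K\<close> into three blocks. The signs
  agree because inversions between different blocks may be counted one pair of blocks at a time.\<close>

lemma wedge_assoc:
  fixes a b c :: "'n::{finite,linorder} cform"
  shows "(a \<^bold>\<and> b) \<^bold>\<and> c = a \<^bold>\<and> (b \<^bold>\<and> c)"
proof (rule vec_eq_iff[THEN iffD2], rule allI)
  fix K :: "'n covec set"
  have "((a \<^bold>\<and> b) \<^bold>\<and> c) $ K = (\<Sum>L\<in>Pow K. \<Sum>I\<in>Pow L.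
      shuffle_sign L (K - L) * shuffle_sign I (L - I) * a $ I * b $ (L - I) * c $ (K - L))"
    by (simp add: wedge_def sum_distrib_left sum_distrib_right mult_ac)
  also have "\<dots> = (\<Sum>(L,I)\<in>Sigma (Pow K) Pow.
      shuffle_sign L (K - L) * shuffle_sign I (L - I) * a $ I * b $ (L - I) * c $ (K - L))"
    by (rule sum.Sigma) auto
  also have "\<dots> = (\<Sum>(I,J)\<in>Sigma (Pow K) (\<lambda>I. Pow (K - I)).
      shuffle_sign I (K - I) * shuffle_sign J (K - I - J) * a $ I * b $ J * c $ (K - I - J))"
  proof (rule sum.reindex_bij_witness[where j = "\<lambda>(L,I). (I, L - I)" and i = "\<lambda>(I,J). (I \<union> J, I)"])
    fix x :: "'n covec set \<times> 'n covec set" assume "x \<in> Sigma (Pow K) Pow"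
    then obtain L I where x: "x = (L, I)" "L \<subseteq> K" "I \<subseteq> L" by auto
    have e: "K - I - (L - I) = K - L" using x by auto
    have "shuffle_sign L (K - L) = shuffle_sign (I \<union> (L - I)) (K - L)"
      using x by (simp add: Un_absorb1)
    also have "\<dots> = shuffle_sign I (K - L) * shuffle_sign (L - I) (K - L)"
      by (rule shuffle_sign_Un_left) auto
    finally have 1: "shuffle_sign L (K - L) = shuffle_sign I (K - L) * shuffle_sign (L - I) (K - L)" .
    have "shuffle_sign I (K - I) = shuffle_sign I ((L - I) \<union> (K - L))"
      using x by (intro arg_cong2[where f = shuffle_sign]) auto
    also have "\<dots> = shuffle_sign I (L - I) * shuffle_sign I (K - L)"
      by (rule shuffle_sign_Un_right) auto
    finally have 2: "shuffle_sign I (K - I) = shuffle_sign I (L - I) * shuffle_sign I (K - L)" .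
    show "(case case x of (L, I) \<Rightarrow> (I, L - I) of (I, J) \<Rightarrow>
        shuffle_sign I (K - I) * shuffle_sign J (K - I - J) * a $ I * b $ J * c $ (K - I - J)) =
        (case x of (L, I) \<Rightarrow>
        shuffle_sign L (K - L) * shuffle_sign I (L - I) * a $ I * b $ (L - I) * c $ (K - L))"
      using x(1) e by (simp add: 1 2 mult_ac)
  qed auto
  also have "\<dots> = (\<Sum>I\<in>Pow K. \<Sum>J\<in>Pow (K - I).
      shuffle_sign I (K - I) * shuffle_sign J (K - I - J) * a $ I * b $ J * c $ (K - I - J))"
    by (rule sum.Sigma[symmetric]) auto
  also have "\<dots> = (a \<^bold>\<and> (b \<^bold>\<and> c)) $ K"
    by (simp add: wedge_def sum_distrib_left mult_ac)
  finally show "((a \<^bold>\<and> b) \<^bold>\<and> c) $ K = (a \<^bold>\<and> (b \<^bold>\<and> c)) $ K" .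
qed

lemma shuffle_sign_empty [simp]: "shuffle_sign {} J = 1" "shuffle_sign I {} = 1"
  by (simp_all add: shuffle_sign_def)

lemma axis_nth_if: "axis I r $ K = (if K = I then r else 0)"
  by (simp add: axis_def)

lemma axis_wedge_nth:
  "(axis I r \<^bold>\<and> b) $ K = (if I \<subseteq> K then shuffle_sign I (K - I) * r * b $ (K - I) else 0)"
proof -
  have "(axis I r \<^bold>\<and> b) $ K = (\<Sum>J\<in>Pow K. if J = I then shuffle_sign I (K - I) * r * b $ (K - I) else 0)"
    unfolding wedge_def vec_lambda_beta by (rule sum.cong) (auto simp: axis_def)
  then show ?thesis by simp
qed

lemma wedge_axis_nth:
  "(a \<^bold>\<and> axis J r) $ K = (if J \<subseteq> K then shuffle_sign (K - J) J * a $ (K - J) * r else 0)"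
proof -
  have "(a \<^bold>\<and> axis J r) $ K = (\<Sum>I\<in>Pow K. if I = K - J then (if J \<subseteq> K then shuffle_sign (K - J) J * a $ (K - J) * r else 0) else 0)"
    unfolding wedge_def vec_lambda_beta by (rule sum.cong) (auto simp: axis_def double_diff)
  then show ?thesis by simp
qed

lemma axis_wedge_axis:
  "axis I r \<^bold>\<and> axis J s = (if I \<inter> J = {} then axis (I \<union> J) (shuffle_sign I J * r * s) else 0)"
proof (rule vec_eq_iff[THEN iffD2], rule allI)
  fix K
  have "I \<subseteq> K \<and> K - I = J \<longleftrightarrow> I \<inter> J = {} \<and> K = I \<union> J" by auto
  then show "(axis I r \<^bold>\<and> axis J s) $ K =
      (if I \<inter> J = {} then axis (I \<union> J) (shuffle_sign I J * r * s) else 0) $ K"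
    by (cases "I \<subseteq> K") (auto simp: axis_wedge_nth axis_nth_if)
qed

lemma wedge_one_left: "wedge_one \<^bold>\<and> a = a"
  by (simp add: vec_eq_iff wedge_one_def axis_wedge_nth)

lemma wedge_one_right: "a \<^bold>\<and> wedge_one = a"
  by (simp add: vec_eq_iff wedge_one_def wedge_axis_nth)

lemma wedge_add_left: "(a + b) \<^bold>\<and> c = a \<^bold>\<and> c + b \<^bold>\<and> c"
  by (simp add: vec_eq_iff wedge_def algebra_simps sum.distrib)

lemma wedge_add_right: "c \<^bold>\<and> (a + b) = c \<^bold>\<and> a + c \<^bold>\<and> b"
  by (simp add: vec_eq_iff wedge_def algebra_simps sum.distrib)

lemma wedge_scale_left: "(r *s a) \<^bold>\<and> b = r *s (a \<^bold>\<and> b)"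
  by (simp add: vec_eq_iff wedge_def sum_distrib_left mult_ac)

lemma wedge_scale_right: "a \<^bold>\<and> (r *s b) = r *s (a \<^bold>\<and> b)"
  by (simp add: vec_eq_iff wedge_def sum_distrib_left mult_ac)

definition even_form :: "'n::{finite,linorder} cform \<Rightarrow> bool" where
  "even_form a \<longleftrightarrow> (\<forall>K. odd (card K) \<longrightarrow> a $ K = 0)"

text \<open>Exchanging two blocks \<open>I\<close> and \<open>J\<close> costs the sign \<open>(-1)\<close> to
  the power \<open>|I| |J|\<close>, which is trivial when \<open>|I|\<close> is even.\<close>

lemma even_form_wedge_commute:
  assumes "even_form a" shows "a \<^bold>\<and> b = b \<^bold>\<and> a"
proof (rule vec_eq_iff[THEN iffD2], rule allI)
  fix K
  have *: "shuffle_sign I (K - I) * a $ I * b $ (K - I) = shuffle_sign (K - I) I * b $ (K - I) * a $ I" for I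
  proof (cases "even (card I)")
    case True
    have "shuffle_sign I (K - I) * shuffle_sign (K - I) I = 1"
      using shuffle_sign_swap[of I "K - I"] True by (simp add: power_mult)
    moreover have "shuffle_sign I (K - I) * shuffle_sign I (K - I) = 1"
      by (simp add: shuffle_sign_def flip: power_mult_distrib)
    ultimately have "shuffle_sign I (K - I) = shuffle_sign (K - I) I"
      by (metis mult.commute mult.left_commute mult.right_neutral)
    then show ?thesis by simp
  next
    case False
    then show ?thesis using assms by (simp add: even_form_def)
  qed
  have "(a \<^bold>\<and> b) $ K = (\<Sum>I\<in>Pow K. shuffle_sign (K - I) I * b $ (K - I) * a $ I)"
    by (simp add: wedge_def *)
  also have "\<dots> = (\<Sum>I\<in>Pow K. shuffle_sign I (K - I) * b $ I * a $ (K - I))"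
    by (rule sum.reindex_bij_witness[where i = "\<lambda>I. K - I" and j = "\<lambda>I. K - I"])
      (auto simp: double_diff)
  finally show "(a \<^bold>\<and> b) $ K = (b \<^bold>\<and> a) $ K" by (simp add: wedge_def)
qed

text \<open>The type of forms already carries the componentwise product. On a copy, the wedge product can be
  the multiplication of a type class, so that ring arithmetic, powers and sums apply to it.\<close>

typedef (overloaded) 'n exterior = "UNIV :: 'n::{finite,linorder} cform set" by simp
setup_lifting type_definition_exterior

instantiation exterior :: ("{finite,linorder}") ring_1
begin
lift_definition zero_exterior :: "'a exterior" is 0 .
lift_definition one_exterior :: "'a exterior" is wedge_one .
lift_definition plus_exterior :: "'a exterior \<Rightarrow> 'a exterior \<Rightarrow> 'a exterior" is "(+)" .
lift_definition minus_exterior :: "'a exterior \<Rightarrow> 'a exterior \<Rightarrow> 'a exterior" is "(-)" .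
lift_definition uminus_exterior :: "'a exterior \<Rightarrow> 'a exterior" is uminus .
lift_definition times_exterior :: "'a exterior \<Rightarrow> 'a exterior \<Rightarrow> 'a exterior" is "(\<^bold>\<and>)" .
instance
proof
  show "(0::'a exterior) \<noteq> 1"
    by transfer (simp add: wedge_one_def vec_eq_iff axis_def)
qed (transfer; simp add: add.assoc add.commute wedge_assoc wedge_one_left wedge_one_right wedge_add_left wedge_add_right)+
end

lift_definition to_ext :: "'n::{finite,linorder} cform \<Rightarrow> 'n exterior" is "\<lambda>a. a" .
text \<open>The scalars as a central subring, which takes the place of scalar multiplication.\<close>

lift_definition sc :: "complex \<Rightarrow> 'n::{finite,linorder} exterior" is "\<lambda>c. c *s wedge_one" .

lemma to_ext_inject [simp]: "to_ext a = to_ext b \<longleftrightarrow> a = b"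
  by transfer simp
lemma to_ext_simps: "to_ext 0 = 0" "to_ext (a + b) = to_ext a + to_ext b"
    "to_ext (a - b) = to_ext a - to_ext b" "to_ext (- a) = - to_ext a"
    "to_ext (a \<^bold>\<and> b) = to_ext a * to_ext b" "to_ext (c *s a) = sc c * to_ext a"
    "to_ext wedge_one = 1"
  by (transfer, simp add: wedge_scale_left wedge_one_left)+
lemma to_ext_eq_0_iff [simp]: "to_ext a = 0 \<longleftrightarrow> a = 0"
  by transfer simp
lemma to_ext_sum: "to_ext (\<Sum>i\<in>S. f i) = (\<Sum>i\<in>S. to_ext (f i))"
  by (induction S rule: infinite_finite_induct) (simp_all add: to_ext_simps)
lemma to_ext_power: "to_ext (wedge_power a k) = to_ext a ^ k"
  by (induction k) (simp_all add: wedge_power_def to_ext_simps)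

lemma sc_simps: "sc 0 = 0" "sc 1 = 1" "sc (a + b) = sc a + sc b" "sc (a - b) = sc a - sc b"
    "sc (- a) = - sc a" "sc (a * b) = sc a * sc b"
  by (transfer, simp add: wedge_scale_left wedge_scale_right wedge_one_left vector_smult_assoc vector_sadd_rdistrib vector_ssub_ldistrib vector_sub_rdistrib)+
lemma sc_sum: "sc (\<Sum>i\<in>S. f i) = (\<Sum>i\<in>S. sc (f i))"
  by (induction S rule: infinite_finite_induct) (simp_all add: sc_simps)
lemma sc_of_nat: "sc (of_nat m) = of_nat m"
  by (induction m) (simp_all add: sc_simps)
lemma sc_central: "x * sc c = sc c * x"
  by transfer (simp add: wedge_scale_left wedge_scale_right wedge_one_left wedge_one_right)
lemma sc_left_commute: "x * (sc c * y) = sc c * (x * y)"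
  by (metis sc_central mult.assoc)
lemma sc_mult_eq_0_iff: "sc c * x = 0 \<longleftrightarrow> c = 0 \<or> x = 0"
proof
  assume "sc c * x = 0"
  then show "c = 0 \<or> x = 0"
    by transfer (simp add: wedge_scale_left wedge_one_left)
qed (auto simp: sc_simps)

lift_definition cv :: "'n::{finite,linorder} covec \<Rightarrow> 'n exterior" is covector .
lemma to_ext_covector: "to_ext (covector e) = cv e" by transfer simp

lemma cv_anticommute: "cv e * cv f = - (cv f * cv e)"
proof (transfer, goal_cases)
  case (1 e f)
  show ?case
  proof (cases "e = f")
    case False
    have "{(i, j). i = e \<and> j = f \<and> j < i} = (if f < e then {(e,f)} else {})" by auto
    moreover have "{(i, j). i = f \<and> j = e \<and> j < i} = (if e < f then {(f,e)} else {})" by auto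
    ultimately have "shuffle_sign {e} {f} = - shuffle_sign {f} {e}"
      using False by (auto simp: shuffle_sign_def neq_iff)
    then show ?thesis using False
      by (auto simp: covector_def axis_wedge_axis insert_commute vec_eq_iff axis_nth_if)
  qed (simp add: covector_def axis_wedge_axis)
qed

text \<open>Such a product is a basis monomial up to sign.\<close>

lemma prod_list_cv_nonzero:
  assumes "distinct xs"
  shows "prod_list (map cv xs) \<noteq> (0::'n::{finite,linorder} exterior)"
proof -
  have "\<exists>r. r \<noteq> 0 \<and> prod_list (map cv xs) = to_ext (axis (set xs) r)" using assms
  proof (induction xs)
    case Nil
    then show ?case by (intro exI[of _ 1]) (simp add: wedge_one_def[symmetric] to_ext_simps)
  next
    case (Cons x xs)
    then obtain r where r: "r \<noteq> 0" "prod_list (map cv xs) = to_ext (axis (set xs) r)" by auto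
    have "prod_list (map cv (x # xs)) = to_ext (covector x \<^bold>\<and> axis (set xs) r)"
      by (simp add: r to_ext_simps to_ext_covector)
    also have "covector x \<^bold>\<and> axis (set xs) r = axis (set (x # xs)) (shuffle_sign {x} (set xs) * r)"
      using Cons.prems by (simp add: covector_def axis_wedge_axis)
    finally show ?case using r(1)
      by (intro exI[of _ "shuffle_sign {x} (set xs) * r"]) (simp add: shuffle_sign_def)
  qed
  then show ?thesis by (metis axis_nth to_ext_eq_0_iff zero_index)
qed

lemma even_form_pair: "even_form (covector e \<^bold>\<and> covector f)"
proof -
  have "odd (card K) \<Longrightarrow> K \<noteq> {e,f} \<or> e = f" for K by (cases "e = f") auto
  then show ?thesis
    by (auto simp: even_form_def covector_def axis_wedge_axis axis_nth_if)
qed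

section \<open>Powers of sums of square-zero elements\<close>

text \<open>After expanding the power, each monomial contains a factor with index in \<open>S\<close>, which
  \<open>X\<close> kills, or a repeated factor, which is zero, because there are fewer than
  \<open>m\<close> indices outside \<open>S\<close>.\<close>

lemma sum_nilpotent_power_vanishes:
  fixes w :: "'i::finite \<Rightarrow> 'r::ring_1"
  assumes comm: "\<And>a b. w a * w b = w b * w a" and sq: "\<And>a. w a * w a = 0"
    and "\<And>c. c \<in> S \<Longrightarrow> X * w c = 0" and "card (- S) < m"
  shows "X * (\<Sum>c. w c) ^ m = 0"
  using assms(3,4)
proof (induction m arbitrary: X S)
  case (Suc m)
  have "X * w c * (\<Sum>c. w c) ^ m = 0" for c
  proof (cases "c \<in> S")
    case False
    have "card (- insert c S) < m"
    proof -
      have "- S = insert c (- insert c S)" using False by auto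
      then show ?thesis using Suc.prems(2)
        by (metis Compl_iff Suc_less_SucD card_insert_disjoint finite insertI1)
    qed
    moreover have "X * w c * w d = 0" if "d \<in> insert c S" for d
    proof (cases "d = c")
      case True then show ?thesis by (simp add: mult.assoc sq)
    next
      case False
      then have "X * w d = 0" using Suc.prems(1) that by blast
      moreover have "X * w c * w d = X * w d * w c" by (simp add: mult.assoc comm)
      ultimately show ?thesis by simp
    qed
    ultimately show ?thesis using Suc.IH[of "insert c S" "X * w c"] by blast
  qed (simp add: Suc.prems)
  then show ?case by (simp add: sum_distrib_left sum_distrib_right flip: mult.assoc)
qed simp

text \<open>If there are exactly \<open>m + 1\<close> indices outside \<open>S\<close>, the only monomials
  that survive use each of them once. They are all equal, so any index \<open>a\<close> may be the
  one that is split off, at the price of a factor \<open>m + 1\<close>.\<close>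

lemma sum_nilpotent_power_factor:
  fixes w :: "'i::finite \<Rightarrow> 'r::ring_1"
  assumes comm: "\<And>a b. w a * w b = w b * w a" and sq: "\<And>a. w a * w a = 0"
    and "\<And>c. c \<in> S \<Longrightarrow> X * w c = 0" and "card (- S) = Suc m" and "a \<notin> S"
  shows "X * (\<Sum>c. w c) ^ Suc m = of_nat (Suc m) * (X * w a * (\<Sum>c. w c) ^ m)"
  using assms(3-5)
proof (induction m arbitrary: X S a)
  case 0
  then have "- S = {a}" by (metis One_nat_def Compl_iff card_1_singletonE singletonD)
  then have "X * w c = 0" if "c \<noteq> a" for c using that 0(1) by blast
  then have "(\<Sum>c. X * w c) = (\<Sum>c. if c = a then X * w a else 0)"
    by (intro sum.cong) auto
  then show ?case by (simp add: sum_distrib_left)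
next
  case (Suc m)
  let ?W = "\<Sum>c. w c"
  have step: "X * w c * ?W ^ Suc m = of_nat (Suc m) * (X * w c * w d * ?W ^ m)"
    if "c \<notin> S" "d \<notin> S" "c \<noteq> d" for c d
  proof (rule Suc.IH[of "insert c S"])
    have "- S = insert c (- insert c S)" using that by auto
    then show "card (- insert c S) = Suc m" using Suc.prems(2)
      by (metis Compl_iff card_insert_disjoint finite insertI1 nat.inject)
    show "X * w c * w e = 0" if "e \<in> insert c S" for e
    proof (cases "e = c")
      case True then show ?thesis by (simp add: mult.assoc sq)
    next
      case False
      then have "X * w e = 0" using Suc.prems(1) that by blast
      moreover have "X * w c * w e = X * w e * w c" by (simp add: mult.assoc comm)
      ultimately show ?thesis by simp
    qed
  qed (use that in auto)
  (* Splitting off one more factor on either side gives the same product of two factors. *)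
  have eq: "X * w c * ?W ^ Suc m = X * w a * ?W ^ Suc m" if "c \<notin> S" for c
  proof (cases "c = a")
    case False
    have "X * w c * w a = X * w a * w c" by (simp add: mult.assoc comm)
    then show ?thesis using step[of c a] step[of a c] that False Suc.prems(3) by simp
  qed simp
  have "X * ?W ^ Suc (Suc m) = (X * ?W) * ?W ^ Suc m"
    by (simp only: power_Suc mult.assoc)
  also have "\<dots> = (\<Sum>c. X * w c * ?W ^ Suc m)"
    by (simp only: sum_distrib_left[of X] sum_distrib_right)
  also have "\<dots> = (\<Sum>c\<in>- S. X * w c * ?W ^ Suc m)"
    by (rule sum.mono_neutral_right) (use Suc.prems in auto)
  also have "\<dots> = (\<Sum>c\<in>- S. X * w a * ?W ^ Suc m)"
    by (rule sum.cong) (use eq in auto)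
  also have "\<dots> = of_nat (Suc (Suc m)) * (X * w a * ?W ^ Suc m)"
    by (simp only: sum_constant Suc.prems)
  finally show ?case .
qed

lemma exterior_double_eq_0: "x + x = 0 \<Longrightarrow> x = (0::'n::{finite,linorder} exterior)"
proof -
  assume x: "x + x = 0"
  have "sc 2 * x = 0"
  proof -
    have "sc 2 = (2::'n exterior)" using sc_of_nat[of 2] by simp
    then show ?thesis using x by (simp add: mult_2)
  qed
  then show "x = 0" by (simp add: sc_mult_eq_0_iff)
qed

lemma cv_pair_central: "cv e * cv f * x = x * (cv e * cv f)"
proof -
  have "to_ext (covector e \<^bold>\<and> covector f) * x = x * to_ext (covector e \<^bold>\<and> covector f)"
    by transfer (simp add: even_form_wedge_commute even_form_pair)
  then show ?thesis by (simp add: to_ext_simps to_ext_covector)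
qed

text \<open>An arbitrary basis of the covectors. The two coefficient matrices express that it and the
  coordinate basis span the same space.\<close>

locale covec_basis =
  fixes F :: "'n::{finite,linorder} covec \<Rightarrow> 'n exterior" and M N :: "'n covec \<Rightarrow> 'n covec \<Rightarrow> complex"
  assumes F_cv: "F e = (\<Sum>f. sc (M e f) * cv f)"
    and cv_F: "cv e = (\<Sum>f. sc (N e f) * F f)"
begin

lemma F_mult: "F e * F f = (\<Sum>g g'. sc (M e g * M f g') * (cv g * cv g'))"
  unfolding F_cv sum_product
  by (intro sum.cong refl) (simp add: sc_simps mult.assoc sc_left_commute[of "cv _"])

lemma F_anticommute: "F e * F f = - (F f * F e)"
proof -
  have "F e * F f = (\<Sum>g g'. - (sc (M f g' * M e g) * (cv g' * cv g)))"
    unfolding F_mult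
  proof (intro sum.cong refl)
    fix g g'
    show "sc (M e g * M f g') * (cv g * cv g') = - (sc (M f g' * M e g) * (cv g' * cv g))"
      by (subst cv_anticommute) (simp add: mult.commute)
  qed
  also have "\<dots> = - (\<Sum>g' g. (sc (M f g' * M e g) * (cv g' * cv g)))"
    unfolding sum_negf by (subst sum.swap) simp
  finally show ?thesis by (simp add: F_mult)
qed

lemma F_square: "F e * F e = 0"
  using F_anticommute[of e e] exterior_double_eq_0 eq_neg_iff_add_eq_0 by blast

lemma F_pair_central: "F e * F f * x = x * (F e * F f)"
proof -
  have "sc c * (cv g * cv g') * x = x * (sc c * (cv g * cv g'))" for c g g'
    using cv_pair_central[of g g' x] by (simp add: mult.assoc sc_left_commute)
  then show ?thesis by (simp add: F_mult sum_distrib_left sum_distrib_right)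
qed

abbreviation Fp :: "'n covec list \<Rightarrow> 'n exterior" where
  "Fp xs \<equiv> prod_list (map F xs)"

lemma F_Fp_commute: "F x * Fp xs = Fp xs * F x \<or> F x * Fp xs = - (Fp xs * F x)"
proof (induction xs)
  case (Cons y xs)
  have "F x * Fp (y # xs) = - (F y * (F x * Fp xs))"
    by (simp add: F_anticommute[of x y] flip: mult.assoc)
  then show ?case using Cons by (auto simp: mult.assoc)
qed simp

lemma Fp_not_distinct: "\<not> distinct xs \<Longrightarrow> Fp xs = 0"
proof -
  assume "\<not> distinct xs"
  then obtain as bs cs y where xs: "xs = as @ [y] @ bs @ [y] @ cs"
    by (metis not_distinct_decomp)
  have *: "F y * Fp bs * F y = 0"
  proof -
    have "Fp bs * F y * F y = 0" by (simp add: mult.assoc F_square)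
    then show ?thesis using F_Fp_commute[of y bs] by auto
  qed
  have "F y * (Fp bs * (F y * z)) = 0" for z
  proof -
    have "F y * (Fp bs * (F y * z)) = (F y * Fp bs * F y) * z" by (simp only: mult.assoc)
    then show ?thesis by (simp add: *)
  qed
  then show ?thesis by (simp add: xs)
qed

lemma Fp_permute: "mset xs = mset ys \<Longrightarrow> Fp xs = Fp ys \<or> Fp xs = - Fp ys"
proof (induction xs arbitrary: ys)
  case (Cons x xs)
  then have "x \<in> set ys" by (metis list.set_intros(1) set_mset_mset)
  then obtain as bs where ys: "ys = as @ x # bs" by (metis split_list)
  then have "Fp xs = Fp (as @ bs) \<or> Fp xs = - Fp (as @ bs)"
    using Cons by (intro Cons.IH) simp
  moreover have "Fp ys = F x * Fp (as @ bs) \<or> Fp ys = - (F x * Fp (as @ bs))"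
    using F_Fp_commute[of x as] by (auto simp: ys minus_equation_iff simp flip: mult.assoc)
  ultimately show ?case by auto
qed simp

text \<open>In a unitary coframe these are the summands
  \<open>\<i> \<theta>\<^sub>a \<and> cnj \<theta>\<^sub>a\<close> of the fundamental form
  \<open>W\<close>.\<close>

definition w :: "'n \<Rightarrow> 'n exterior" where "w a = sc \<i> * (F (Dz a) * F (Dzbar a))"
definition W :: "'n exterior" where "W = (\<Sum>a. w a)"

lemma w_central: "w a * x = x * w a"
  using F_pair_central[of "Dz a" "Dzbar a" x] by (simp add: w_def mult.assoc sc_left_commute)

lemma W_central: "W * x = x * W"
  by (simp add: W_def sum_distrib_left sum_distrib_right w_central)

lemma W_power_central: "W ^ m * x = x * W ^ m"
  by (induction m) (simp_all add: mult.assoc W_central, metis W_central mult.assoc)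

lemma F_w: "F (Dz a) * w a = 0" "F (Dzbar a) * w a = 0"
proof -
  have "F (Dz a) * (F (Dz a) * F (Dzbar a)) = 0"
    by (simp add: F_square flip: mult.assoc)
  then show "F (Dz a) * w a = 0" by (simp add: w_def sc_left_commute sc_simps)
  have "F (Dzbar a) * (F (Dz a) * F (Dzbar a)) = 0"
    using F_pair_central[of "Dz a" "Dzbar a" "F (Dzbar a)"] by (simp add: mult.assoc F_square)
  then show "F (Dzbar a) * w a = 0" by (simp add: w_def sc_left_commute sc_simps)
qed

lemma w_square: "w a * w a = 0"
proof -
  have "w a * w a = sc \<i> * (F (Dz a) * (F (Dzbar a) * w a))" by (simp add: w_def mult.assoc)
  then show ?thesis by (simp add: F_w)
qed

lemma Fp_w: "Dz a \<in> set xs \<or> Dzbar a \<in> set xs \<Longrightarrow> Fp xs * w a = 0"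
proof (induction xs)
  case (Cons x xs)
  show ?case
  proof (cases "x = Dz a \<or> x = Dzbar a")
    case True
    have "Fp (x # xs) * w a = F x * w a * Fp xs" by (simp add: mult.assoc w_central)
    then show ?thesis using True F_w by auto
  next
    case False
    then show ?thesis using Cons by (auto simp: mult.assoc)
  qed
qed simp

lemmas power_vanishes = sum_nilpotent_power_vanishes[of w, OF w_central w_square, folded W_def]
lemmas power_factor = sum_nilpotent_power_factor[of w, OF w_central w_square, folded W_def]

text \<open>The product of the \<open>F e\<close> kills as many summands of \<open>W\<close> as there are
  different indices in it.\<close>

lemma Fp_W_vanishes:
  assumes "S = {a. Dz a \<in> set xs \<or> Dzbar a \<in> set xs}" "CARD('n) - card S < m"
  shows "Fp xs * W ^ m = 0"
proof (rule power_vanishes[of S])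
  show "card (- S) < m" using assms(2) by (simp add: Compl_eq_Diff_UNIV card_Diff_subset)
qed (use Fp_w assms(1) in auto)

text \<open>The power is a nonzero multiple of the product of the whole basis. If that product vanished, so
  would every product of \<open>2n\<close> basis elements; expanding the coordinate covectors in the
  basis one after the other, their product would vanish as well.\<close>

lemma W_power_card_nonzero: "W ^ CARD('n) \<noteq> 0"
proof
  assume W0: "W ^ CARD('n) = 0"
  have expand: "\<exists>c. c \<noteq> 0 \<and> W ^ CARD('n) =
      sc c * Fp (concat (map (\<lambda>a. [Dz a, Dzbar a]) as)) * W ^ (CARD('n) - length as)"
    if "distinct as" for as :: "'n list" using that
  proof (induction as rule: rev_induct)
    case Nil
    then show ?case by (intro exI[of _ 1]) (simp add: sc_simps)
  next
    case (snoc a as)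
    let ?L = "concat (map (\<lambda>a. [Dz a, Dzbar a]) as)"
    obtain c where c: "c \<noteq> 0" "W ^ CARD('n) = sc c * Fp ?L * W ^ (CARD('n) - length as)"
      using snoc by auto
    have len: "length as < CARD('n)"
      using card_mono[of UNIV "set (as @ [a])"] distinct_card[OF snoc.prems] by simp
    then obtain m where m: "CARD('n) - length as = Suc m" by (metis Suc_diff_Suc)
    have "Fp ?L * W ^ Suc m = of_nat (Suc m) * (Fp ?L * w a * W ^ m)"
    proof (rule power_factor[of "set as"])
      show "Fp ?L * w b = 0" if "b \<in> set as" for b
        using that by (intro Fp_w) auto
      show "card (- set as) = Suc m" using snoc.prems m by (simp add: Compl_eq_Diff_UNIV card_Diff_subset distinct_card)
    qed (use snoc.prems in auto)
    also have "Fp ?L * w a = sc \<i> * Fp (concat (map (\<lambda>a. [Dz a, Dzbar a]) (as @ [a])))"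
      by (simp add: w_def sc_left_commute mult.assoc)
    finally have "W ^ CARD('n) = sc (c * of_nat (Suc m) * \<i>) *
        Fp (concat (map (\<lambda>a. [Dz a, Dzbar a]) (as @ [a]))) * W ^ m"
      unfolding c(2) m sc_simps sc_of_nat by (simp only: mult.assoc)
    moreover have "CARD('n) - length (as @ [a]) = m" using m by simp
    ultimately show ?case using c(1)
      by (intro exI[of _ "c * of_nat (Suc m) * \<i>"]) (simp del: of_nat_Suc)
  qed
  obtain as :: "'n list" where as: "set as = UNIV" "distinct as"
    using finite_distinct_list[of "UNIV :: 'n set"] by auto
  have las: "length as = CARD('n)" using as distinct_card by fastforce
  define L where "L = concat (map (\<lambda>a. [Dz a, Dzbar a]) as)"
  have setL: "set L = UNIV"
    using as(1) by (auto simp: L_def) (metis covec.exhaust UNIV_I)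
  have lenL: "length L = 2 * CARD('n)"
    by (simp add: L_def length_concat o_def sum_list_triv las)
  have distL: "distinct L"
    using as(2) unfolding L_def by (induction as) auto
  have FL: "Fp L = 0"
    using expand[OF as(2)] W0 las
    by (auto simp flip: L_def simp: mult.assoc sc_mult_eq_0_iff)
  have all0: "Fp xs = 0" if "length xs = length L" for xs
  proof (cases "distinct xs")
    case True
    then have "card (set xs) = card (set L)" using that distL by (simp add: distinct_card)
    then have "set xs = set L" unfolding setL by (intro card_subset_eq) auto
    then have "mset xs = mset L" using True distL by (simp add: set_eq_iff_mset_eq_distinct)
    then show ?thesis using Fp_permute[of xs L] FL by auto
  qed (rule Fp_not_distinct)
  (* Replace the coordinate covectors in the tail by basis elements, one at a time. *)
  have "Fp xs * prod_list (map cv ys) = 0" if "length xs + length ys = length L" for xs ys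
    using that
  proof (induction ys arbitrary: xs)
    case (Cons y ys)
    have "Fp xs * prod_list (map cv (y # ys)) = (\<Sum>f. sc (N y f) * (Fp (xs @ [f]) * prod_list (map cv ys)))"
      by (simp add: cv_F[of y] sum_distrib_left sum_distrib_right mult.assoc sc_left_commute)
    also have "\<dots> = 0"
    proof (rule sum.neutral, rule ballI)
      fix f
      have "Fp (xs @ [f]) * prod_list (map cv ys) = 0" using Cons.prems by (intro Cons.IH) simp
      then show "sc (N y f) * (Fp (xs @ [f]) * prod_list (map cv ys)) = 0" by simp
    qed
    finally show ?case .
  qed (use all0 in simp)
  from this[of "[]" L] prod_list_cv_nonzero[OF distL] show False by simp
qed

end

section \<open>The Hodge--Riemann relation for primitive (2,1)-forms\<close>

text \<open>The determinant of the three by three matrix of Kronecker symbols with rows \<open>a, b, f\<close>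
  and columns \<open>c, d, e\<close>.\<close>

definition kron3 :: "'i \<Rightarrow> 'i \<Rightarrow> 'i \<Rightarrow> 'i \<Rightarrow> 'i \<Rightarrow> 'i \<Rightarrow> complex" where
  "kron3 a b f c d e = of_bool (a = c) * of_bool (b = d) * of_bool (f = e)
     - of_bool (a = c) * of_bool (b = e) * of_bool (f = d)
     - of_bool (a = d) * of_bool (b = c) * of_bool (f = e)
     + of_bool (a = d) * of_bool (b = e) * of_bool (f = c)
     + of_bool (a = e) * of_bool (b = c) * of_bool (f = d)
     - of_bool (a = e) * of_bool (b = d) * of_bool (f = c)"

context covec_basis
begin

lemma F_swap: "F x * (F y * z) = - (F y * (F x * z))"
  by (metis F_anticommute mult.assoc mult_minus_left)

text \<open>If an index is repeated within \<open>a, b, f\<close> or within \<open>c, d, e\<close>, both sides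
  vanish. If \<open>c, d, e\<close> is not a permutation of \<open>a, b, f\<close>, the product
  involves at least four indices and the remaining power of \<open>W\<close> is too high. Otherwise
  sorting reduces the claim to \<open>(c, d, e) = (a, b, f)\<close>, where three summands of
  \<open>W\<close> have been split off from its \<open>n\<close>-th power; the constant collects the
  three multiplicities and the powers of \<open>\<i>\<close>.\<close>

lemma Fp_W_three:
  assumes "3 \<le> CARD('n)"
  shows "Fp [Dz a, Dz b, Dz f, Dzbar c, Dzbar d, Dzbar e] * W ^ (CARD('n) - 3) =
    sc (kron3 a b f c d e * (-\<i> / (of_nat CARD('n) * of_nat (CARD('n) - 1) * of_nat (CARD('n) - 2)))) * W ^ CARD('n)"
proof -
  define m where "m = CARD('n) - 3"
  have n: "CARD('n) = Suc (Suc (Suc m))" using assms by (simp add: m_def)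
  define k :: complex where "k = - \<i> / (of_nat (Suc (Suc (Suc m))) * of_nat (Suc (Suc m)) * of_nat (Suc m))"
  let ?Q = "\<lambda>a b f c d e. Fp [Dz a, Dz b, Dz f, Dzbar c, Dzbar d, Dzbar e] * W ^ m"
  have diag: "?Q a b f a b f = sc k * W ^ CARD('n)" if "a \<noteq> b" "a \<noteq> f" "b \<noteq> f" for a b f
  proof -
    have c1: "card (- {a}) = Suc (Suc m)" using n by (simp add: Compl_eq_Diff_UNIV)
    have c2: "card (- {a,b}) = Suc m" using n that by (simp add: Compl_eq_Diff_UNIV card_Diff_subset)
    have wz: "w a * (w b * w a) = 0"
      by (simp add: w_central[of b "w a"] w_square flip: mult.assoc)
    have "W ^ CARD('n) = of_nat (Suc (Suc (Suc m))) * (w a * W ^ Suc (Suc m))"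
      using power_factor[of "{}" 1 "Suc (Suc m)" a] n by simp
    also have "w a * W ^ Suc (Suc m) = of_nat (Suc (Suc m)) * (w a * w b * W ^ Suc m)"
      using c1 that by (intro power_factor[of "{a}"]) (auto simp: w_square)
    also have "w a * w b * W ^ Suc m = of_nat (Suc m) * (w a * w b * w f * W ^ m)"
      using c2 that by (intro power_factor[of "{a, b}"]) (auto simp: wz w_square mult.assoc)
    also have "w a * w b * w f = - (sc \<i> * (F (Dz a) * (F (Dzbar a) * (F (Dz b) * (F (Dzbar b) * (F (Dz f) * F (Dzbar f)))))))"
    proof -
      have "w a * w b * w f = sc (\<i> * \<i> * \<i>) * (F (Dz a) * (F (Dzbar a) * (F (Dz b) * (F (Dzbar b) * (F (Dz f) * F (Dzbar f))))))"
        by (simp only: w_def sc_simps mult.assoc sc_left_commute[of "F _"])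
      also have "\<i> * \<i> * \<i> = - \<i>" by simp
      finally show ?thesis by (simp only: sc_simps mult_minus_left)
    qed
    also have "F (Dz a) * (F (Dzbar a) * (F (Dz b) * (F (Dzbar b) * (F (Dz f) * F (Dzbar f))))) =
        - Fp [Dz a, Dz b, Dz f, Dzbar a, Dzbar b, Dzbar f]"
      by (simp add: F_swap[of "Dzbar _" "Dz _"])
    finally have "W ^ CARD('n) = sc (of_nat (Suc (Suc (Suc m))) * of_nat (Suc (Suc m)) * of_nat (Suc m) * \<i>) * ?Q a b f a b f"
      by (simp only: sc_simps sc_of_nat mult.assoc mult_minus_left mult_minus_right minus_minus)
    then have "sc k * W ^ CARD('n) = sc (k * (of_nat (Suc (Suc (Suc m))) * of_nat (Suc (Suc m)) * of_nat (Suc m) * \<i>)) * ?Q a b f a b f"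
      by (simp only: sc_simps mult.assoc)
    moreover have "k * (of_nat (Suc (Suc (Suc m))) * of_nat (Suc (Suc m)) * of_nat (Suc m) * \<i>) = 1"
      by (simp add: k_def field_simps del: of_nat_Suc)
    ultimately show ?thesis by (simp only: sc_simps(2) mult_1_left)
  qed
  have "?Q a b f c d e = sc (kron3 a b f c d e * k) * W ^ CARD('n)"
  proof (cases "a = b \<or> a = f \<or> b = f \<or> c = d \<or> c = e \<or> d = e")
    case True
    then have "\<not> distinct [Dz a, Dz b, Dz f, Dzbar c, Dzbar d, Dzbar e]" by auto
    then have "?Q a b f c d e = 0" by (subst Fp_not_distinct) auto
    moreover have "kron3 a b f c d e = 0" using True by (auto simp: kron3_def)
    ultimately show ?thesis by (simp add: sc_simps)
  next
    case distinct: False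
    show ?thesis
    proof (cases "{c, d, e} \<subseteq> {a, b, f}")
      case True
      then consider "c = a" "d = b" "e = f" | "c = a" "d = f" "e = b" | "c = b" "d = a" "e = f"
        | "c = b" "d = f" "e = a" | "c = f" "d = a" "e = b" | "c = f" "d = b" "e = a"
        using distinct by auto
      then show ?thesis
      proof cases
        case 1 then show ?thesis using diag[of a b f] distinct by (simp add: kron3_def)
      next
        case 2
        have "?Q a b f c d e = - ?Q a b f a b f"
          by (simp add: 2 F_anticommute[of "Dzbar f"])
        then show ?thesis using diag[of a b f] distinct by (simp add: kron3_def 2 sc_simps)
      next
        case 3
        have "?Q a b f c d e = - ?Q a b f a b f"
          by (simp add: 3 F_swap[of "Dzbar b" "Dzbar a"])
        then show ?thesis using diag[of a b f] distinct by (simp add: kron3_def 3 sc_simps)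
      next
        case 4
        have "?Q a b f c d e = ?Q a b f a b f"
          by (simp add: 4 F_anticommute[of "Dzbar f" "Dzbar a"] F_swap[of "Dzbar b" "Dzbar a"])
        then show ?thesis using diag[of a b f] distinct by (simp add: kron3_def 4 sc_simps)
      next
        case 5
        have "?Q a b f c d e = ?Q a b f a b f"
          by (simp add: 5 F_anticommute[of "Dzbar f" "Dzbar b"] F_swap[of "Dzbar f" "Dzbar a"])
        then show ?thesis using diag[of a b f] distinct by (simp add: kron3_def 5 sc_simps)
      next
        case 6
        have "?Q a b f c d e = - ?Q a b f a b f"
          by (simp add: 6 F_anticommute[of "Dzbar b" "Dzbar a"] F_swap[of "Dzbar f" "Dzbar a"]
              F_anticommute[of "Dzbar f" "Dzbar b"])
        then show ?thesis using diag[of a b f] distinct by (simp add: kron3_def 6 sc_simps)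
      qed
    next
      case False
      (* The index g does not occur among a, b, f, so that at least four indices occur. *)
      then obtain g where g: "g \<in> {c, d, e}" "g \<notin> {a, b, f}" by blast
      have "card {a, b, f, g} \<le> card {a, b, f, c, d, e}"
        using g by (intro card_mono) auto
      moreover have "card {a, b, f, g} = 4" using g distinct by auto
      ultimately have 4: "4 \<le> card {a, b, f, c, d, e}" by linarith
      have "?Q a b f c d e = 0"
      proof (rule Fp_W_vanishes)
        show "{a, b, f, c, d, e} = {x. Dz x \<in> set [Dz a, Dz b, Dz f, Dzbar c, Dzbar d, Dzbar e] \<or>
            Dzbar x \<in> set [Dz a, Dz b, Dz f, Dzbar c, Dzbar d, Dzbar e]}" by auto
        have "card {a, b, f, c, d, e} \<le> CARD('n)" by (intro card_mono) auto
        then show "CARD('n) - card {a, b, f, c, d, e} < m" using 4 n by linarith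
      qed
      moreover have "kron3 a b f c d e = 0" using g by (auto simp: kron3_def)
      ultimately show ?thesis by (simp add: sc_simps)
    qed
  qed
  then show ?thesis by (simp add: k_def n)
qed

text \<open>The same counting with three covectors: only \<open>c = b\<close> or \<open>c = a\<close> leaves
  few enough indices for the power of \<open>W\<close>.\<close>

lemma Fp_W_two:
  assumes "3 \<le> CARD('n)"
  shows "Fp [Dzbar a, Dz c, Dzbar b] * W ^ (CARD('n) - 2) =
    sc (of_bool (c = b) * (- \<i> / of_nat (CARD('n) - 1))) * (F (Dzbar a) * W ^ (CARD('n) - 1)) -
    sc (of_bool (c = a) * (- \<i> / of_nat (CARD('n) - 1))) * (F (Dzbar b) * W ^ (CARD('n) - 1))"
proof -
  define m where "m = CARD('n) - 2"
  have n: "CARD('n) = Suc (Suc m)" "m \<ge> 1" using assms by (auto simp: m_def)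
  define k :: complex where "k = - \<i> / of_nat (Suc m)"
  let ?Q = "\<lambda>a c b. Fp [Dzbar a, Dz c, Dzbar b] * W ^ m"
  have diag: "?Q a b b = sc k * (F (Dzbar a) * W ^ Suc m)" if "a \<noteq> b" for a b
  proof -
    have "F (Dzbar a) * W ^ Suc m = of_nat (Suc m) * (F (Dzbar a) * w b * W ^ m)"
      using n that by (intro power_factor[of "{a}"]) (auto simp: F_w Compl_eq_Diff_UNIV)
    also have "F (Dzbar a) * w b = sc \<i> * Fp [Dzbar a, Dz b, Dzbar b]"
      by (simp add: w_def sc_left_commute)
    finally have "F (Dzbar a) * W ^ Suc m = sc (of_nat (Suc m) * \<i>) * ?Q a b b"
      by (simp only: sc_simps sc_of_nat mult.assoc)
    then have "sc k * (F (Dzbar a) * W ^ Suc m) = sc (k * (of_nat (Suc m) * \<i>)) * ?Q a b b"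
      by (simp only: sc_simps mult.assoc)
    moreover have "k * (of_nat (Suc m) * \<i>) = 1"
      by (simp add: k_def field_simps del: of_nat_Suc)
    ultimately show ?thesis by (simp only: sc_simps(2) mult_1_left)
  qed
  have "?Q a c b = sc (of_bool (c = b) * k) * (F (Dzbar a) * W ^ Suc m) -
     sc (of_bool (c = a) * k) * (F (Dzbar b) * W ^ Suc m)"
  proof (cases "a = b")
    case True
    then have "?Q a c b = 0" by (subst Fp_not_distinct) auto
    then show ?thesis using True by simp
  next
    case ab: False
    consider "c = b" | "c = a" | "c \<noteq> a" "c \<noteq> b" by blast
    then show ?thesis
    proof cases
      case 1
      then show ?thesis using diag[OF ab] ab by (simp add: sc_simps)
    next
      case 2
      have "?Q a a b = - ?Q b a a"
        by (simp add: F_anticommute[of "Dz a" "Dzbar b"] F_anticommute[of "Dz a" "Dzbar a"] F_swap[of "Dzbar a" "Dzbar b"])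
      then show ?thesis using diag[of b a] 2 ab by (simp add: sc_simps)
    next
      case 3
      have 4: "card {a, b, c} = 3" using 3 ab by auto
      have "?Q a c b = 0"
      proof (rule Fp_W_vanishes)
        show "{a, b, c} = {x. Dz x \<in> set [Dzbar a, Dz c, Dzbar b] \<or>
            Dzbar x \<in> set [Dzbar a, Dz c, Dzbar b]}" by auto
        show "CARD('n) - card {a, b, c} < m" using 4 n by linarith
      qed
      then show ?thesis using 3 by (simp add: sc_simps)
    qed
  qed
  moreover have "CARD('n) - 2 = m" "CARD('n) - 1 = Suc m" by (simp_all add: n(1))
  ultimately show ?thesis by (simp only: k_def)
qed

text \<open>Multiplying by the power of \<open>W\<close> contracts the unbarred index with either barred one,
  with opposite signs. The hypothesis makes the two contractions cancel.\<close>

lemma trace_free_imp_wedge_W_zero: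
  assumes "3 \<le> CARD('n)"
    and trace: "\<And>a. (\<Sum>b. B a b b) = (\<Sum>b. B b b a)"
  shows "(\<Sum>a c b. sc (B a c b) * Fp [Dzbar a, Dz c, Dzbar b]) * W ^ (CARD('n) - 2) = 0"
proof -
  define k :: complex where "k = - \<i> / of_nat (CARD('n) - 1)"
  define Y where "Y a = sc k * (F (Dzbar a) * W ^ (CARD('n) - 1))" for a
  have Q: "Fp [Dzbar a, Dz c, Dzbar b] * W ^ (CARD('n) - 2) =
      (if c = b then Y a else 0) - (if c = a then Y b else 0)" for a b c
    unfolding Fp_W_two[OF assms(1)] Y_def k_def by (simp add: sc_simps)
  have "(\<Sum>a c b. sc (B a c b) * Fp [Dzbar a, Dz c, Dzbar b]) * W ^ (CARD('n) - 2)
     = (\<Sum>a c b. sc (B a c b) * (Fp [Dzbar a, Dz c, Dzbar b] * W ^ (CARD('n) - 2)))"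
    by (simp only: sum_distrib_right mult.assoc)
  also have "\<dots> = (\<Sum>a c. sc (B a c c) * Y a) - (\<Sum>a b. sc (B a a b) * Y b)"
  proof -
    have "(\<Sum>c b. sc (B a c b) * (if c = a then Y b else 0)) = (\<Sum>b. sc (B a a b) * Y b)" for a
      by (subst sum.swap) (simp add: if_distrib[of "\<lambda>x. _ * x"] cong: if_cong)
    moreover have "(\<Sum>b. sc (B a c b) * (if c = b then Y a else 0)) = sc (B a c c) * Y a" for a c
      by (simp add: if_distrib[of "\<lambda>x. _ * x"] cong: if_cong)
    ultimately show ?thesis unfolding Q by (simp only: right_diff_distrib sum_subtractf)
  qed
  also have "(\<Sum>a b. sc (B a a b) * Y b) = (\<Sum>b. sc (\<Sum>a. B a a b) * Y b)"
    by (subst sum.swap) (simp add: sum_distrib_right sc_sum)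
  also have "(\<Sum>a c. sc (B a c c) * Y a) = (\<Sum>a. sc (\<Sum>c. B a c c) * Y a)"
    by (simp add: sum_distrib_right sc_sum)
  finally show ?thesis by (simp add: trace)
qed

text \<open>Of the six terms of the determinant, four are products of traces of \<open>A\<close> and cancel
  when the two traces agree. The other two give the squared norm of the part of \<open>A\<close>
  that is antisymmetric in its first two indices.\<close>

lemma kron3_form:
  fixes A :: "'i::finite \<Rightarrow> 'i \<Rightarrow> 'i \<Rightarrow> complex"
  assumes trace: "\<And>a. (\<Sum>c. A a c c) = (\<Sum>c. A c a c)"
  shows "(\<Sum>a b c d e f.
      A a b c * cnj (A d e f) * kron3 a b f c d e) =
    (\<Sum>a b c. (cmod (A a b c - A b a c))\<^sup>2) / 2"
proof -
  define r where "r a = (\<Sum>c. A a c c)" for a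
  define S where "S = (\<Sum>a b c. A a b c * cnj (A a b c))"
  define S' where "S' = (\<Sum>a b c. A a b c * cnj (A b a c))"
  let ?s = "\<lambda>g. \<Sum>a b c d e f.
      A a b c * cnj (A d e f) * g a b f c d e"
  have if_conv: "x * (of_bool P * of_bool Q * of_bool R) = (if P then if Q then if R then x else 0 else 0 else 0)"
    for x :: complex and P Q R by simp
  have if_sum: "(\<Sum>x. if P then g x else 0) = (if P then sum g UNIV else 0)"
    for P and g :: "'i \<Rightarrow> complex" by simp
  have r': "(\<Sum>c. A c a c) = r a" for a by (simp add: r_def trace)
  have r'': "(\<Sum>c. cnj (A a c c)) = cnj (r a)" "(\<Sum>c. cnj (A c a c)) = cnj (r a)" for a
    by (simp_all only: cnj_sum[symmetric] r' r_def[symmetric])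
  have 1: "?s (\<lambda>a b f c d e. of_bool (a = c) * of_bool (b = d) * of_bool (f = e)) = (\<Sum>b. r b * cnj (r b))"
  proof -
    have "?s (\<lambda>a b f c d e. of_bool (a = c) * of_bool (b = d) * of_bool (f = e)) =
        (\<Sum>a b e. A a b a * cnj (A b e e))"
      by (simp add: if_conv if_sum)
    also have "\<dots> = (\<Sum>b. (\<Sum>a. A a b a) * (\<Sum>e. cnj (A b e e)))"
      by (subst sum.swap) (simp add: sum_product)
    finally show ?thesis by (simp add: r' r'')
  qed
  have 2: "?s (\<lambda>a b f c d e. of_bool (a = c) * of_bool (b = e) * of_bool (f = d)) = (\<Sum>b. r b * cnj (r b))"
  proof -
    have "?s (\<lambda>a b f c d e. of_bool (a = c) * of_bool (b = e) * of_bool (f = d)) =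
        (\<Sum>a b d. A a b a * cnj (A d b d))"
      by (simp add: if_conv if_sum)
    also have "\<dots> = (\<Sum>b. (\<Sum>a. A a b a) * (\<Sum>d. cnj (A d b d)))"
      by (subst sum.swap) (simp add: sum_product)
    finally show ?thesis by (simp add: r' r'')
  qed
  have 3: "?s (\<lambda>a b f c d e. of_bool (a = d) * of_bool (b = c) * of_bool (f = e)) = (\<Sum>b. r b * cnj (r b))"
  proof -
    have "?s (\<lambda>a b f c d e. of_bool (a = d) * of_bool (b = c) * of_bool (f = e)) =
        (\<Sum>a b e. A a b b * cnj (A a e e))"
      by (simp add: if_conv if_sum)
    also have "\<dots> = (\<Sum>a. (\<Sum>b. A a b b) * (\<Sum>e. cnj (A a e e)))"
      by (simp add: sum_product)
    finally show ?thesis by (simp add: r'' flip: r_def)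
  qed
  have 4: "?s (\<lambda>a b f c d e. of_bool (a = d) * of_bool (b = e) * of_bool (f = c)) = S"
    by (simp add: if_conv if_sum S_def)
  have 5: "?s (\<lambda>a b f c d e. of_bool (a = e) * of_bool (b = c) * of_bool (f = d)) = (\<Sum>b. r b * cnj (r b))"
  proof -
    have "?s (\<lambda>a b f c d e. of_bool (a = e) * of_bool (b = c) * of_bool (f = d)) =
        (\<Sum>a b d. A a b b * cnj (A d a d))"
      by (simp add: if_conv if_sum)
    also have "\<dots> = (\<Sum>a. (\<Sum>b. A a b b) * (\<Sum>d. cnj (A d a d)))"
      by (simp add: sum_product)
    finally show ?thesis by (simp add: r'' flip: r_def)
  qed
  have 6: "?s (\<lambda>a b f c d e. of_bool (a = e) * of_bool (b = d) * of_bool (f = c)) = S'"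
    by (simp add: if_conv if_sum S'_def)
  have "?s kron3 = S - S'"
    unfolding kron3_def by (simp only: ring_distribs sum.distrib sum_subtractf 1 2 3 4 5 6) simp
  moreover have "complex_of_real (\<Sum>a b c. (cmod (A a b c - A b a c))\<^sup>2) = 2 * (S - S')"
  proof -
    have "complex_of_real ((cmod (x - y))\<^sup>2) = x * cnj x - x * cnj y - (y * cnj x - y * cnj y)" for x y
      by (simp only: complex_norm_square) (simp add: algebra_simps)
    then have "complex_of_real (\<Sum>a b c. (cmod (A a b c - A b a c))\<^sup>2) =
        S - S' - ((\<Sum>a b c. A b a c * cnj (A a b c)) -
                  (\<Sum>a b c. A b a c * cnj (A b a c)))"
      by (simp only: of_real_sum sum_subtractf S_def S'_def)
    also have "(\<Sum>a b c. A b a c * cnj (A a b c)) = S'"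
      unfolding S'_def by (rule sum.swap)
    also have "(\<Sum>a b c. A b a c * cnj (A b a c)) = S"
      unfolding S_def by (rule sum.swap)
    finally show ?thesis by simp
  qed
  ultimately show ?thesis by (simp only:) simp
qed

text \<open>For the \<open>(2,1)\<close>-form with coefficients \<open>A\<close>, the product is a nonzero
  multiple of the squared norm of the antisymmetrized coefficients times the top form
  \<open>W\<^sup>n\<close>, as soon as the form is primitive, which is the trace hypothesis.\<close>

lemma hodge_riemann_trace_free:
  assumes n: "3 \<le> CARD('n)"
    and trace: "\<And>a. (\<Sum>c. A a c c) = (\<Sum>c. A c a c)"
    and zero: "W ^ (CARD('n) - 3) *
      ((\<Sum>a b c. sc (A a b c) * Fp [Dz a, Dz b, Dzbar c]) *
       (\<Sum>d f e. sc (cnj (A d e f)) * Fp [Dzbar d, Dz f, Dzbar e])) = 0"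
  shows "A a b c = A b a c"
proof -
  define k :: complex where "k = -\<i> / (of_nat CARD('n) * of_nat (CARD('n) - 1) * of_nat (CARD('n) - 2))"
  have "k \<noteq> 0" using n by (simp add: k_def del: of_nat_diff)
  let ?V = "W ^ CARD('n)" and ?m = "CARD('n) - 3"
  have summand: "(sc (A a b c) * Fp [Dz a, Dz b, Dzbar c]) * (sc (cnj (A d e f)) * Fp [Dzbar d, Dz f, Dzbar e]) * W ^ ?m
     = sc (A a b c * cnj (A d e f) * kron3 a b f c d e) * (sc k * ?V)" for a b c d e f
  proof -
    have "Fp [Dz a, Dz b, Dzbar c] * Fp [Dzbar d, Dz f, Dzbar e] = Fp [Dz a, Dz b, Dz f, Dzbar c, Dzbar d, Dzbar e]"
      by (simp add: mult.assoc F_swap[of "Dzbar _" "Dz _"])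
    then have "Fp [Dz a, Dz b, Dzbar c] * Fp [Dzbar d, Dz f, Dzbar e] * W ^ ?m = sc (kron3 a b f c d e * k) * ?V"
      using Fp_W_three[OF n, of a b f c d e] by (simp only: k_def)
    moreover have "(sc (A a b c) * Fp [Dz a, Dz b, Dzbar c]) * (sc (cnj (A d e f)) * Fp [Dzbar d, Dz f, Dzbar e]) * W ^ ?m
      = sc (A a b c) * (sc (cnj (A d e f)) * (Fp [Dz a, Dz b, Dzbar c] * Fp [Dzbar d, Dz f, Dzbar e] * W ^ ?m))"
      by (simp only: mult.assoc sc_left_commute[of "Fp _"])
    ultimately show ?thesis by (simp only: sc_simps mult.assoc)
  qed
  have "0 = (\<Sum>a b c. sc (A a b c) * Fp [Dz a, Dz b, Dzbar c]) *
       (\<Sum>d f e. sc (cnj (A d e f)) * Fp [Dzbar d, Dz f, Dzbar e]) * W ^ ?m"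
    using zero by (simp only: W_power_central)
  also have "(\<Sum>d f e. sc (cnj (A d e f)) * Fp [Dzbar d, Dz f, Dzbar e]) =
      (\<Sum>d e f. sc (cnj (A d e f)) * Fp [Dzbar d, Dz f, Dzbar e])"
    by (intro sum.cong refl sum.swap)
  also have "(\<Sum>a b c. sc (A a b c) * Fp [Dz a, Dz b, Dzbar c]) *
      (\<Sum>d e f. sc (cnj (A d e f)) * Fp [Dzbar d, Dz f, Dzbar e]) * W ^ ?m
     = (\<Sum>a b c d e f.
        sc (A a b c * cnj (A d e f) * kron3 a b f c d e) * (sc k * ?V))"
    by (simp only: sum_distrib_right) (simp only: sum_distrib_left sum_distrib_right summand)
  also have "\<dots> = sc (\<Sum>a b c d e f.
        A a b c * cnj (A d e f) * kron3 a b f c d e) * (sc k * ?V)"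
    by (simp only: sc_sum sum_distrib_right)
  finally have "sc (\<Sum>a b c d e f.
        A a b c * cnj (A d e f) * kron3 a b f c d e) * (sc k * ?V) = 0"
    by (rule sym)
  then have "(\<Sum>a b c d e f.
        A a b c * cnj (A d e f) * kron3 a b f c d e) = 0"
    using \<open>k \<noteq> 0\<close> W_power_card_nonzero unfolding sc_mult_eq_0_iff by blast
  then have "(\<Sum>a b c. (cmod (A a b c - A b a c))\<^sup>2) = 0"
    unfolding kron3_form[of A, OF trace] by (simp del: of_real_sum of_real_power)
  then have "(cmod (A a b c - A b a c))\<^sup>2 = 0"
    by (simp add: sum_nonneg_eq_0_iff sum_nonneg)
  then show ?thesis by simp
qed

end

section \<open>Unitary coframes of a Hermitian metric\<close>

lemma sum_covec: "(\<Sum>e. g e) = (\<Sum>j. g (Dz j)) + (\<Sum>j. g (Dzbar j))"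
  for g :: "'n::finite covec \<Rightarrow> 'b::comm_monoid_add"
proof -
  have U: "(UNIV :: 'n covec set) = range Dz \<union> range Dzbar"
    by (auto simp: image_iff) (metis covec.exhaust)
  have "(\<Sum>e. g e) = sum g (range Dz) + sum g (range Dzbar)"
    unfolding U by (rule sum.union_disjoint) auto
  then show ?thesis by (simp add: sum.reindex inj_on_def)
qed

lemma sum_swap3: "(\<Sum>l j k a b c. g l j k a b c) =
  (\<Sum>a b c l j k. g l j k a b c)"
  for g :: "'i::finite \<Rightarrow> 'i \<Rightarrow> 'i \<Rightarrow> 'i \<Rightarrow> 'i \<Rightarrow> 'i \<Rightarrow> 'b::comm_monoid_add"
proof -
  have "(\<Sum>x. case x of (l,j,k) \<Rightarrow> \<Sum>y. case y of (a,b,c) \<Rightarrow> g l j k a b c) =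
     (\<Sum>y. case y of (a,b,c) \<Rightarrow> \<Sum>x. case x of (l,j,k) \<Rightarrow> g l j k a b c)"
    unfolding case_prod_unfold by (rule sum.swap)
  then show ?thesis
    by (simp add: UNIV_Times_UNIV[symmetric] sum.cartesian_product[symmetric] del: UNIV_Times_UNIV)
qed

lemma sum_swap2: "(\<Sum>l j a b. g l j a b) =
  (\<Sum>a b l j. g l j a b)"
  for g :: "'i::finite \<Rightarrow> 'i \<Rightarrow> 'i \<Rightarrow> 'i \<Rightarrow> 'b::comm_monoid_add"
proof -
  have "(\<Sum>x. case x of (l,j) \<Rightarrow> \<Sum>y. case y of (a,b) \<Rightarrow> g l j a b) =
     (\<Sum>y. case y of (a,b) \<Rightarrow> \<Sum>x. case x of (l,j) \<Rightarrow> g l j a b)"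
    unfolding case_prod_unfold by (rule sum.swap)
  then show ?thesis
    by (simp add: UNIV_Times_UNIV[symmetric] sum.cartesian_product[symmetric] del: UNIV_Times_UNIV)
qed

lemma sum_swap13: "(\<Sum>c l j k. g c l j k) =
  (\<Sum>l j k c. g c l j k)"
  for g :: "'i::finite \<Rightarrow> 'i \<Rightarrow> 'i \<Rightarrow> 'i \<Rightarrow> 'b::comm_monoid_add"
proof -
  have "(\<Sum>c x. case x of (l,j,k) \<Rightarrow> g c l j k) =
     (\<Sum>x. case x of (l,j,k) \<Rightarrow> \<Sum>c. g c l j k)"
    unfolding case_prod_unfold by (rule sum.swap)
  then show ?thesis
    by (simp add: UNIV_Times_UNIV[symmetric] sum.cartesian_product[symmetric] del: UNIV_Times_UNIV)
qed

definition hermitian_pos :: "'n::finite cmat \<Rightarrow> bool" where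
  "hermitian_pos H \<longleftrightarrow> (\<forall>j k. H $ k $ j = cnj (H $ j $ k)) \<and>
     (\<forall>v. v \<noteq> 0 \<longrightarrow> 0 < Re (\<Sum>j k. H $ j $ k * v $ j * cnj (v $ k)))"

definition herm :: "'n::finite cmat \<Rightarrow> 'n cvec \<Rightarrow> 'n cvec \<Rightarrow> complex" where
  "herm H v u = (\<Sum>j k. H $ j $ k * v $ j * cnj (u $ k))"

lemma herm_cnj: "hermitian_pos H \<Longrightarrow> cnj (herm H v u) = herm H u v"
proof -
  assume H: "hermitian_pos H"
  have "cnj (herm H v u) = (\<Sum>j k. H $ k $ j * u $ k * cnj (v $ j))"
  proof -
    have "cnj (H $ j $ k) = H $ k $ j" for j k using H unfolding hermitian_pos_def by metis
    then show ?thesis unfolding herm_def by (simp add: mult_ac)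
  qed
  also have "\<dots> = herm H u v" unfolding herm_def by (rule sum.swap)
  finally show ?thesis .
qed

lemma herm_scale: "herm H (r *s v) u = r * herm H v u" "herm H v (r *s u) = cnj r * herm H v u"
  unfolding herm_def sum_distrib_left by (intro sum.cong refl; simp)+

text \<open>Gram--Schmidt. As long as some index \<open>a\<close> has not been used, the orthogonality
  relations form a matrix with a zero row, so a further orthogonal vector exists.\<close>

lemma exists_unitary_family:
  assumes H: "hermitian_pos (H :: 'n::finite cmat)"
  shows "\<exists>V. \<forall>a b. herm H (V a) (V b) = of_bool (a = (b::'n))"
proof -
  have "\<exists>V. \<forall>a\<in>S. \<forall>b\<in>S. herm H (V a) (V b) = of_bool (a = (b::'n))" if "finite S" for S
    using that
  proof (induction S)
    case (insert a S)
    then obtain V where V: "\<And>a b. a \<in> S \<Longrightarrow> b \<in> S \<Longrightarrow> herm H (V a) (V b) = of_bool (a = b)"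
      by blast
    define M :: "'n cmat" where
      "M = (\<chi> b j. if b \<in> S then \<Sum>k. H $ j $ k * cnj (V b $ k) else 0)"
    (* Row b of M evaluates the inner product with V b; row a is zero since a is new. *)
    have "row a M = 0" using insert.hyps by (simp add: row_def M_def vec_eq_iff)
    then have "det M = 0" by (rule det_zero_row)
    then have "\<not> invertible M" by (simp add: invertible_det_nz)
    then obtain v where v: "M *v v = 0" "v \<noteq> 0"
      by (metis invertible_left_inverse matrix_left_invertible_ker)
    have orth: "herm H v (V b) = 0" if "b \<in> S" for b
    proof -
      have "herm H v (V b) = (M *v v) $ b" using that
        by (simp add: herm_def M_def matrix_vector_mult_def sum_distrib_left sum_distrib_right mult_ac)
      then show ?thesis using v by simp
    qed
    have orth': "herm H (V b) v = 0" if "b \<in> S" for b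
      using orth[OF that] herm_cnj[OF H, of v "V b"] by simp
    define q where "q = Re (herm H v v)"
    have q: "q > 0" "herm H v v = of_real q"
    proof -
      show "q > 0" using H v(2) unfolding q_def hermitian_pos_def herm_def by blast
      have "cnj (herm H v v) = herm H v v" by (rule herm_cnj[OF H])
      then show "herm H v v = of_real q"
        unfolding q_def by (metis Reals_cnj_iff of_real_Re)
    qed
    define V' where "V' = V (a := of_real (1 / sqrt q) *s v)"
    have "herm H (V' a) (V' a) = 1"
      using q by (simp add: V'_def herm_scale) (simp flip: of_real_mult)
    moreover have "herm H (V' a) (V' b) = 0" "herm H (V' b) (V' a) = 0" if "b \<in> S" for b
      using that insert.hyps orth[OF that] orth'[OF that] by (auto simp: V'_def herm_scale)
    moreover have "herm H (V' b) (V' c) = of_bool (b = c)" if "b \<in> S" "c \<in> S" for b c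
      using that insert.hyps V by (auto simp: V'_def)
    ultimately have "\<forall>b\<in>insert a S. \<forall>c\<in>insert a S. herm H (V' b) (V' c) = of_bool (b = c)"
      using insert.hyps by auto
    then show ?case by blast
  qed simp
  from this[of UNIV] show ?thesis by simp
qed

text \<open>The change of basis of all covectors that is induced by a change of basis \<open>U\<close> of the
  \<open>dz\<^sub>j\<close>.\<close>

fun block_conj :: "('n \<Rightarrow> 'n \<Rightarrow> complex) \<Rightarrow> 'n covec \<Rightarrow> 'n covec \<Rightarrow> complex" where
  "block_conj U (Dz a) (Dz j) = U a j"
| "block_conj U (Dzbar a) (Dzbar j) = cnj (U a j)"
| "block_conj U (Dz a) (Dzbar j) = 0"
| "block_conj U (Dzbar a) (Dz j) = 0"

text \<open>The columns of \<open>V\<close> form a unitary basis of tangent vectors, and the rows of its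
  inverse \<open>U\<close> give the dual coframe. The last condition expresses the inverse metric by
  \<open>V\<close>.\<close>

locale unitary_coframe =
  fixes H :: "'n::{finite,linorder} cmat" and V U :: "'n \<Rightarrow> 'n \<Rightarrow> complex"
  assumes V: "\<And>a b. (\<Sum>j k. H $ j $ k * V j a * cnj (V k b)) = of_bool (a = b)"
    and VU: "\<And>j k. (\<Sum>a. V j a * U a k) = of_bool (j = k)"
    and G: "\<And>j k. matrix_inv H $ k $ j = (\<Sum>c. cnj (V k c) * V j c)"
begin

definition \<theta> :: "'n covec \<Rightarrow> 'n exterior" where
  "\<theta> e = (\<Sum>f. sc (block_conj U e f) * cv f)"

lemma cv_\<theta>: "cv (Dz j) = (\<Sum>a. sc (V j a) * \<theta> (Dz a))"
    "cv (Dzbar j) = (\<Sum>a. sc (cnj (V j a)) * \<theta> (Dzbar a))"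
proof -
  have "(\<Sum>a. sc (V j a) * \<theta> (Dz a)) = (\<Sum>a k. sc (V j a * U a k) * cv (Dz k))"
    by (simp add: \<theta>_def sum_covec sc_simps sum_distrib_left mult.assoc)
  also have "\<dots> = (\<Sum>k. sc (\<Sum>a. V j a * U a k) * cv (Dz k))"
    by (subst sum.swap) (simp add: sc_sum sum_distrib_right)
  also have "\<dots> = cv (Dz j)" by (simp add: VU of_bool_def if_distrib[of sc] if_distribR sc_simps if_distrib[of "\<lambda>x. x * _"] cong: if_cong)
  finally show "cv (Dz j) = (\<Sum>a. sc (V j a) * \<theta> (Dz a))" by simp
  have "(\<Sum>a. sc (cnj (V j a)) * \<theta> (Dzbar a)) = (\<Sum>a k. sc (cnj (V j a * U a k)) * cv (Dzbar k))"
    by (simp add: \<theta>_def sum_covec sc_simps sum_distrib_left mult.assoc)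
  also have "\<dots> = (\<Sum>k. sc (cnj (\<Sum>a. V j a * U a k)) * cv (Dzbar k))"
    by (subst sum.swap) (simp add: sc_sum sum_distrib_right)
  also have "\<dots> = cv (Dzbar j)" by (simp add: VU of_bool_def if_distrib[of cnj] if_distrib[of sc] if_distribR sc_simps if_distrib[of "\<lambda>x. x * _"] cong: if_cong)
  finally show "cv (Dzbar j) = (\<Sum>a. sc (cnj (V j a)) * \<theta> (Dzbar a))" by simp
qed

sublocale covec_basis \<theta> "block_conj U" "block_conj V"
proof
  show "\<theta> e = (\<Sum>f. sc (block_conj U e f) * cv f)" for e by (fact \<theta>_def)
  show "cv e = (\<Sum>f. sc (block_conj V e f) * \<theta> f)" for e
    by (cases e) (simp_all add: sum_covec sc_simps cv_\<theta>)
qed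

lemma fundamental_frame:
  "(\<Sum>j k. sc (\<i> * H $ j $ k) * (cv (Dz j) * cv (Dzbar k))) = W"
proof -
  have "(\<Sum>j k. sc (\<i> * H $ j $ k) * (cv (Dz j) * cv (Dzbar k))) =
     (\<Sum>j k a b. sc (\<i> * (H $ j $ k * V j a * cnj (V k b))) * (\<theta> (Dz a) * \<theta> (Dzbar b)))"
    unfolding cv_\<theta> unfolding sum_product unfolding sum_distrib_left
    by (intro sum.cong refl) (simp only: sc_simps mult.assoc sc_left_commute[of "\<theta> _"])
  also have "\<dots> = (\<Sum>a b j k. sc (\<i> * (H $ j $ k * V j a * cnj (V k b))) * (\<theta> (Dz a) * \<theta> (Dzbar b)))"
    by (rule sum_swap2)
  also have "\<dots> = (\<Sum>a b. sc (\<i> * of_bool (a = b)) * (\<theta> (Dz a) * \<theta> (Dzbar b)))"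
    by (simp only: V[symmetric] sum_distrib_left sum_distrib_right sc_sum)
  also have "\<dots> = W"
    by (simp add: W_def w_def of_bool_def if_distrib[of sc] if_distrib[of "\<lambda>x. x * _"] if_distrib[of "\<lambda>x. _ * x"] sc_simps cong: if_cong)
  finally show ?thesis .
qed

definition frame_coeff :: "('n \<Rightarrow> 'n \<Rightarrow> 'n \<Rightarrow> complex) \<Rightarrow> 'n \<Rightarrow> 'n \<Rightarrow> 'n \<Rightarrow> complex" where
  "frame_coeff D a b c = (\<Sum>l j k. D l j k * V l a * V j b * cnj (V k c))"

lemma sum_three_frame:
  "(\<Sum>l j k. sc (\<i> * D l j k) * (cv (Dz l) * (cv (Dz j) * cv (Dzbar k)))) =
   sc \<i> * (\<Sum>a b c. sc (frame_coeff D a b c) * Fp [Dz a, Dz b, Dzbar c])"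
proof -
  have *: "sc (\<i> * D l j k) * (cv (Dz l) * (cv (Dz j) * cv (Dzbar k))) =
      (\<Sum>a b c. sc \<i> * (sc (D l j k * V l a * V j b * cnj (V k c)) * Fp [Dz a, Dz b, Dzbar c]))" for l j k
    unfolding cv_\<theta> unfolding sum_product unfolding sum_distrib_left
    by (intro sum.cong refl) (simp only: sc_simps mult.assoc sc_left_commute[of "\<theta> _"] list.map prod_list.Nil prod_list.Cons mult_1_right)
  show ?thesis unfolding *
    by (subst sum_swap3) (simp only: frame_coeff_def sum_distrib_left sum_distrib_right sc_sum)
qed

lemma sum_three_frame_bar:
  "(\<Sum>l j k. sc (\<i> * cnj (D l k j)) * (cv (Dzbar l) * (cv (Dz j) * cv (Dzbar k)))) =
   sc \<i> * (\<Sum>a c b. sc (cnj (frame_coeff D a b c)) * Fp [Dzbar a, Dz c, Dzbar b])"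
proof -
  have *: "sc (\<i> * cnj (D l k j)) * (cv (Dzbar l) * (cv (Dz j) * cv (Dzbar k))) =
      (\<Sum>a c b. sc \<i> * (sc (cnj (D l k j * V l a * V k b * cnj (V j c))) * Fp [Dzbar a, Dz c, Dzbar b]))" for l j k
    unfolding cv_\<theta> unfolding sum_product unfolding sum_distrib_left
  proof (intro sum.cong refl)
    fix a b c
    have "cnj (D l k j * V l a * V k b * cnj (V j c)) = cnj (D l k j) * (cnj (V l a) * (V j c * cnj (V k b)))"
      by simp
    then show "sc (\<i> * cnj (D l k j)) * (sc (cnj (V l a)) * \<theta> (Dzbar a) * (sc (V j c) * \<theta> (Dz c) * (sc (cnj (V k b)) * \<theta> (Dzbar b)))) =
      sc \<i> * (sc (cnj (D l k j * V l a * V k b * cnj (V j c))) * Fp [Dzbar a, Dz c, Dzbar b])"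
      by (simp only: sc_simps mult.assoc sc_left_commute[of "\<theta> _"] list.map prod_list.Nil prod_list.Cons mult_1_right)
  qed
  have fc: "cnj (frame_coeff D a b c) = (\<Sum>l j k. cnj (D l k j * V l a * V k b * cnj (V j c)))" for a b c
    unfolding frame_coeff_def cnj_sum by (rule sum.cong[OF refl], rule sum.swap)
  show ?thesis unfolding *
    by (subst sum_swap3) (simp only: fc sum_distrib_left sum_distrib_right sc_sum)
qed

text \<open>The trace of the torsion with respect to the inverse metric is, in a unitary frame, a plain trace.\<close>

lemma trace_frame:
  assumes "\<And>a. (\<Sum>c d. matrix_inv H $ d $ c * (D a c d - D c a d)) = 0"
  shows "(\<Sum>c. frame_coeff D a c c) = (\<Sum>c. frame_coeff D c a c)"
proof -
  have "(\<Sum>c. frame_coeff D a c c) = (\<Sum>l j k c. D l j k * V l a * V j c * cnj (V k c))"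
    unfolding frame_coeff_def by (rule sum_swap13)
  also have "\<dots> = (\<Sum>l. V l a * (\<Sum>c d. matrix_inv H $ d $ c * D l c d))"
    unfolding G sum_distrib_left sum_distrib_right by (intro sum.cong refl) (simp only: mult_ac)
  finally have 1: "(\<Sum>c. frame_coeff D a c c) = (\<Sum>l. V l a * (\<Sum>c d. matrix_inv H $ d $ c * D l c d))" .
  have "(\<Sum>c. frame_coeff D c a c) = (\<Sum>l j k c. D l j k * V l c * V j a * cnj (V k c))"
    unfolding frame_coeff_def by (rule sum_swap13)
  also have "\<dots> = (\<Sum>j l k c. D l j k * V l c * V j a * cnj (V k c))"
    by (rule sum.swap)
  also have "\<dots> = (\<Sum>l. V l a * (\<Sum>c d. matrix_inv H $ d $ c * D c l d))"
    unfolding G sum_distrib_left sum_distrib_right by (intro sum.cong refl) (simp only: mult_ac)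
  finally have 2: "(\<Sum>c. frame_coeff D c a c) = (\<Sum>l. V l a * (\<Sum>c d. matrix_inv H $ d $ c * D c l d))" .
  have "(\<Sum>c. frame_coeff D a c c) - (\<Sum>c. frame_coeff D c a c) =
     (\<Sum>l. V l a * (\<Sum>c d. matrix_inv H $ d $ c * (D l c d - D c l d)))"
    unfolding 1 2 by (simp only: right_diff_distrib sum_subtractf)
  then show ?thesis using assms by simp
qed

end

text \<open>With \<open>P\<close> the matrix of a unitary family of vectors, unitarity reads
  \<open>R P = 1\<close>; from \<open>P R = 1\<close> one reads off the inverse of \<open>H\<close>.\<close>

lemma exists_unitary_frame:
  fixes H :: "'n::{finite,linorder} cmat"
  assumes H: "hermitian_pos H"
  obtains V U where "unitary_coframe H V U"
proof -
  obtain v where v: "\<And>a b. herm H (v a) (v b) = of_bool (a = (b::'n))"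
    using exists_unitary_family[OF H] by blast
  define P :: "'n cmat" where "P = (\<chi> j a. v a $ j)"
  define R :: "'n cmat" where "R = (\<chi> b j. \<Sum>k. H $ j $ k * cnj (P $ k $ b))"
  have "(R ** P) $ b $ a = herm H (v a) (v b)" for a b
    unfolding matrix_matrix_mult_def R_def P_def herm_def vec_lambda_beta sum_distrib_right
    by (intro sum.cong refl) (simp add: mult_ac)
  then have RP: "R ** P = mat 1" by (auto simp: vec_eq_iff v mat_def)
  then have PR: "P ** R = mat 1" by (simp add: matrix_left_right_inverse)
  define G :: "'n cmat" where "G = (\<chi> k j. \<Sum>c. cnj (P $ k $ c) * P $ j $ c)"
  have "(H ** G) $ j $ l = (P ** R) $ l $ j" for j l
    unfolding matrix_matrix_mult_def G_def R_def vec_lambda_beta sum_distrib_left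
    by (subst sum.swap) (simp add: mult_ac)
  then have HG: "H ** G = mat 1" by (auto simp: PR vec_eq_iff mat_def)
  then have "invertible H" by (metis invertible_def matrix_left_right_inverse)
  then have "matrix_inv H = G"
  proof -
    have inv: "matrix_inv H ** H = mat 1"
      using someI_ex[OF \<open>invertible H\<close>[unfolded invertible_def]] by (simp add: matrix_inv_def)
    have "matrix_inv H = matrix_inv H ** (H ** G)" by (simp add: HG)
    also have "\<dots> = (matrix_inv H ** H) ** G" by (simp only: matrix_mul_assoc)
    finally show ?thesis using inv by simp
  qed
  then have G: "matrix_inv H $ k $ j = (\<Sum>c. cnj (P $ k $ c) * P $ j $ c)" for j k
    by (simp add: G_def)
  have VU: "(\<Sum>a. P $ j $ a * R $ a $ k) = of_bool (j = k)" for j k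
    using PR by (simp add: vec_eq_iff matrix_matrix_mult_def mat_def)
  have V: "(\<Sum>j k. H $ j $ k * P $ j $ a * cnj (P $ k $ b)) = of_bool (a = b)" for a b
    using v[of a b] by (simp add: herm_def P_def)
  have "unitary_coframe H (\<lambda>j a. P $ j $ a) (\<lambda>a k. R $ a $ k)"
    by unfold_locales (fact V VU G)+
  then show ?thesis by (rule that)
qed

lemma antisymmetric_sum_zero:
  fixes g :: "'i::finite \<Rightarrow> 'i \<Rightarrow> 'n::{finite,linorder} exterior"
  assumes "\<And>a b. g b a = - g a b"
  shows "(\<Sum>a b. g a b) = 0"
proof -
  have "(\<Sum>a b. g a b) = (\<Sum>b a. g a b)" by (rule sum.swap)
  also have "\<dots> = (\<Sum>b a. - g b a)" by (intro sum.cong refl assms)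
  also have "\<dots> = - (\<Sum>a b. g a b)" by (simp add: sum_negf)
  finally have "(\<Sum>a b. g a b) + (\<Sum>a b. g a b) = 0"
    by (simp add: eq_neg_iff_add_eq_0)
  then show ?thesis by (rule exterior_double_eq_0)
qed

text \<open>Here \<open>D l j k\<close> stands for
  \<open>\<partial>h\<^sub>j\<^sub>k/\<partial>z\<^sub>l\<close>, so that \<open>del\<omega>\<close>
  and \<open>dbar\<omega>\<close> are the two parts of \<open>d\<omega>\<close> at a point. The
  trace hypothesis is the vanishing of the Lee form; its first consequence is the balanced equation
  for \<open>\<omega>\<close>, the second one is the Hodge--Riemann relation.\<close>

theorem pointwise_torsion:
  fixes H :: "'n::{finite,linorder} cmat" and D :: "'n \<Rightarrow> 'n \<Rightarrow> 'n \<Rightarrow> complex"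
  defines "\<omega> \<equiv> \<Sum>j k. sc (\<i> * H $ j $ k) * (cv (Dz j) * cv (Dzbar k))"
    and "del\<omega> \<equiv> \<Sum>l j k. sc (\<i> * D l j k) * (cv (Dz l) * (cv (Dz j) * cv (Dzbar k)))"
    and "dbar\<omega> \<equiv> \<Sum>l j k. sc (\<i> * cnj (D l k j)) * (cv (Dzbar l) * (cv (Dz j) * cv (Dzbar k)))"
  assumes H: "hermitian_pos H" and n: "3 \<le> CARD('n)"
    and trace: "\<And>a. (\<Sum>c d. matrix_inv H $ d $ c * (D a c d - D c a d)) = 0"
  shows "dbar\<omega> * \<omega> ^ (CARD('n) - 2) = 0"
    and "\<omega> ^ (CARD('n) - 3) * (del\<omega> * dbar\<omega>) = 0 \<Longrightarrow> del\<omega> = 0 \<and> dbar\<omega> = 0"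
proof -
  obtain V U where "unitary_coframe H V U" by (rule exists_unitary_frame[OF H])
  then interpret unitary_coframe H V U .
  let ?A = "frame_coeff D"
  have W: "\<omega> = W" unfolding \<omega>_def by (rule fundamental_frame)
  have d: "del\<omega> = sc \<i> * (\<Sum>a b c. sc (?A a b c) * Fp [Dz a, Dz b, Dzbar c])"
    unfolding del\<omega>_def by (rule sum_three_frame)
  have d': "dbar\<omega> = sc \<i> * (\<Sum>a c b. sc (cnj (?A a b c)) * Fp [Dzbar a, Dz c, Dzbar b])"
    unfolding dbar\<omega>_def by (rule sum_three_frame_bar)
  note tr = trace_frame[of D, OF trace]
  show "dbar\<omega> * \<omega> ^ (CARD('n) - 2) = 0"
    unfolding W d' using trace_free_imp_wedge_W_zero[OF n, of "\<lambda>a c b. cnj (?A a b c)"] tr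
    by (simp only: cnj_sum[symmetric] mult.assoc mult_zero_right)
  assume "\<omega> ^ (CARD('n) - 3) * (del\<omega> * dbar\<omega>) = 0"
  then have "sc (\<i> * \<i>) * (W ^ (CARD('n) - 3) * (
      (\<Sum>a b c. sc (?A a b c) * Fp [Dz a, Dz b, Dzbar c]) *
      (\<Sum>a c b. sc (cnj (?A a b c)) * Fp [Dzbar a, Dz c, Dzbar b]))) = 0"
    unfolding W d d' sc_simps(6)
    by (simp only: mult.assoc sc_left_commute[of "W ^ _"] sc_left_commute[of "sum _ _"])
  then have "W ^ (CARD('n) - 3) * (
      (\<Sum>a b c. sc (?A a b c) * Fp [Dz a, Dz b, Dzbar c]) *
      (\<Sum>a c b. sc (cnj (?A a b c)) * Fp [Dzbar a, Dz c, Dzbar b])) = 0"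
    unfolding sc_mult_eq_0_iff by simp
  then have sym: "?A a b c = ?A b a c" for a b c
    by (rule hodge_riemann_trace_free[OF n tr])
  have "(\<Sum>a b c. sc (?A a b c) * Fp [Dz a, Dz b, Dzbar c]) = 0"
  proof (rule antisymmetric_sum_zero)
    fix a b
    show "(\<Sum>c. sc (?A b a c) * Fp [Dz b, Dz a, Dzbar c]) = - (\<Sum>c. sc (?A a b c) * Fp [Dz a, Dz b, Dzbar c])"
      unfolding sum_negf[symmetric]
    proof (intro sum.cong refl)
      fix c
      show "sc (?A b a c) * Fp [Dz b, Dz a, Dzbar c] = - (sc (?A a b c) * Fp [Dz a, Dz b, Dzbar c])"
        using F_swap[of "Dz b" "Dz a" "\<theta> (Dzbar c)"]
        by (simp only: sym[of b a] list.map prod_list.Cons prod_list.Nil mult_1_right mult_minus_right)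
    qed
  qed
  moreover have "(\<Sum>a b c. sc (cnj (?A a b c)) * Fp [Dzbar a, Dz c, Dzbar b]) = 0"
  proof (rule antisymmetric_sum_zero)
    fix a b
    show "(\<Sum>c. sc (cnj (?A b a c)) * Fp [Dzbar b, Dz c, Dzbar a]) = - (\<Sum>c. sc (cnj (?A a b c)) * Fp [Dzbar a, Dz c, Dzbar b])"
      unfolding sum_negf[symmetric]
    proof (intro sum.cong refl)
      fix c
      have "Fp [Dzbar b, Dz c, Dzbar a] = - (\<theta> (Dz c) * (\<theta> (Dzbar b) * \<theta> (Dzbar a)))"
        using F_swap[of "Dzbar b" "Dz c" "\<theta> (Dzbar a)"]
        by (simp only: list.map prod_list.Cons prod_list.Nil mult_1_right)
      also have "\<dots> = \<theta> (Dz c) * (\<theta> (Dzbar a) * \<theta> (Dzbar b))"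
        by (simp only: F_anticommute[of "Dzbar b" "Dzbar a"] mult_minus_right minus_minus)
      also have "\<dots> = - Fp [Dzbar a, Dz c, Dzbar b]"
        using F_swap[of "Dz c" "Dzbar a" "\<theta> (Dzbar b)"]
        by (simp only: list.map prod_list.Cons prod_list.Nil mult_1_right)
      finally show "sc (cnj (?A b a c)) * Fp [Dzbar b, Dz c, Dzbar a] = - (sc (cnj (?A a b c)) * Fp [Dzbar a, Dz c, Dzbar b])"
        by (simp only: sym[of b a] mult_minus_right)
    qed
  qed
  then have "(\<Sum>a c b. sc (cnj (?A a b c)) * Fp [Dzbar a, Dz c, Dzbar b]) = 0"
    by (rule trans[rotated]) (intro sum.cong refl sum.swap)
  ultimately show "del\<omega> = 0 \<and> dbar\<omega> = 0" unfolding d d' by simp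
qed

section \<open>Smooth functions\<close>

text \<open>Smoothness up to a finite order. Closure properties are proved by induction on the order and
  transferred to \<open>smooth_on\<close>, where coinduction would have to be done up to sums and
  products.\<close>

primrec Cn_on :: "nat \<Rightarrow> 'a::real_normed_vector set \<Rightarrow> ('a \<Rightarrow> 'b::real_normed_vector) \<Rightarrow> bool" where
  "Cn_on 0 S f \<longleftrightarrow> True"
| "Cn_on (Suc k) S f \<longleftrightarrow> (\<forall>x\<in>S. f differentiable (at x)) \<and>
     (\<forall>v. Cn_on k S (\<lambda>x. frechet_derivative f (at x) v))"

lemma smooth_on_iff_Cn_on: "smooth_on S f \<longleftrightarrow> (\<forall>k. Cn_on k S f)"
proof
  show "\<forall>k. Cn_on k S f" if "smooth_on S f"
  proof
    fix k show "Cn_on k S f" using that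
      by (induction k arbitrary: f) (auto elim: smooth_on.cases)
  qed
  show "smooth_on S f" if "\<forall>k. Cn_on k S f"
    using that
  proof (coinduction arbitrary: f)
    case smooth_on
    then have "Cn_on (Suc k) S f" for k by blast
    then show ?case by auto
  qed
qed

lemma Cn_on_Suc_imp: "Cn_on (Suc k) S f \<Longrightarrow> Cn_on k S f"
  by (induction k arbitrary: f) auto

text \<open>Differentiability at a point is a local matter, so different neighbourhoods may be used at
  different points.\<close>

lemma Cn_on_local:
  "(\<And>x. x \<in> S \<Longrightarrow> \<exists>U. x \<in> U \<and> Cn_on k U f) \<Longrightarrow> Cn_on k S f"
proof (induction k arbitrary: f)
  case (Suc k)
  have "f differentiable (at x)" if "x \<in> S" for x using Suc.prems[OF that] by auto
  moreover have "Cn_on k S (\<lambda>x. frechet_derivative f (at x) v)" for v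
  proof (rule Suc.IH)
    fix x assume "x \<in> S"
    from Suc.prems[OF this] obtain U where "x \<in> U" "Cn_on (Suc k) U f" by blast
    then show "\<exists>U. x \<in> U \<and> Cn_on k U (\<lambda>x. frechet_derivative f (at x) v)" by auto
  qed
  ultimately show ?case by simp
qed simp

lemma frechet_derivative_cong_open:
  assumes "open S" "x \<in> S" "\<And>y. y \<in> S \<Longrightarrow> f y = g y"
  shows "frechet_derivative f (at x) = frechet_derivative g (at x)"
proof -
  have "(f has_derivative D) (at x) \<longleftrightarrow> (g has_derivative D) (at x)" for D
    using has_derivative_transform_within_open[OF _ assms(1,2), of f D UNIV g]
      has_derivative_transform_within_open[OF _ assms(1,2), of g D UNIV f] assms(3) by auto
  then show ?thesis by (simp add: frechet_derivative_def)
qed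

lemma Cn_on_cong:
  assumes "open S" "\<And>x. x \<in> S \<Longrightarrow> f x = g x"
  shows "Cn_on k S f \<longleftrightarrow> Cn_on k S g"
proof -
  have *: "Cn_on k S f \<Longrightarrow> Cn_on k S g" if "\<And>x. x \<in> S \<Longrightarrow> f x = g x" for f g :: "'a \<Rightarrow> 'b"
    using that
  proof (induction k arbitrary: f g)
    case (Suc k)
    have "g differentiable (at x)" if "x \<in> S" for x
    proof -
      have "(f has_derivative frechet_derivative f (at x)) (at x)"
        using Suc.prems(1) that by (auto simp: frechet_derivative_works)
      then have "(g has_derivative frechet_derivative f (at x)) (at x)"
        by (rule has_derivative_transform_within_open[OF _ assms(1) that Suc.prems(2)])
      then show ?thesis by (auto simp: differentiable_def)
    qed
    moreover have "Cn_on k S (\<lambda>x. frechet_derivative g (at x) v)" for v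
    proof (rule Suc.IH[of "\<lambda>x. frechet_derivative f (at x) v"])
      show "Cn_on k S (\<lambda>x. frechet_derivative f (at x) v)" using Suc.prems(1) by simp
      show "frechet_derivative f (at x) v = frechet_derivative g (at x) v" if "x \<in> S" for x
        using frechet_derivative_cong_open[OF assms(1) that Suc.prems(2)] by (rule fun_cong)
    qed
    ultimately show ?case by simp
  qed simp
  from *[of f g] *[of g f] assms(2) show ?thesis by auto
qed

lemma Cn_on_SucI:
  assumes "open S" "\<And>x. x \<in> S \<Longrightarrow> (f has_derivative f' x) (at x)" "\<And>v. Cn_on k S (\<lambda>x. f' x v)"
  shows "Cn_on (Suc k) S f"
proof -
  have "Cn_on k S (\<lambda>x. frechet_derivative f (at x) v)" for v
    using assms(3)[of v] frechet_derivative_at[OF assms(2)]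
      Cn_on_cong[OF assms(1), of "\<lambda>x. frechet_derivative f (at x) v" "\<lambda>x. f' x v"]
    by simp
  then show ?thesis using assms(2) by (auto simp: differentiable_def)
qed

lemma Cn_on_SucD:
  assumes "Cn_on (Suc k) S f" "x \<in> S"
  shows "(f has_derivative frechet_derivative f (at x)) (at x)"
  using assms by (auto simp: frechet_derivative_works)

lemma Cn_on_const: "open S \<Longrightarrow> Cn_on k S (\<lambda>x. c)"
proof (induction k arbitrary: c)
  case (Suc k)
  show ?case by (rule Cn_on_SucI[where f' = "\<lambda>x v. 0"]) (use Suc in auto)
qed simp

lemma Cn_on_add:
  assumes "open S"
  shows "Cn_on k S f \<Longrightarrow> Cn_on k S g \<Longrightarrow> Cn_on k S (\<lambda>x. f x + g x)"
proof (induction k arbitrary: f g)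
  case (Suc k)
  show ?case
    by (rule Cn_on_SucI[OF assms has_derivative_add[OF Cn_on_SucD[OF Suc.prems(1)] Cn_on_SucD[OF Suc.prems(2)]]])
      (use Suc in auto)
qed simp

lemma Cn_on_bounded_linear:
  assumes "open S" "bounded_linear L"
  shows "Cn_on k S f \<Longrightarrow> Cn_on k S (\<lambda>x. L (f x))"
proof (induction k arbitrary: f)
  case (Suc k)
  show ?case
    by (rule Cn_on_SucI[OF assms(1) bounded_linear.has_derivative[OF assms(2) Cn_on_SucD[OF Suc.prems]]])
      (use Suc in auto)
qed simp

lemma Cn_on_bilinear:
  assumes "open S" and B: "bounded_bilinear B"
  shows "Cn_on k S f \<Longrightarrow> Cn_on k S g \<Longrightarrow> Cn_on k S (\<lambda>x. B (f x) (g x))"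
proof (induction k arbitrary: f g)
  case (Suc k)
  show ?case
  proof (rule Cn_on_SucI[OF assms(1) bounded_bilinear.FDERIV[OF B Cn_on_SucD[OF Suc.prems(1)] Cn_on_SucD[OF Suc.prems(2)]]])
    show "Cn_on k S (\<lambda>x. B (f x) (frechet_derivative g (at x) v) + B (frechet_derivative f (at x) v) (g x))" for v
      using Suc.prems Suc.prems[THEN Cn_on_Suc_imp] by (intro Cn_on_add assms(1) Suc.IH) auto
  qed
qed simp

lemma Cn_on_sum:
  assumes "open S" "\<And>i. i \<in> I \<Longrightarrow> Cn_on k S (f i)"
  shows "Cn_on k S (\<lambda>x. \<Sum>i\<in>I. f i x)"
  using assms(2)
  by (induction I rule: infinite_finite_induct) (auto intro!: Cn_on_add Cn_on_const assms(1))

text \<open>Expanding the derivative of \<open>T\<close> in a basis turns the derivative of the composition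
  into a sum of products of derivatives of \<open>T\<close> and compositions of directional
  derivatives of \<open>f\<close> with \<open>T\<close>.\<close>

lemma Cn_on_compose:
  fixes T :: "'a::real_normed_vector \<Rightarrow> 'b::euclidean_space"
  assumes "open S" "open U" "T ` S \<subseteq> U"
  shows "Cn_on k S T \<Longrightarrow> Cn_on k U f \<Longrightarrow> Cn_on k S (\<lambda>x. f (T x))"
proof (induction k arbitrary: f)
  case (Suc k)
  let ?f' = "\<lambda>x v. \<Sum>b\<in>Basis. (frechet_derivative T (at x) v \<bullet> b) *\<^sub>R frechet_derivative f (at (T x)) b"
  show ?case
  proof (rule Cn_on_SucI[OF assms(1), of _ ?f'])
    fix x assume x: "x \<in> S"
    then have "T x \<in> U" using assms by auto
    then have f: "(f has_derivative frechet_derivative f (at (T x))) (at (T x))"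
      using Cn_on_SucD Suc.prems by blast
    then interpret f: linear "frechet_derivative f (at (T x))" by (rule has_derivative_linear)
    have "((\<lambda>x. f (T x)) has_derivative (\<lambda>v. frechet_derivative f (at (T x)) (frechet_derivative T (at x) v))) (at x)"
      using has_derivative_compose[OF Cn_on_SucD[OF Suc.prems(1) x] f] .
    also have "(\<lambda>v. frechet_derivative f (at (T x)) (frechet_derivative T (at x) v)) = ?f' x"
    proof
      fix v
      have "frechet_derivative f (at (T x)) (\<Sum>b\<in>Basis. (frechet_derivative T (at x) v \<bullet> b) *\<^sub>R b) = ?f' x v"
        by (simp add: f.sum f.scale)
      then show "frechet_derivative f (at (T x)) (frechet_derivative T (at x) v) = ?f' x v"
        by (simp add: euclidean_representation)
    qed
    finally show "((\<lambda>x. f (T x)) has_derivative ?f' x) (at x)" .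
  next
    fix v
    have "Cn_on k S (\<lambda>x. frechet_derivative T (at x) v \<bullet> b)" for b
      using Suc.prems by (intro Cn_on_bounded_linear[OF assms(1) bounded_linear_inner_left]) auto
    moreover have "Cn_on k S (\<lambda>x. frechet_derivative f (at (T x)) b)" for b
      using Suc.prems Cn_on_Suc_imp[OF Suc.prems(1)] by (intro Suc.IH) auto
    ultimately show "Cn_on k S (\<lambda>x. ?f' x v)"
      by (intro Cn_on_sum assms(1) Cn_on_bilinear[OF assms(1) bounded_bilinear_scaleR])
  qed
qed simp

lemma smooth_onD:
  assumes "smooth_on S f" "x \<in> S"
  shows "(f has_derivative frechet_derivative f (at x)) (at x)" "f differentiable (at x)"
  using assms by (auto elim: smooth_on.cases simp: frechet_derivative_works[symmetric])

lemma smooth_on_frechet: "smooth_on S f \<Longrightarrow> smooth_on S (\<lambda>x. frechet_derivative f (at x) v)"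
  by (auto elim: smooth_on.cases)

lemma smooth_on_imp_continuous_on: "smooth_on S f \<Longrightarrow> continuous_on S f"
  by (meson smooth_onD(2) differentiable_imp_continuous_within continuous_at_imp_continuous_on)

lemma smooth_on_cong: "open S \<Longrightarrow> (\<And>x. x \<in> S \<Longrightarrow> f x = g x) \<Longrightarrow> smooth_on S f \<Longrightarrow> smooth_on S g"
  unfolding smooth_on_iff_Cn_on using Cn_on_cong[of S f g] by auto

lemma smooth_on_local: "(\<And>x. x \<in> S \<Longrightarrow> \<exists>U. x \<in> U \<and> smooth_on U f) \<Longrightarrow> smooth_on S f"
proof -
  assume *: "\<And>x. x \<in> S \<Longrightarrow> \<exists>U. x \<in> U \<and> smooth_on U f"
  have "Cn_on k S f" for k
  proof (rule Cn_on_local)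
    show "\<exists>U. x \<in> U \<and> Cn_on k U f" if "x \<in> S" for x
      using *[OF that] by (auto simp: smooth_on_iff_Cn_on)
  qed
  then show ?thesis by (simp add: smooth_on_iff_Cn_on)
qed

lemma smooth_on_const: "open S \<Longrightarrow> smooth_on S (\<lambda>x. c)"
  unfolding smooth_on_iff_Cn_on by (auto intro: Cn_on_const)

lemma smooth_on_add: "open S \<Longrightarrow> smooth_on S f \<Longrightarrow> smooth_on S g \<Longrightarrow> smooth_on S (\<lambda>x. f x + g x)"
  unfolding smooth_on_iff_Cn_on by (auto intro: Cn_on_add)

lemma smooth_on_sum: "open S \<Longrightarrow> (\<And>i. i \<in> I \<Longrightarrow> smooth_on S (f i)) \<Longrightarrow> smooth_on S (\<lambda>x. \<Sum>i\<in>I. f i x)"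
  unfolding smooth_on_iff_Cn_on by (auto intro: Cn_on_sum)

lemma smooth_on_bounded_linear: "open S \<Longrightarrow> bounded_linear L \<Longrightarrow> smooth_on S f \<Longrightarrow> smooth_on S (\<lambda>x. L (f x))"
  unfolding smooth_on_iff_Cn_on by (auto intro: Cn_on_bounded_linear)

lemma smooth_on_bilinear: "open S \<Longrightarrow> bounded_bilinear B \<Longrightarrow> smooth_on S f \<Longrightarrow> smooth_on S g
    \<Longrightarrow> smooth_on S (\<lambda>x. B (f x) (g x))"
  unfolding smooth_on_iff_Cn_on by (auto intro: Cn_on_bilinear)

lemmas smooth_on_mult = smooth_on_bilinear[OF _ bounded_bilinear_mult]

lemma smooth_on_compose:
  fixes T :: "'a::real_normed_vector \<Rightarrow> 'b::euclidean_space"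
  shows "open S \<Longrightarrow> open U \<Longrightarrow> T ` S \<subseteq> U \<Longrightarrow> smooth_on S T \<Longrightarrow> smooth_on U f \<Longrightarrow> smooth_on S (\<lambda>x. f (T x))"
  unfolding smooth_on_iff_Cn_on by (auto intro: Cn_on_compose[of S U T])

lemma smooth_on_prod:
  fixes f :: "'i \<Rightarrow> 'a::real_normed_vector \<Rightarrow> 'b::{real_normed_algebra_1,comm_ring_1}"
  shows "open S \<Longrightarrow> (\<And>i. i \<in> I \<Longrightarrow> smooth_on S (f i)) \<Longrightarrow> smooth_on S (\<lambda>x. \<Prod>i\<in>I. f i x)"
  by (induction I rule: infinite_finite_induct) (auto intro!: smooth_on_mult smooth_on_const)

lemma smooth_on_id: "open S \<Longrightarrow> smooth_on S (\<lambda>x. x)"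
proof -
  assume S: "open S"
  have "Cn_on k S (\<lambda>x. x)" for k
  proof (cases k)
    case (Suc m)
    show ?thesis unfolding Suc
      by (rule Cn_on_SucI[OF S, of _ "\<lambda>x v. v"]) (auto intro: Cn_on_const S)
  qed simp
  then show ?thesis by (simp add: smooth_on_iff_Cn_on)
qed

lemma smooth_on_nth: "open S \<Longrightarrow> smooth_on S f \<Longrightarrow> smooth_on S (\<lambda>x. f x $ i)"
  by (rule smooth_on_bounded_linear[OF _ bounded_linear_vec_nth])

section \<open>Bump functions\<close>

text \<open>For \<open>m = 0\<close> this is the standard function that is flat at the origin. The whole
  family is needed because differentiation leads to higher \<open>m\<close>.\<close>

definition flat :: "nat \<Rightarrow> real \<Rightarrow> real" where
  "flat m t = (if t > 0 then exp (- inverse t) * inverse t ^ m else 0)"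

text \<open>Substituting \<open>t = 1/x\<close>, this says that the exponential grows faster than any power.\<close>

lemma flat_at_0: "((\<lambda>t. flat m t) \<longlongrightarrow> 0) (at 0)"
proof -
  have "((\<lambda>x. x ^ m / exp x) \<longlongrightarrow> (0::real)) at_top" by (rule tendsto_power_div_exp_0)
  then have "((\<lambda>t. inverse t ^ m / exp (inverse t)) \<longlongrightarrow> (0::real)) (at_right 0)"
    by (rule filterlim_compose[OF _ filterlim_inverse_at_top_right])
  then have "((\<lambda>t. flat m t) \<longlongrightarrow> 0) (at_right 0)"
    by (rule Lim_transform_eventually)
      (auto simp: flat_def eventually_at_right_field exp_minus field_simps intro!: exI[of _ 1])
  moreover have "((\<lambda>t. flat m t) \<longlongrightarrow> 0) (at_left 0)"
    by (rule Lim_transform_eventually[OF tendsto_const])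
      (auto simp: flat_def eventually_at_left_field intro!: exI[of _ "-1"])
  ultimately show ?thesis by (simp add: filterlim_at_split)
qed

lemma flat_has_derivative:
  "(flat m has_field_derivative (flat (m + 2) t - of_nat m * flat (m + 1) t)) (at t)"
proof -
  consider "t > 0" | "t < 0" | "t = 0" by linarith
  then show ?thesis
  proof cases
    case 1
    have "((\<lambda>t. exp (- inverse t) * inverse t ^ m) has_field_derivative (flat (m + 2) t - of_nat m * flat (m + 1) t)) (at t)"
    proof -
      have inv: "(inverse has_field_derivative - (inverse t * inverse t)) (at t)"
        using DERIV_inverse[of t] 1 by (simp add: power2_eq_square)
      have "((\<lambda>t. inverse t ^ m) has_field_derivative - of_nat m * inverse t ^ Suc m) (at t)"
      proof (cases m)
        case (Suc k)
        show ?thesis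
          by (rule DERIV_cong[OF DERIV_power[OF inv, of m]]) (simp add: Suc algebra_simps)
      qed simp
      from DERIV_mult[OF DERIV_chain2[OF DERIV_exp DERIV_minus[OF inv]] this]
      show ?thesis using 1 by (simp add: flat_def algebra_simps)
    qed
    then show ?thesis
      by (rule has_field_derivative_transform_within_open[where S = "{0<..}"]) (use 1 in \<open>auto simp: flat_def\<close>)
  next
    case 2
    have "((\<lambda>t. 0) has_field_derivative (flat (m + 2) t - of_nat m * flat (m + 1) t)) (at t)"
      using 2 by (auto simp: flat_def)
    then show ?thesis
      by (rule has_field_derivative_transform_within_open[where S = "{..<0}"]) (use 2 in \<open>auto simp: flat_def\<close>)
  next
    case 3
    have "((\<lambda>h. (flat m (0 + h) - flat m 0) / h) \<longlongrightarrow> 0) (at 0)"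
    proof (rule Lim_transform_eventually[OF flat_at_0[of "Suc m"]])
      have "flat (Suc m) h = (flat m (0 + h) - flat m 0) / h" for h
        by (simp add: flat_def divide_inverse)
      then show "\<forall>\<^sub>F h in at 0. flat (Suc m) h = (flat m (0 + h) - flat m 0) / h" by simp
    qed
    then show ?thesis using 3 by (simp add: DERIV_def flat_def)
  qed
qed

lemma smooth_on_flat: "smooth_on UNIV (flat m)"
proof -
  have "Cn_on k UNIV (flat m)" for k
  proof (induction k arbitrary: m)
    case (Suc k)
    show ?case
    proof (rule Cn_on_SucI[OF open_UNIV])
      show "(flat m has_derivative (\<lambda>v. (flat (m + 2) t + (- of_nat m) * flat (m + 1) t) * v)) (at t)" for t
        using flat_has_derivative[of m t] by (simp add: has_field_derivative_def)
      show "Cn_on k UNIV (\<lambda>t. (flat (m + 2) t + (- of_nat m) * flat (m + 1) t) * v)" for v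
        by (intro Cn_on_bilinear[OF _ bounded_bilinear_mult] Cn_on_add Cn_on_const Suc.IH open_UNIV)
    qed
  qed simp
  then show ?thesis by (simp add: smooth_on_iff_Cn_on)
qed

definition bump :: "'a::real_inner \<Rightarrow> real \<Rightarrow> 'a \<Rightarrow> real" where
  "bump x0 r x = flat 0 (r\<^sup>2 - (x - x0) \<bullet> (x - x0))"

lemma bump_nonneg: "0 \<le> bump x0 r x"
  by (simp add: bump_def flat_def)

lemma bump_nonzero_iff: "r > 0 \<Longrightarrow> bump x0 r x \<noteq> 0 \<longleftrightarrow> dist x0 x < r"
proof -
  assume r: "r > 0"
  have "(x - x0) \<bullet> (x - x0) = (dist x0 x)\<^sup>2"
    by (simp add: dist_norm norm_minus_commute power2_norm_eq_inner)
  then have "bump x0 r x \<noteq> 0 \<longleftrightarrow> (dist x0 x)\<^sup>2 < r\<^sup>2" by (simp add: bump_def flat_def)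
  also have "\<dots> \<longleftrightarrow> dist x0 x < r" using r by (simp add: power_mono_iff flip: not_le)
  finally show ?thesis .
qed

lemma smooth_on_bump: "smooth_on UNIV (bump (x0::'a::euclidean_space) r)"
proof -
  have 1: "smooth_on UNIV (\<lambda>x. x + (- x0))" by (intro smooth_on_add smooth_on_id smooth_on_const open_UNIV)
  have "smooth_on UNIV (\<lambda>x. r\<^sup>2 + (- 1) * ((x + (-x0)) \<bullet> (x + (-x0))))"
    by (intro smooth_on_add smooth_on_const open_UNIV smooth_on_mult smooth_on_bilinear[OF _ bounded_bilinear_inner] 1)
  then have "smooth_on UNIV (\<lambda>x. flat 0 (r\<^sup>2 + (- 1) * ((x + (-x0)) \<bullet> (x + (-x0)))))"
    by (intro smooth_on_compose[OF open_UNIV open_UNIV _ _ smooth_on_flat]) auto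
  then show ?thesis by (simp add: bump_def[abs_def])
qed

section \<open>Dolbeault operators and closedness of the fundamental form\<close>

lemma bounded_linear_vec_scale: "bounded_linear (\<lambda>a :: complex ^ 'm::finite. c *s a)"
  by (subst linear_conv_bounded_linear[symmetric])
    (auto intro!: linearI simp: vec_eq_iff algebra_simps)

lemma bounded_bilinear_wedge: "bounded_bilinear ((\<^bold>\<and>) :: 'n::{finite,linorder} cform \<Rightarrow> _)"
proof -
  have r: "r *\<^sub>R a = of_real r *s a" for r and a :: "'n cform"
    by (simp add: vec_eq_iff scaleR_conv_of_real[where 'a = complex])
  have "bilinear ((\<^bold>\<and>) :: 'n cform \<Rightarrow> _)"
    unfolding bilinear_def
    by (auto intro!: linearI simp: wedge_add_left wedge_add_right r wedge_scale_left wedge_scale_right)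
  then show ?thesis by (simp add: bilinear_conv_bounded_bilinear)
qed

text \<open>The two kinds of Wirtinger derivatives differ only in the sign of \<open>\<i>\<close>, which
  \<open>covec_unit\<close> records.\<close>

fun covec_index :: "'n covec \<Rightarrow> 'n" where "covec_index (Dz j) = j" | "covec_index (Dzbar j) = j"
fun covec_unit :: "'n covec \<Rightarrow> complex" where "covec_unit (Dz j) = - \<i>" | "covec_unit (Dzbar j) = \<i>"

lemma wirtinger_eq:
  "wirtinger e f x = (1/2) *s (frechet_derivative f (at x) (axis (covec_index e) 1)
     + covec_unit e *s frechet_derivative f (at x) (axis (covec_index e) \<i>))"
  by (cases e) (simp_all add: vec_eq_iff)

lemma wirtinger_has_derivative:
  "(f has_derivative f') (at x) \<Longrightarrow>
    wirtinger e f x = (1/2) *s (f' (axis (covec_index e) 1) + covec_unit e *s f' (axis (covec_index e) \<i>))"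
  unfolding wirtinger_eq by (simp flip: frechet_derivative_at)

lemma wirtinger_cong_open:
  "open S \<Longrightarrow> x \<in> S \<Longrightarrow> (\<And>y. y \<in> S \<Longrightarrow> f y = g y) \<Longrightarrow> wirtinger e f x = wirtinger e g x"
  unfolding wirtinger_eq using frechet_derivative_cong_open[of S x f g] by simp

lemma wirtinger_const: "wirtinger e (\<lambda>y. c) x = 0"
  by (simp add: wirtinger_has_derivative[OF has_derivative_const])

lemma wirtinger_wedge:
  assumes "f differentiable (at x)" "g differentiable (at x)"
  shows "wirtinger e (\<lambda>y. f y \<^bold>\<and> g y) x = wirtinger e f x \<^bold>\<and> g x + f x \<^bold>\<and> wirtinger e g x"
proof -
  have "(f has_derivative frechet_derivative f (at x)) (at x)" "(g has_derivative frechet_derivative g (at x)) (at x)"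
    using assms by (simp_all add: frechet_derivative_works)
  note d = bounded_bilinear.FDERIV[OF bounded_bilinear_wedge this]
  show ?thesis
    unfolding wirtinger_has_derivative[OF d] wirtinger_eq[of e f] wirtinger_eq[of e g]
    by (simp only: wedge_add_left wedge_add_right wedge_scale_left wedge_scale_right vector_add_ldistrib
        add_ac)
qed

lemma wirtinger_linear:
  assumes "f differentiable (at x)" "bounded_linear L" "\<And>c a. L (c *s a) = c *s L a"
  shows "wirtinger e (\<lambda>y. L (f y)) x = L (wirtinger e f x)"
proof -
  have "(f has_derivative frechet_derivative f (at x)) (at x)"
    using assms by (simp add: frechet_derivative_works)
  note d = bounded_linear.has_derivative[OF assms(2) this]
  interpret L: bounded_linear L by fact
  show ?thesis
    unfolding wirtinger_has_derivative[OF d] wirtinger_eq[of e f] by (simp only: assms(3) L.add)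
qed

lemma smooth_on_wirtinger:
  assumes "open S" "smooth_on S f" shows "smooth_on S (\<lambda>x. wirtinger e f x)"
  unfolding wirtinger_eq
  by (intro smooth_on_bounded_linear[OF assms(1) bounded_linear_vec_scale] smooth_on_add assms
      smooth_on_frechet)

lemma wedge_zero_right: "a \<^bold>\<and> 0 = 0"
  by (simp add: wedge_def vec_eq_iff)

text \<open>This is \<open>\<partial>\<close> for \<open>E = Dz\<close> and its conjugate operator for
  \<open>E = Dzbar\<close>.\<close>

definition dolbeault :: "('n \<Rightarrow> 'n covec) \<Rightarrow> ('n cvec \<Rightarrow> 'n::{finite,linorder} cform) \<Rightarrow> 'n cvec \<Rightarrow> 'n cform" where
  "dolbeault E a x = (\<Sum>j. covector (E j) \<^bold>\<and> wirtinger (E j) a x)"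

lemma del_eq_dolbeault: "del = dolbeault Dz" and delbar_eq_dolbeault: "delbar = dolbeault Dzbar"
  by (simp_all add: fun_eq_iff del_def delbar_def dolbeault_def)

lemma dolbeault_cong_open:
  "open S \<Longrightarrow> x \<in> S \<Longrightarrow> (\<And>y. y \<in> S \<Longrightarrow> f y = g y) \<Longrightarrow> dolbeault E f x = dolbeault E g x"
  unfolding dolbeault_def using wirtinger_cong_open[of S x f g] by simp

lemma dolbeault_const: "dolbeault E (\<lambda>y. c) x = 0"
  by (simp add: dolbeault_def wirtinger_const wedge_zero_right)

lemma dolbeault_scale:
  assumes "f differentiable (at x)"
  shows "dolbeault E (\<lambda>y. c *s f y) x = c *s dolbeault E f x"
proof -
  have "wirtinger e (\<lambda>y. c *s f y) x = c *s wirtinger e f x" for e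
  proof (rule wirtinger_linear[OF assms bounded_linear_vec_scale])
    show "c *s (c' *s a) = c' *s (c *s a)" for c' and a :: "'a cform"
      by (simp only: vector_smult_assoc mult.commute)
  qed
  then show ?thesis
    by (simp add: dolbeault_def wedge_scale_right vec.scale_sum_right)
qed

lemma smooth_on_dolbeault:
  "open S \<Longrightarrow> smooth_on S f \<Longrightarrow> smooth_on S (\<lambda>x. dolbeault E f x)"
  unfolding dolbeault_def
  by (intro smooth_on_sum smooth_on_bilinear[OF _ bounded_bilinear_wedge] smooth_on_const smooth_on_wirtinger)

definition central :: "'n::{finite,linorder} exterior \<Rightarrow> bool" where
  "central a \<longleftrightarrow> (\<forall>b. a * b = b * a)"

lemma centralD: "central a \<Longrightarrow> a * b = b * a"
  unfolding central_def by blast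

lemma central_power: "central a \<Longrightarrow> central (a ^ m)"
proof (induction m)
  case (Suc m)
  have "a * a ^ m * b = b * (a * a ^ m)" for b
  proof -
    have "a * a ^ m * b = a * (b * a ^ m)"
      using centralD[OF Suc.IH[OF Suc.prems], of b] by (simp only: mult.assoc)
    also have "\<dots> = (a * b) * a ^ m" by (simp only: mult.assoc)
    also have "\<dots> = (b * a) * a ^ m" by (simp only: centralD[OF Suc.prems, of b])
    finally show ?thesis by (simp only: mult.assoc)
  qed
  then show ?case unfolding central_def by (simp only: power_Suc) blast
qed (simp add: central_def)

text \<open>The Leibniz rule carries no sign because the left factor is central.\<close>

lemma dolbeault_wedge:
  assumes "f differentiable (at x)" "g differentiable (at x)" "central (to_ext (f x))"
  shows "to_ext (dolbeault E (\<lambda>y. f y \<^bold>\<and> g y) x) =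
    to_ext (dolbeault E f x) * to_ext (g x) + to_ext (f x) * to_ext (dolbeault E g x)"
proof -
  have "cv e * (to_ext (f x) * z) = to_ext (f x) * (cv e * z)" for e z
  proof -
    have "cv e * (to_ext (f x) * z) = (cv e * to_ext (f x)) * z" by (simp only: mult.assoc)
    also have "cv e * to_ext (f x) = to_ext (f x) * cv e" by (rule centralD[OF assms(3), symmetric])
    finally show ?thesis by (simp only: mult.assoc)
  qed
  then show ?thesis
    by (simp add: dolbeault_def wirtinger_wedge[OF assms(1,2)] to_ext_sum to_ext_simps to_ext_covector
        distrib_left sum.distrib sum_distrib_left sum_distrib_right mult.assoc)
qed

lemma smooth_on_wedge_power:
  "open S \<Longrightarrow> smooth_on S f \<Longrightarrow> smooth_on S (\<lambda>x. wedge_power (f x) m)"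
  by (induction m)
    (auto simp: wedge_power_def intro!: smooth_on_const smooth_on_bilinear[OF _ bounded_bilinear_wedge])

lemma dolbeault_wedge_power:
  assumes "open S" "x \<in> S" "smooth_on S f" "central (to_ext (f x))"
  shows "to_ext (dolbeault E (\<lambda>y. wedge_power (f y) m) x) =
    of_nat m * (to_ext (f x) ^ (m - 1) * to_ext (dolbeault E f x))"
proof (induction m)
  case 0
  show ?case by (simp add: wedge_power_def dolbeault_const)
next
  case (Suc m)
  let ?F = "to_ext (f x)" and ?d = "to_ext (dolbeault E f x)"
  have "(\<lambda>y. wedge_power (f y) (Suc m)) = (\<lambda>y. f y \<^bold>\<and> wedge_power (f y) m)"
    by (simp add: wedge_power_def)
  then have "to_ext (dolbeault E (\<lambda>y. wedge_power (f y) (Suc m)) x) =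
      ?d * ?F ^ m + ?F * (of_nat m * (?F ^ (m - 1) * ?d))"
    using dolbeault_wedge[OF smooth_onD(2)[OF assms(3,2)]
        smooth_onD(2)[OF smooth_on_wedge_power[OF assms(1,3)] assms(2)] assms(4)] Suc
    by (simp add: to_ext_power)
  also have "?d * ?F ^ m = ?F ^ m * ?d"
    by (rule centralD[OF central_power[OF assms(4)], symmetric])
  also have "?F * (of_nat m * (?F ^ (m - 1) * ?d)) = of_nat m * (?F ^ m * ?d)"
  proof (cases m)
    case (Suc p)
    have "?F * (of_nat m * (?F ^ p * ?d)) = of_nat m * (?F * (?F ^ p * ?d))"
      by (simp only: sc_of_nat[symmetric] sc_left_commute[of ?F])
    then show ?thesis by (simp add: Suc mult.assoc del: of_nat_Suc)
  qed simp
  finally show ?case by (simp add: distrib_right)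
qed

definition omega :: "'n::{finite,linorder} cmat \<Rightarrow> 'n cform" where
  "omega M = (\<Sum>j k. (\<i> * M $ j $ k) *s (covector (Dz j) \<^bold>\<and> covector (Dzbar k)))"

lemma fundamental_form_omega: "fundamental_form h c x = omega (h c x)"
  by (simp add: fundamental_form_def omega_def)

lemma to_ext_omega:
  "to_ext (omega M) = (\<Sum>j k. sc (\<i> * M $ j $ k) * (cv (Dz j) * cv (Dzbar k)))"
  by (simp only: omega_def to_ext_sum to_ext_simps(5,6) to_ext_covector)

text \<open>Forms of even degree are central.\<close>

lemma central_omega: "central (to_ext (omega M))"
proof -
  have *: "sc c * (cv (Dz j) * cv (Dzbar k)) * b = b * (sc c * (cv (Dz j) * cv (Dzbar k)))" for c j k b
    by (simp only: sc_left_commute[of b] mult.assoc cv_pair_central[of _ _ b, symmetric])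
  then show ?thesis
    unfolding central_def to_ext_omega sum_distrib_left sum_distrib_right by (intro allI sum.cong refl *)
qed

lemma omega_nth: "omega M $ K = (\<Sum>j k. \<i> * M $ j $ k * (covector (Dz j) \<^bold>\<and> covector (Dzbar k)) $ K)"
  by (simp add: omega_def)

lemma bounded_linear_omega: "bounded_linear omega"
  by (subst linear_conv_bounded_linear[symmetric])
    (auto intro!: linearI simp: vec_eq_iff omega_nth algebra_simps sum.distrib scaleR_sum_right)

text \<open>The derivative \<open>\<partial>h\<^sub>j\<^sub>k/\<partial>z\<^sub>l\<close>.\<close>

definition dmetric :: "('n::finite cvec \<Rightarrow> 'n cmat) \<Rightarrow> 'n cvec \<Rightarrow> 'n \<Rightarrow> 'n \<Rightarrow> 'n \<Rightarrow> complex" where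
  "dmetric h x l j k = (1/2) * (frechet_derivative h (at x) (axis l 1) $ j $ k -
      \<i> * frechet_derivative h (at x) (axis l \<i>) $ j $ k)"

lemma wirtinger_omega:
  assumes "h differentiable (at x)"
  shows "wirtinger e (\<lambda>y. omega (h y)) x =
    omega (\<chi> j k. (1/2) * (frechet_derivative h (at x) (axis (covec_index e) 1) $ j $ k +
      covec_unit e * frechet_derivative h (at x) (axis (covec_index e) \<i>) $ j $ k))"
proof -
  have "(h has_derivative frechet_derivative h (at x)) (at x)"
    using assms by (simp add: frechet_derivative_works)
  note d = bounded_linear.has_derivative[OF bounded_linear_omega this]
  show ?thesis
    unfolding wirtinger_has_derivative[OF d]
    by (simp add: vec_eq_iff omega_nth sum_distrib_left sum.distrib[symmetric] algebra_simps)
qed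

text \<open>Conjugating exchanges the two Wirtinger derivatives and, since the metric is Hermitian, the two
  matrix indices.\<close>

lemma dmetric_bar:
  assumes "open S" "x \<in> S" "smooth_on S h" "\<And>y. y \<in> S \<Longrightarrow> hermitian_pos (h y)"
  shows "(1/2) * (frechet_derivative h (at x) (axis l 1) $ j $ k +
      \<i> * frechet_derivative h (at x) (axis l \<i>) $ j $ k) = cnj (dmetric h x l k j)"
proof -
  have "frechet_derivative h (at x) v $ j $ k = cnj (frechet_derivative h (at x) v $ k $ j)" for v
  proof -
    note d = smooth_onD(1)[OF assms(3,2)]
    have entry: "((\<lambda>y. h y $ j $ k) has_derivative (\<lambda>v. frechet_derivative h (at x) v $ j $ k)) (at x)" for j k
      using bounded_linear.has_derivative[OF bounded_linear_vec_nth
          bounded_linear.has_derivative[OF bounded_linear_vec_nth d]] .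
    have "((\<lambda>y. cnj (h y $ k $ j)) has_derivative (\<lambda>v. cnj (frechet_derivative h (at x) v $ k $ j))) (at x)"
      by (rule bounded_linear.has_derivative[OF bounded_linear_cnj entry])
    then have "((\<lambda>y. h y $ j $ k) has_derivative (\<lambda>v. cnj (frechet_derivative h (at x) v $ k $ j))) (at x)"
    proof (rule has_derivative_transform_within_open[OF _ assms(1,2)])
      fix y assume "y \<in> S"
      then have "hermitian_pos (h y)" by (rule assms(4))
      then show "cnj (h y $ k $ j) = h y $ j $ k" unfolding hermitian_pos_def by (metis complex_cnj_cnj)
    qed
    from has_derivative_unique[OF entry this] show ?thesis by (rule fun_cong)
  qed
  then show ?thesis by (simp add: dmetric_def)
qed

text \<open>The trace condition holds on an open set, so the equation
  \<open>\<omega>\<^sup>n\<^sup>-\<^sup>2 \<and> \<delta>\<omega> = 0\<close> that it implies can be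
  differentiated. Comparison with the Gauduchon equation kills
  \<open>\<omega>\<^sup>n\<^sup>-\<^sup>3 \<and> \<partial>\<omega> \<and> \<delta>\<omega>\<close>,
  and the Hodge--Riemann relation concludes.\<close>

theorem torsion_trace_gauduchon_imp_closed:
  fixes h :: "'n::{finite,linorder} cvec \<Rightarrow> 'n cmat"
  defines "\<omega> \<equiv> \<lambda>y. omega (h y)"
  assumes S: "open S" and h: "smooth_on S h" and pos: "\<And>y. y \<in> S \<Longrightarrow> hermitian_pos (h y)"
    and trace: "\<And>y a. y \<in> S \<Longrightarrow>
      (\<Sum>c d. matrix_inv (h y) $ d $ c * (dmetric h y a c d - dmetric h y c a d)) = 0"
    and k: "1 \<le> k" "k + 2 \<le> CARD('n)" and x: "x \<in> S"
    and gauduchon: "\<i> *s (wedge_power (\<omega> x) (CARD('n) - k - 1) \<^bold>\<and>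
       del (delbar (\<lambda>y. wedge_power (\<omega> y) k)) x) = 0"
  shows "ext_d \<omega> x = 0"
proof -
  define n where "n = CARD('n)"
  have n: "3 \<le> n" using k by (simp add: n_def)
  have smooth: "smooth_on S \<omega>"
    unfolding \<omega>_def by (rule smooth_on_bounded_linear[OF S bounded_linear_omega h])
  have centr: "central (to_ext (\<omega> y))" for y by (simp add: \<omega>_def central_omega)
  have smooth': "smooth_on S (\<lambda>y. delbar \<omega> y)"
    unfolding delbar_eq_dolbeault by (rule smooth_on_dolbeault[OF S smooth])
  have d: "to_ext (del \<omega> y) = (\<Sum>l j k.
      sc (\<i> * dmetric h y l j k) * (cv (Dz l) * (cv (Dz j) * cv (Dzbar k))))" if "y \<in> S" for y
  proof -
    have "wirtinger (Dz l) \<omega> y = omega (\<chi> j k. dmetric h y l j k)" for l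
      unfolding \<omega>_def wirtinger_omega[OF smooth_onD(2)[OF h that]] by (simp add: dmetric_def)
    then show ?thesis
      by (simp only: del_def to_ext_sum to_ext_simps(5) to_ext_covector to_ext_omega vec_lambda_beta
          sum_distrib_left sc_left_commute[of "cv _"])
  qed
  have b: "to_ext (delbar \<omega> y) = (\<Sum>l j k.
      sc (\<i> * cnj (dmetric h y l k j)) * (cv (Dzbar l) * (cv (Dz j) * cv (Dzbar k))))" if "y \<in> S" for y
  proof -
    have "wirtinger (Dzbar l) \<omega> y = omega (\<chi> j k. cnj (dmetric h y l k j))" for l
      unfolding \<omega>_def wirtinger_omega[OF smooth_onD(2)[OF h that]] covec_index.simps covec_unit.simps
      using dmetric_bar[OF S that h pos] by simp
    then show ?thesis
      by (simp only: delbar_def to_ext_sum to_ext_simps(5) to_ext_covector to_ext_omega vec_lambda_beta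
          sum_distrib_left sc_left_commute[of "cv _"])
  qed
  note torsion = pointwise_torsion[OF pos n[unfolded n_def] trace, folded to_ext_omega n_def]
  let ?O = "to_ext (\<omega> x)" and ?d = "to_ext (del \<omega> x)" and ?b = "to_ext (delbar \<omega> x)"
    and ?D = "to_ext (del (delbar \<omega>) x)"
  let ?X = "?O ^ (n - 3) * (?d * ?b)" and ?Y = "?O ^ (n - 2) * ?D"
  have zero: "wedge_power (\<omega> y) (n - 2) \<^bold>\<and> delbar \<omega> y = 0" if "y \<in> S" for y
  proof -
    have "to_ext (delbar \<omega> y) * to_ext (\<omega> y) ^ (n - 2) = 0"
      using torsion(1)[OF that that] b[OF that] by (simp only: \<omega>_def)
    then have "to_ext (\<omega> y) ^ (n - 2) * to_ext (delbar \<omega> y) = 0"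
      by (simp only: centralD[OF central_power[OF centr]])
    then have "to_ext (wedge_power (\<omega> y) (n - 2) \<^bold>\<and> delbar \<omega> y) = 0"
      by (simp only: to_ext_simps(5) to_ext_power)
    then show ?thesis by simp
  qed
  have product: "to_ext (del (\<lambda>y. wedge_power (\<omega> y) m \<^bold>\<and> delbar \<omega> y) x) =
      of_nat m * (?O ^ (m - 1) * (?d * ?b)) + ?O ^ m * ?D" for m
  proof -
    have cp: "central (to_ext (wedge_power (\<omega> x) m))"
      unfolding to_ext_power by (rule central_power[OF centr])
    show ?thesis
      unfolding del_eq_dolbeault
      using dolbeault_wedge[OF smooth_onD(2)[OF smooth_on_wedge_power[OF S smooth] x] smooth_onD(2)[OF smooth' x] cp, of Dz]
        dolbeault_wedge_power[OF S x smooth centr, of Dz m]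
      by (simp only: to_ext_power mult.assoc)
  qed
  (* The trace condition gives one relation between the two top forms, the Gauduchon condition another one. *)
  have XY1: "of_nat (n - 2) * ?X + ?Y = 0"
  proof -
    have "del (\<lambda>y. wedge_power (\<omega> y) (n - 2) \<^bold>\<and> delbar \<omega> y) x = del (\<lambda>y. 0) x"
      unfolding del_eq_dolbeault by (rule dolbeault_cong_open[OF S x zero])
    then have "to_ext (del (\<lambda>y. wedge_power (\<omega> y) (n - 2) \<^bold>\<and> delbar \<omega> y) x) = 0"
      by (simp add: del_eq_dolbeault dolbeault_const)
    moreover have "n - 2 - 1 = n - 3" by simp
    ultimately show ?thesis unfolding product by simp
  qed
  have XY2: "of_nat (k - 1) * ?X + ?Y = 0"
  proof -
    have "delbar (\<lambda>y. wedge_power (\<omega> y) k) y = of_nat k *s (wedge_power (\<omega> y) (k - 1) \<^bold>\<and> delbar \<omega> y)"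
      if "y \<in> S" for y
    proof -
      have "to_ext (delbar (\<lambda>y. wedge_power (\<omega> y) k) y) =
          to_ext (of_nat k *s (wedge_power (\<omega> y) (k - 1) \<^bold>\<and> delbar \<omega> y))"
        using dolbeault_wedge_power[OF S that smooth centr, of Dzbar k]
        by (simp only: delbar_eq_dolbeault to_ext_simps(5,6) to_ext_power sc_of_nat)
      then show ?thesis by simp
    qed
    then have "del (delbar (\<lambda>y. wedge_power (\<omega> y) k)) x =
        del (\<lambda>y. of_nat k *s (wedge_power (\<omega> y) (k - 1) \<^bold>\<and> delbar \<omega> y)) x"
      unfolding del_eq_dolbeault by (rule dolbeault_cong_open[OF S x])
    also have "\<dots> = of_nat k *s del (\<lambda>y. wedge_power (\<omega> y) (k - 1) \<^bold>\<and> delbar \<omega> y) x"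
      unfolding del_eq_dolbeault
      by (intro dolbeault_scale smooth_onD(2)[OF _ x] smooth_on_bilinear[OF S bounded_bilinear_wedge]
          smooth_on_wedge_power[OF S smooth] smooth')
    finally have "to_ext (del (delbar (\<lambda>y. wedge_power (\<omega> y) k)) x) =
        sc (of_nat k) * (of_nat (k - 1) * (?O ^ (k - 1 - 1) * (?d * ?b)) + ?O ^ (k - 1) * ?D)"
      by (simp only: to_ext_simps(6) product)
    moreover have "to_ext (\<i> *s (wedge_power (\<omega> x) (n - k - 1) \<^bold>\<and> del (delbar (\<lambda>y. wedge_power (\<omega> y) k)) x)) = 0"
      using gauduchon by (simp add: n_def)
    ultimately have "sc \<i> * (sc (of_nat k) * (?O ^ (n - k - 1) * (of_nat (k - 1) * (?O ^ (k - 1 - 1) * (?d * ?b)) + ?O ^ (k - 1) * ?D))) = 0"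
      by (simp only: to_ext_simps(5,6) to_ext_power sc_left_commute[of "_ ^ _"])
    then have "?O ^ (n - k - 1) * (of_nat (k - 1) * (?O ^ (k - 1 - 1) * (?d * ?b)) + ?O ^ (k - 1) * ?D) = 0"
      using k(1) unfolding sc_mult_eq_0_iff by simp
    moreover have "?O ^ (n - k - 1) * (of_nat (k - 1) * (?O ^ (k - 1 - 1) * (?d * ?b))) = of_nat (k - 1) * ?X"
    proof (cases "k = 1")
      case False
      then have "n - k - 1 + (k - 1 - 1) = n - 3" using k by (simp add: n_def)
      then have "?O ^ (n - k - 1) * ?O ^ (k - 1 - 1) = ?O ^ (n - 3)" by (simp only: power_add[symmetric])
      moreover have "?O ^ (n - k - 1) * (of_nat (k - 1) * (?O ^ (k - 1 - 1) * (?d * ?b))) =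
          of_nat (k - 1) * (?O ^ (n - k - 1) * (?O ^ (k - 1 - 1) * (?d * ?b)))"
        by (simp only: sc_of_nat[symmetric] sc_left_commute[of "_ ^ _"])
      moreover have "?O ^ (n - k - 1) * (?O ^ (k - 1 - 1) * (?d * ?b)) =
          (?O ^ (n - k - 1) * ?O ^ (k - 1 - 1)) * (?d * ?b)"
        by (simp only: mult.assoc)
      ultimately show ?thesis by (simp only:)
    qed simp
    moreover have "?O ^ (n - k - 1) * (?O ^ (k - 1) * ?D) = ?Y"
    proof -
      have "n - k - 1 + (k - 1) = n - 2" using k by (simp add: n_def)
      then show ?thesis by (simp only: mult.assoc[symmetric] power_add[symmetric])
    qed
    ultimately show ?thesis by (simp only: distrib_left)
  qed
  have "sc (of_nat (n - 2) - of_nat (k - 1)) * ?X = 0"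
  proof -
    have "of_nat (n - 2) * ?X = of_nat (k - 1) * ?X" using XY1 XY2 by (metis add_right_cancel)
    then show ?thesis by (simp only: sc_simps sc_of_nat left_diff_distrib diff_self)
  qed
  moreover have "(of_nat (n - 2) - of_nat (k - 1) :: complex) \<noteq> 0"
  proof -
    have "n - 2 \<noteq> k - 1" using k by (simp add: n_def)
    then show ?thesis by (simp only: right_minus_eq of_nat_eq_iff not_False_eq_True)
  qed
  ultimately have "?X = 0" by (simp only: sc_mult_eq_0_iff) blast
  then have "?d = 0 \<and> ?b = 0"
    using torsion(2)[OF x x] d[OF x] b[OF x] by (simp only: \<omega>_def)
  then show ?thesis by (simp add: ext_d_def)
qed

section \<open>One-forms extended by zero from a chart\<close>

lemma minor_singleton:
  "minor m {e} J = (if card J = 1 then m e (the_elem J) else 0)"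
proof (cases "card J = 1")
  case True
  then obtain f where J: "J = {f}" by (auto simp: card_1_singleton_iff)
  have "{\<pi>. \<pi> permutes {..<Suc 0}} = {id}"
    by (simp add: lessThan_Suc permutes_sing)
  then show ?thesis by (simp add: minor_def J sign_id)
qed (simp add: minor_def)

text \<open>For forms of degree one the minors of the Jacobian are its entries.\<close>

lemma pullback_one_form:
  fixes \<beta> :: "'n::{finite,linorder} cvec \<Rightarrow> 'n cform"
  assumes "\<And>I. card I \<noteq> 1 \<Longrightarrow> \<beta> (T x) $ I = 0"
  shows "pullback T \<beta> x = (\<Sum>f. (\<Sum>g. \<beta> (T x) $ {g} * jacobian T x g f) *s covector f)"
proof (rule vec_eq_iff[THEN iffD2], rule allI)
  fix J
  have "pullback T \<beta> x $ J = (\<Sum>I\<in>range (\<lambda>g. {g}). \<beta> (T x) $ I * minor (jacobian T x) I J)"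
    unfolding pullback_def vec_lambda_beta
  proof (rule sum.mono_neutral_right)
    show "\<forall>I\<in>UNIV - range (\<lambda>g. {g}). \<beta> (T x) $ I * minor (jacobian T x) I J = 0"
      using assms by (auto simp: card_1_singleton_iff image_iff)
  qed auto
  also have "\<dots> = (\<Sum>g. \<beta> (T x) $ {g} * minor (jacobian T x) {g} J)"
    by (subst sum.reindex) (auto simp: inj_on_def)
  finally have *: "pullback T \<beta> x $ J = (\<Sum>g. \<beta> (T x) $ {g} * minor (jacobian T x) {g} J)" .
  show "pullback T \<beta> x $ J = (\<Sum>f. (\<Sum>g. \<beta> (T x) $ {g} * jacobian T x g f) *s covector f) $ J"
  proof (cases "card J = 1")
    case True
    then obtain f0 where J: "J = {f0}" by (auto simp: card_1_singleton_iff)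
    have "(\<Sum>f. (\<Sum>g. \<beta> (T x) $ {g} * jacobian T x g f) * covector f $ J) =
        (\<Sum>f. if f = f0 then (\<Sum>g. \<beta> (T x) $ {g} * jacobian T x g f) else 0)"
      by (intro sum.cong) (auto simp: J covector_def axis_nth_if)
    then show ?thesis by (simp add: *[unfolded J] J minor_singleton)
  next
    case False
    then have "covector f $ J = 0" for f :: "'n covec" by (auto simp: covector_def axis_nth_if)
    then show ?thesis using False by (simp add: * minor_singleton)
  qed
qed

text \<open>This is
  \<open>du = \<Sum>j (\<partial>u/\<partial>z\<^sub>j dz\<^sub>j + \<partial>u/\<partial>\<zeta>\<^sub>j d\<zeta>\<^sub>j)\<close>,
  evaluated on a vector.\<close>

lemma real_derivative_wirtinger:
  fixes u :: "'n::finite cvec \<Rightarrow> complex ^ 'm::finite"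
  assumes "u differentiable (at y)"
  shows "frechet_derivative u (at y) v =
    (\<Sum>j. v $ j *s wirtinger (Dz j) u y + cnj (v $ j) *s wirtinger (Dzbar j) u y)"
proof -
  have "(u has_derivative frechet_derivative u (at y)) (at y)"
    using assms by (simp add: frechet_derivative_works)
  then interpret D: linear "frechet_derivative u (at y)" by (rule has_derivative_linear)
  have v: "v = (\<Sum>j. Re (v $ j) *\<^sub>R axis j 1 + Im (v $ j) *\<^sub>R axis j \<i>)"
  proof -
    have "(\<Sum>j. Re (v $ j) *\<^sub>R (axis j 1 :: 'n cvec) + Im (v $ j) *\<^sub>R axis j \<i>) $ i =
        (\<Sum>j. if j = i then v $ i else 0)" for i
      unfolding sum_component by (intro sum.cong) (auto simp: axis_nth_if complex_eq_iff)
    then show ?thesis by (simp add: vec_eq_iff)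
  qed
  have "frechet_derivative u (at y) v = (\<Sum>j. Re (v $ j) *\<^sub>R frechet_derivative u (at y) (axis j 1)
      + Im (v $ j) *\<^sub>R frechet_derivative u (at y) (axis j \<i>))"
    by (subst v) (simp add: D.sum D.add D.scale)
  also have "\<dots> = (\<Sum>j. v $ j *s wirtinger (Dz j) u y + cnj (v $ j) *s wirtinger (Dzbar j) u y)"
    by (intro sum.cong refl) (simp add: vec_eq_iff complex_eq_iff field_simps)
  finally show ?thesis .
qed

text \<open>The coordinates \<open>(z, \<zeta>)\<close> of a point. In them the Jacobian consists of Wirtinger
  derivatives, and the chain rule takes its usual form.\<close>

definition covec_coords :: "'n cvec \<Rightarrow> complex ^ ('n::finite covec)" where
  "covec_coords v = (\<chi> e. case e of Dz j \<Rightarrow> v $ j | Dzbar j \<Rightarrow> cnj (v $ j))"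

lemma jacobian_covec_coords: "jacobian T x e f = wirtinger f (\<lambda>y. covec_coords (T y)) x $ e"
  by (simp add: jacobian_def covec_coords_def)

lemma bounded_linear_covec_coords: "bounded_linear covec_coords"
  by (subst linear_conv_bounded_linear[symmetric])
    (auto intro!: linearI simp: vec_eq_iff covec_coords_def split: covec.split)

lemma wirtinger_chain:
  fixes u :: "'n::finite cvec \<Rightarrow> complex ^ 'm::finite" and T :: "'n cvec \<Rightarrow> 'n cvec"
  assumes u: "u differentiable (at (T x))" and T: "T differentiable (at x)"
  shows "wirtinger g (\<lambda>y. u (T y)) x $ m = (\<Sum>f. wirtinger f u (T x) $ m * jacobian T x f g)"
proof -
  let ?t = "frechet_derivative T (at x)"
  have dT: "(T has_derivative ?t) (at x)" using T by (simp add: frechet_derivative_works)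
  have du: "(u has_derivative frechet_derivative u (at (T x))) (at (T x))"
    using u by (simp add: frechet_derivative_works)
  have jac: "jacobian T x f g = (1/2) * (covec_coords (?t (axis (covec_index g) 1)) $ f +
      covec_unit g * covec_coords (?t (axis (covec_index g) \<i>)) $ f)" for f
    unfolding jacobian_covec_coords
      wirtinger_has_derivative[OF bounded_linear.has_derivative[OF bounded_linear_covec_coords dT]]
    by simp
  show ?thesis
    unfolding wirtinger_has_derivative[OF has_derivative_compose[OF dT du]] real_derivative_wirtinger[OF u]
      sum_covec jac
    by (simp add: covec_coords_def sum_distrib_left sum.distrib[symmetric] algebra_simps)
qed

lemma complex_chartD:
  assumes "complex_chart X c"
  shows "openin X (fst c)" "open (chart_image c)" "inj_on (snd c) (fst c)"
    and "openin X W \<Longrightarrow> W \<subseteq> fst c \<Longrightarrow> open (snd c ` W)"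
    and "compact K \<Longrightarrow> K \<subseteq> chart_image c \<Longrightarrow> compactin X {p \<in> fst c. snd c p \<in> K}"
proof -
  show o: "openin X (fst c)" "open (chart_image c)" using assms by (auto simp: complex_chart_def)
  have hom: "homeomorphic_map (subtopology X (fst c)) (top_of_set (chart_image c)) (snd c)"
    using assms by (auto simp: complex_chart_def)
  have top: "topspace (subtopology X (fst c)) = fst c"
    using openin_subset[OF o(1)] by (simp add: inf_absorb2)
  show inj: "inj_on (snd c) (fst c)"
    using homeomorphic_imp_injective_map[OF hom] by (simp only: top)
  show "open (snd c ` W)" if "openin X W" "W \<subseteq> fst c"
  proof -
    have "openin (subtopology X (fst c)) W"
      using that by (auto simp: openin_subtopology)
    then have "openin (top_of_set (chart_image c)) (snd c ` W)"
      using homeomorphic_imp_open_map[OF hom] by (simp add: open_map_def)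
    then show ?thesis using o(2) openin_open_trans by blast
  qed
  show "compactin X {p \<in> fst c. snd c p \<in> K}" if "compact K" "K \<subseteq> chart_image c"
  proof -
    have sub: "{p \<in> fst c. snd c p \<in> K} \<subseteq> topspace (subtopology X (fst c))" by (auto simp only: top)
    have "snd c ` {p \<in> fst c. snd c p \<in> K} = K" using that(2) by (auto simp: chart_image_def)
    moreover have "compactin (top_of_set (chart_image c)) K"
      using that by (simp add: compactin_subtopology)
    ultimately have "compactin (subtopology X (fst c)) {p \<in> fst c. snd c p \<in> K}"
      using homeomorphic_map_compactness[OF hom sub] by simp
    then show ?thesis by (simp add: compactin_subtopology)
  qed
qed

locale complex_manifold =
  fixes X :: "'a topology" and A :: "('a, 'n::{finite,linorder}) chart set"
  assumes manifold: "compact_complex_manifold X A"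
begin

lemma chart: "c \<in> A \<Longrightarrow> complex_chart X c"
  using manifold by (auto simp: compact_complex_manifold_def complex_atlas_def)

lemma open_overlap: "c \<in> A \<Longrightarrow> d \<in> A \<Longrightarrow> open (overlap c d)"
  unfolding overlap_def
  by (intro complex_chartD(4)[OF chart] openin_Int complex_chartD(1)[OF chart]) auto

lemma transition_apply: "c \<in> A \<Longrightarrow> p \<in> fst c \<Longrightarrow> transition c d (snd c p) = snd d p"
  using complex_chartD(3)[OF chart] by (simp add: transition_def)

lemma smooth_transition: "c \<in> A \<Longrightarrow> d \<in> A \<Longrightarrow> smooth_on (overlap c d) (transition c d)"
  using manifold by (auto simp: compact_complex_manifold_def complex_atlas_def holomorphic_map_on_def)

lemma mem_overlap_iff: "c \<in> A \<Longrightarrow> p \<in> fst c \<Longrightarrow> snd c p \<in> overlap c d \<longleftrightarrow> p \<in> fst d"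
proof -
  assume c: "c \<in> A" and p: "p \<in> fst c"
  have "p \<in> fst d" if "snd c p \<in> overlap c d"
  proof -
    from that obtain q where q: "q \<in> fst c" "q \<in> fst d" "snd c p = snd c q" by (auto simp: overlap_def)
    then have "p = q" using inj_onD[OF complex_chartD(3)[OF chart[OF c]]] p by blast
    then show ?thesis using q by simp
  qed
  then show ?thesis using p by (auto simp: overlap_def)
qed

text \<open>The family of local forms that represents \<open>a\<close>, given in the chart \<open>c\<close>,
  on all charts. It is a global form if \<open>a\<close> has compact support inside the chart.\<close>

definition extend_by_zero :: "('a,'n) chart \<Rightarrow> ('n cvec \<Rightarrow> 'n cform) \<Rightarrow> ('a,'n) chart \<Rightarrow> 'n cvec \<Rightarrow> 'n cform" where
  "extend_by_zero c a d y = (if y \<in> overlap d c then pullback (transition d c) a y else 0)"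

context
  fixes c K and a :: "'n cvec \<Rightarrow> 'n cform"
  assumes c: "c \<in> A" and K: "compact K" "K \<subseteq> chart_image c"
    and a_smooth: "smooth_on UNIV a"
    and a_one: "\<And>y I. card I \<noteq> 1 \<Longrightarrow> a y $ I = 0"
    and a_supp: "\<And>y. y \<notin> K \<Longrightarrow> a y = 0"
begin

lemma extend_formula:
  "y \<in> overlap d c \<Longrightarrow> extend_by_zero c a d y =
    (\<Sum>f. (\<Sum>g. a (transition d c y) $ {g} * jacobian (transition d c) y g f) *s covector f)"
  unfolding extend_by_zero_def by (simp add: pullback_one_form[of a, OF a_one])

lemma extend_one: "card I \<noteq> 1 \<Longrightarrow> extend_by_zero c a d y $ I = 0"
proof (cases "y \<in> overlap d c")
  case True
  assume "card I \<noteq> 1"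
  then have "covector f $ I = 0" for f :: "'n covec" by (auto simp: covector_def axis_nth_if)
  then show ?thesis by (simp add: extend_formula[OF True])
qed (simp add: extend_by_zero_def)

text \<open>The support of \<open>a\<close> is compact in the manifold, hence closed by the Hausdorff
  property, and its complement is a neighbourhood of every point outside the domain of
  \<open>c\<close>.\<close>

lemma extend_vanishes_near:
  assumes d: "d \<in> A" and p: "p \<in> fst d" "p \<notin> fst c"
  obtains W where "open W" "snd d p \<in> W" "\<And>y. y \<in> W \<Longrightarrow> extend_by_zero c a d y = 0"
proof -
  let ?K = "{q \<in> fst c. snd c q \<in> K}"
  have "compactin X ?K" by (rule complex_chartD(5)[OF chart[OF c] K])
  then have "closedin X ?K"
    using manifold compactin_imp_closedin by (auto simp: compact_complex_manifold_def)
  then have oW: "openin X (fst d - ?K)" using complex_chartD(1)[OF chart[OF d]] by blast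
  show ?thesis
  proof (rule that)
    show "open (snd d ` (fst d - ?K))" by (rule complex_chartD(4)[OF chart[OF d] oW]) auto
    show "snd d p \<in> snd d ` (fst d - ?K)" using p by auto
    fix y assume "y \<in> snd d ` (fst d - ?K)"
    then obtain q where q: "q \<in> fst d" "q \<notin> ?K" "y = snd d q" by auto
    show "extend_by_zero c a d y = 0"
    proof (cases "y \<in> overlap d c")
      case True
      then have "q \<in> fst c" using q d by (simp add: mem_overlap_iff)
      then have "a (transition d c y) = 0"
        using q d by (intro a_supp) (simp add: transition_apply)
      then show ?thesis by (simp add: extend_formula[OF True])
    qed (simp add: extend_by_zero_def)
  qed
qed

text \<open>Near points in the domain of \<open>c\<close> the form is a pullback under a smooth transition
  map; near all others it vanishes.\<close>

lemma smooth_on_extend: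
  assumes d: "d \<in> A" shows "smooth_on (chart_image d) (extend_by_zero c a d)"
proof (rule smooth_on_local)
  fix y assume "y \<in> chart_image d"
  then obtain p where p: "p \<in> fst d" "y = snd d p" by (auto simp: chart_image_def)
  show "\<exists>U. y \<in> U \<and> smooth_on U (extend_by_zero c a d)"
  proof (cases "p \<in> fst c")
    case True
    let ?U = "overlap d c" and ?T = "transition d c"
    note o = open_overlap[OF d c] and T = smooth_transition[OF d c]
    have "smooth_on ?U (\<lambda>y. jacobian ?T y g f)" for g f
      unfolding jacobian_covec_coords
      by (intro smooth_on_nth smooth_on_wirtinger smooth_on_bounded_linear[OF _ bounded_linear_covec_coords] o T)
    moreover have "smooth_on ?U (\<lambda>y. a (?T y) $ {g})" for g
      by (intro smooth_on_nth o smooth_on_compose[OF o open_UNIV _ T a_smooth]) auto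
    moreover have "bounded_linear (\<lambda>r. r *s v)" for v :: "'n cform"
      by (subst linear_conv_bounded_linear[symmetric]) (auto intro!: linearI simp: vec_eq_iff algebra_simps)
    ultimately have "smooth_on ?U (\<lambda>y. \<Sum>f. (\<Sum>g. a (?T y) $ {g} * jacobian ?T y g f) *s covector f)"
      by (intro smooth_on_sum o smooth_on_bounded_linear[OF o, where L = "\<lambda>r. r *s _"] smooth_on_mult)
    then have "smooth_on ?U (extend_by_zero c a d)"
      by (rule smooth_on_cong[OF o, rotated]) (simp add: extend_formula)
    moreover have "y \<in> ?U" using p True d by (simp add: mem_overlap_iff)
    ultimately show ?thesis by blast
  next
    case False
    then obtain W where "open W" "y \<in> W" "\<And>y. y \<in> W \<Longrightarrow> extend_by_zero c a d y = 0"
      using extend_vanishes_near[OF d p(1)] p(2) by blast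
    then have "smooth_on W (extend_by_zero c a d)"
      by (intro smooth_on_cong[OF _ _ smooth_on_const[of W 0]]) auto
    then show ?thesis using \<open>y \<in> W\<close> by blast
  qed
qed

text \<open>On triple overlaps this is the chain rule for Jacobians.\<close>

lemma extend_compatible:
  assumes d: "d \<in> A" and e: "e \<in> A" and x: "x \<in> overlap d e"
  shows "extend_by_zero c a d x = pullback (transition d e) (extend_by_zero c a e) x"
proof -
  let ?T = "transition d e"
  obtain p where p: "p \<in> fst d" "p \<in> fst e" "x = snd d p" using x by (auto simp: overlap_def)
  have Tx: "?T x = snd e p" using p d by (simp add: transition_apply)
  have pb: "pullback ?T (extend_by_zero c a e) x = (\<Sum>f. (\<Sum>g.
      extend_by_zero c a e (?T x) $ {g} * jacobian ?T x g f) *s covector f)"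
    by (rule pullback_one_form) (rule extend_one)
  show ?thesis
  proof (cases "p \<in> fst c")
    case False
    have "x \<notin> overlap d c" by (simp add: p(3) mem_overlap_iff[OF d p(1)] False)
    moreover have "?T x \<notin> overlap e c" unfolding Tx by (simp add: mem_overlap_iff[OF e p(2)] False)
    ultimately show ?thesis unfolding pb by (simp add: extend_by_zero_def)
  next
    case True
    have xc: "x \<in> overlap d c" by (simp add: p(3) mem_overlap_iff[OF d p(1)] True)
    have Txc: "?T x \<in> overlap e c" unfolding Tx by (simp add: mem_overlap_iff[OF e p(2)] True)
    have same: "transition d c x = transition e c (?T x)"
      using p d e by (simp add: Tx transition_apply)
    have coeff: "extend_by_zero c a e (?T x) $ {f} =
        (\<Sum>g. a (transition d c x) $ {g} * jacobian (transition e c) (?T x) g f)" for f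
    proof -
      have "extend_by_zero c a e (?T x) $ {f} = (\<Sum>f'. if f' = f then
         (\<Sum>g. a (transition d c x) $ {g} * jacobian (transition e c) (?T x) g f') else 0)"
        unfolding extend_formula[OF Txc] same sum_component
        by (intro sum.cong) (auto simp: covector_def axis_nth_if)
      then show ?thesis by simp
    qed
    have chain: "(\<Sum>f. jacobian (transition e c) (?T x) g f * jacobian ?T x f f') = jacobian (transition d c) x g f'" for g f'
    proof -
      let ?u = "\<lambda>y. covec_coords (transition e c y)"
      have "open (snd d ` (fst d \<inter> (fst e \<inter> fst c)))"
        by (intro complex_chartD(4)[OF chart[OF d]] openin_Int complex_chartD(1)[OF chart] c d e) auto
      moreover have "x \<in> snd d ` (fst d \<inter> (fst e \<inter> fst c))" using p True by auto
      moreover have "covec_coords (transition d c y) = ?u (?T y)" if "y \<in> snd d ` (fst d \<inter> (fst e \<inter> fst c))" for y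
        using that d e by (auto simp: transition_apply)
      ultimately have "jacobian (transition d c) x g f' = wirtinger f' (\<lambda>y. ?u (?T y)) x $ g"
        unfolding jacobian_covec_coords by (subst wirtinger_cong_open) auto
      also have "\<dots> = (\<Sum>f. wirtinger f ?u (?T x) $ g * jacobian ?T x f f')"
      proof (rule wirtinger_chain)
        show "?u differentiable at (?T x)"
          by (rule smooth_onD(2)[OF smooth_on_bounded_linear[OF open_overlap[OF e c] bounded_linear_covec_coords
                smooth_transition[OF e c]] Txc])
        show "?T differentiable at x" by (rule smooth_onD(2)[OF smooth_transition[OF d e] x])
      qed
      finally show ?thesis by (simp add: jacobian_covec_coords)
    qed
    have "(\<Sum>f. extend_by_zero c a e (?T x) $ {f} * jacobian ?T x f f') =
       (\<Sum>g. a (transition d c x) $ {g} * jacobian (transition d c) x g f')" for f'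
    proof -
      have "(\<Sum>f. extend_by_zero c a e (?T x) $ {f} * jacobian ?T x f f') =
         (\<Sum>f g. a (transition d c x) $ {g} * (jacobian (transition e c) (?T x) g f * jacobian ?T x f f'))"
        by (simp only: coeff sum_distrib_right mult.assoc)
      also have "\<dots> = (\<Sum>g f. a (transition d c x) $ {g} * (jacobian (transition e c) (?T x) g f * jacobian ?T x f f'))"
        by (rule sum.swap)
      finally show ?thesis by (simp only: sum_distrib_left[symmetric] chain)
    qed
    then show ?thesis unfolding pb extend_formula[OF xc] by simp
  qed
qed

lemma global_form_extend: "global_form A 1 (extend_by_zero c a)"
  unfolding global_form_def using smooth_on_extend extend_one extend_compatible by blast

text \<open>The transition map from a chart to itself is the identity, and so is its Jacobian.\<close>

lemma extend_self: "y \<in> chart_image c \<Longrightarrow> extend_by_zero c a c y = a y"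
proof -
  assume y: "y \<in> chart_image c"
  then have yc: "y \<in> overlap c c" by (simp add: overlap_def chart_image_def)
  have id: "transition c c z = z" if "z \<in> chart_image c" for z
    using that c by (auto simp: chart_image_def transition_apply)
  have "jacobian (transition c c) y g f = of_bool (g = f)" for g f
  proof -
    have "jacobian (transition c c) y g f = wirtinger f covec_coords y $ g"
      unfolding jacobian_covec_coords
      by (subst wirtinger_cong_open[OF complex_chartD(2)[OF chart[OF c]] y, of _ covec_coords]) (auto simp: id)
    also have "\<dots> = of_bool (g = f)"
      unfolding wirtinger_has_derivative[OF bounded_linear_imp_has_derivative[OF bounded_linear_covec_coords]]
      by (cases f; cases g) (auto simp: covec_coords_def axis_nth_if)
    finally show ?thesis .
  qed
  then have "(\<Sum>g. a y $ {g} * jacobian (transition c c) y g f) = a y $ {f}" for f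
    by (simp add: of_bool_def if_distrib[of "\<lambda>x. _ * x"] cong: if_cong)
  then have "extend_by_zero c a c y = (\<Sum>f. a y $ {f} *s covector f)"
    unfolding extend_formula[OF yc] id[OF y] by simp
  also have "\<dots> = a y"
  proof (rule vec_eq_iff[THEN iffD2], rule allI)
    fix J
    show "(\<Sum>f. a y $ {f} *s covector f) $ J = a y $ J"
    proof (cases "card J = 1")
      case True
      then obtain f0 where J: "J = {f0}" by (auto simp: card_1_singleton_iff)
      have "(\<Sum>f. a y $ {f} * covector f $ J) = (\<Sum>f. if f = f0 then a y $ {f} else 0)"
        by (intro sum.cong) (auto simp: J covector_def axis_nth_if)
      then show ?thesis by (simp add: J)
    next
      case False
      then have "covector f $ J = 0" for f :: "'n covec" by (auto simp: covector_def axis_nth_if)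
      then show ?thesis using False a_one by simp
    qed
  qed
  finally show ?thesis .
qed

end
end

section \<open>The weak balanced condition in one chart\<close>

fun disjoint_pieces :: "'a set \<Rightarrow> ('a, 'n) chart list \<Rightarrow> (('a, 'n) chart \<times> 'a set) list" where
  "disjoint_pieces V [] = []"
| "disjoint_pieces V (d # ds) = (d, fst d - V) # disjoint_pieces (V \<union> fst d) ds"

lemma disjoint_pieces_mem:
  "(d, B) \<in> set (disjoint_pieces V ds) \<Longrightarrow> d \<in> set ds \<and> B \<subseteq> fst d \<and> B \<inter> V = {}"
  by (induction ds arbitrary: V) force+

lemma disjoint_pieces_sets:
  assumes "sigma_algebra \<Omega> M"
  shows "V \<in> M \<Longrightarrow> (\<And>d. d \<in> set ds \<Longrightarrow> fst d \<in> M) \<Longrightarrow> (d, B) \<in> set (disjoint_pieces V ds) \<Longrightarrow> B \<in> M"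
proof (induction ds arbitrary: V)
  case (Cons e ds)
  interpret sigma_algebra \<Omega> M by fact
  from Cons.prems(3) consider "B = fst e - V" | "(d, B) \<in> set (disjoint_pieces (V \<union> fst e) ds)" by auto
  then show ?case
  proof cases
    case 1
    have "fst e \<in> M" by (rule Cons.prems(2)) simp
    then show ?thesis unfolding 1 using Cons.prems(1) by (rule Diff)
  next
    case 2
    show ?thesis
    proof (rule Cons.IH[OF _ _ 2])
      have "fst e \<in> M" by (rule Cons.prems(2)) simp
      then show "V \<union> fst e \<in> M" using Cons.prems(1) by (simp add: Un)
    qed (rule Cons.prems(2), simp)
  qed
qed simp

lemma disjoint_pieces_cover:
  "p \<in> (\<Union>d\<in>set ds. fst d) - V \<Longrightarrow> \<exists>!cB. cB \<in> set (disjoint_pieces V ds) \<and> p \<in> snd cB"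
proof (induction ds arbitrary: V)
  case (Cons e ds)
  show ?case
  proof (cases "p \<in> fst e")
    case True
    have "p \<notin> B" if "(d, B) \<in> set (disjoint_pieces (V \<union> fst e) ds)" for d B
      using disjoint_pieces_mem[OF that] True by blast
    then show ?thesis using True Cons.prems
      by (intro ex1I[of _ "(e, fst e - V)"]) auto
  next
    case False
    then have "\<exists>!cB. cB \<in> set (disjoint_pieces (V \<union> fst e) ds) \<and> p \<in> snd cB"
      using Cons.prems by (intro Cons.IH) auto
    then show ?thesis using False by auto
  qed
qed simp

context complex_manifold
begin

lemma chart_partition_exists:
  assumes c: "c \<in> A"
  obtains P where "chart_partition X A P" "(c, fst c) \<in> P"
    "\<And>d B. (d, B) \<in> P \<Longrightarrow> (d, B) \<noteq> (c, fst c) \<Longrightarrow> B \<inter> fst c = {}"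
proof -
  have "compact_space X" and cover: "(\<Union>c\<in>A. fst c) = topspace X"
    using manifold by (auto simp: compact_complex_manifold_def complex_atlas_def)
  have "\<forall>U\<in>fst ` A. openin X U" using complex_chartD(1)[OF chart] by blast
  then obtain \<F> where F: "finite \<F>" "\<F> \<subseteq> fst ` A" "\<Union>\<F> = topspace X"
    using \<open>compact_space X\<close> cover unfolding compact_space by (metis (no_types))
  then obtain C where C: "C \<subseteq> A" "finite C" "\<F> = fst ` C" using finite_subset_image[OF F(1,2)] by blast
  obtain ds where ds: "set ds = C" using finite_list[OF C(2)] by blast
  (* Putting c first makes its whole domain the first piece. *)
  define P where "P = set (disjoint_pieces {} (c # ds))"
  let ?M = "sigma_sets (topspace X) {U. openin X U}"
  have M: "sigma_algebra (topspace X) ?M"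
    by (rule sigma_algebra_sigma_sets) (auto dest: openin_subset)
  show ?thesis
  proof (rule that)
    show "(c, fst c) \<in> P" by (simp add: P_def)
    show "B \<inter> fst c = {}" if "(d, B) \<in> P" "(d, B) \<noteq> (c, fst c)" for d B
      using that disjoint_pieces_mem[of d B "fst c" ds] by (auto simp: P_def)
    show "chart_partition X A P"
      unfolding chart_partition_def
    proof (intro conjI ballI)
      show "finite P" by (simp add: P_def)
      show "\<exists>!cB. cB \<in> P \<and> p \<in> snd cB" if "p \<in> topspace X" for p
        unfolding P_def by (rule disjoint_pieces_cover) (use that F C ds in auto)
      fix x assume "x \<in> P"
      then obtain d B where x: "x = (d, B)" "(d, B) \<in> set (disjoint_pieces {} (c # ds))"
        by (cases x) (auto simp: P_def)
      have "d \<in> A" "B \<subseteq> fst d" using disjoint_pieces_mem[OF x(2)] ds C(1) c by auto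
      moreover have "B \<in> ?M"
      proof (rule disjoint_pieces_sets[OF M _ _ x(2)])
        show "fst e \<in> ?M" if "e \<in> set (c # ds)" for e
          using that ds C(1) c complex_chartD(1)[OF chart, of e] by (intro sigma_sets.Basic) auto
      qed (rule sigma_sets.Empty)
      ultimately show "case x of (c, B) \<Rightarrow> c \<in> A \<and> B \<subseteq> fst c \<and> B \<in> ?M" by (simp add: x(1))
    qed
  qed
qed

lemma ext_d_cong_open:
  "open S \<Longrightarrow> x \<in> S \<Longrightarrow> (\<And>y. y \<in> S \<Longrightarrow> f y = g y) \<Longrightarrow> ext_d f x = ext_d g x"
  unfolding ext_d_def del_eq_dolbeault delbar_eq_dolbeault
  using dolbeault_cong_open[of S x f g] by simp

lemma ext_d_zero: "ext_d (\<lambda>y. 0) x = 0"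
  by (simp add: ext_d_def del_eq_dolbeault delbar_eq_dolbeault dolbeault_const)

text \<open>Tested against the extension of \<open>a\<close> by zero, the integral over the manifold is the
  integral over the chart \<open>c\<close>: the partition can be chosen to contain the whole domain
  of \<open>c\<close> as one piece, and the form vanishes near the points of all others.\<close>

lemma codifferential_zero_local:
  assumes codiff: "is_codifferential X A h 1 \<beta> (\<lambda>_ _. 0)"
    and c: "c \<in> A" and K: "compact K" "K \<subseteq> chart_image c"
    and a: "smooth_on UNIV a" "\<And>y I. card I \<noteq> 1 \<Longrightarrow> a y $ I = 0" "\<And>y. y \<notin> K \<Longrightarrow> a y = 0"
  shows "(LINT x:chart_image c|lborel.
      volume_density (h c x) *\<^sub>R form_inner (h c x) (ext_d a x) (\<beta> c x)) = 0"
proof -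
  let ?\<alpha> = "extend_by_zero c a"
  note ctx = c K a
  obtain P where P: "chart_partition X A P" "(c, fst c) \<in> P"
    and disj: "\<And>d B. (d, B) \<in> P \<Longrightarrow> (d, B) \<noteq> (c, fst c) \<Longrightarrow> B \<inter> fst c = {}"
    using chart_partition_exists[OF c] by blast
  have finP: "finite P" and PA: "\<And>d B. (d, B) \<in> P \<Longrightarrow> d \<in> A \<and> B \<subseteq> fst d"
    using P(1) unfolding chart_partition_def by auto
  have "global_form A 1 ?\<alpha>" by (rule global_form_extend[OF ctx])
  then obtain s where s: "has_L2_inner X A h (\<lambda>c. ext_d (?\<alpha> c)) \<beta> s" "has_L2_inner X A h ?\<alpha> (\<lambda>_ _. 0) s"
    using codiff unfolding is_codifferential_def by blast
  let ?I = "\<lambda>d B. LINT x:snd d ` B|lborel. volume_density (h d x) *\<^sub>R form_inner (h d x) (ext_d (?\<alpha> d) x) (\<beta> d x)"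
  have "(\<Sum>(d, B)\<in>P. LINT x:snd d ` B|lborel. volume_density (h d x) *\<^sub>R form_inner (h d x) (?\<alpha> d x) 0) = s"
    using s(2) P(1) unfolding has_L2_inner_def by blast
  then have "s = 0" by (simp add: form_inner_def set_lebesgue_integral_def)
  moreover have "(\<Sum>(d, B)\<in>P. ?I d B) = s"
    using s(1) P(1) unfolding has_L2_inner_def by blast
  ultimately have sum0: "(\<Sum>x\<in>P. case x of (d, B) \<Rightarrow> ?I d B) = 0" by simp
  have other: "?I d B = 0" if dB: "(d, B) \<in> P" "(d, B) \<noteq> (c, fst c)" for d B
  proof -
    have "ext_d (?\<alpha> d) x = 0" if "x \<in> snd d ` B" for x
    proof -
      from that obtain p where p: "p \<in> B" "x = snd d p" by auto
      then have "p \<in> fst d" "p \<notin> fst c" using PA[OF dB(1)] disj[OF dB] by auto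
      then obtain W where W: "open W" "x \<in> W" "\<And>y. y \<in> W \<Longrightarrow> ?\<alpha> d y = 0"
        using extend_vanishes_near[OF ctx] PA[OF dB(1)] p(2) by metis
      then have "ext_d (?\<alpha> d) x = ext_d (\<lambda>y. 0) x" by (intro ext_d_cong_open) auto
      then show ?thesis by (simp add: ext_d_zero)
    qed
    then have "indicator (snd d ` B) x *\<^sub>R (volume_density (h d x) *\<^sub>R form_inner (h d x) (ext_d (?\<alpha> d) x) (\<beta> d x)) = 0" for x
      by (cases "x \<in> snd d ` B") (simp_all add: form_inner_def)
    then show ?thesis unfolding set_lebesgue_integral_def by (simp only: integral_zero)
  qed
  have "(\<Sum>x\<in>P. case x of (d, B) \<Rightarrow> ?I d B) = (\<Sum>x\<in>{(c, fst c)}. case x of (d, B) \<Rightarrow> ?I d B)"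
    by (rule sum.mono_neutral_right) (use finP P(2) other in auto)
  then have "?I c (fst c) = 0" using sum0 by simp
  moreover have "ext_d (?\<alpha> c) x = ext_d a x" if "x \<in> chart_image c" for x
    by (rule ext_d_cong_open[OF complex_chartD(2)[OF chart[OF c]] that extend_self[OF ctx]])
  then have eqf: "indicator (chart_image c) x *\<^sub>R (volume_density (h c x) *\<^sub>R form_inner (h c x) (ext_d (?\<alpha> c) x) (\<beta> c x))
      = indicator (chart_image c) x *\<^sub>R (volume_density (h c x) *\<^sub>R form_inner (h c x) (ext_d a x) (\<beta> c x))" for x
    by (cases "x \<in> chart_image c") auto
  ultimately show ?thesis
    unfolding set_lebesgue_integral_def chart_image_def[symmetric] by (simp only: eqf)
qed

end

lemma minor_pair:
  assumes "e < f" "g < (h::'b::linorder)"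
  shows "minor m {e, f} {g, h} = m e g * m f h - m e h * m f g"
proof -
  have l: "sorted_list_of_set {e, f} = [e, f]" "sorted_list_of_set {g, h} = [g, h]"
    using assms by (auto simp: sorted_list_of_set_insert_remove)
  have c: "card {e, f} = 2" "card {g, h} = 2" using assms by auto
  have "{..<2::nat} = {0, 1}" by auto
  then have p: "{\<pi>. \<pi> permutes {..<2::nat}} = {id, Transposition.transpose 0 1}"
    by (auto simp: permutes_doubleton_iff)
  have ne: "id \<noteq> Transposition.transpose 0 (1::nat)"
    by (metis id_apply transpose_apply_first zero_neq_one)
  have "minor m {e, f} {g, h} = (\<Sum>\<pi>\<in>{id, Transposition.transpose 0 1}. of_int (sign \<pi>) *
            (\<Prod>i<2. m ([e, f] ! i) ([g, h] ! \<pi> i)))"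
    unfolding minor_def l c p by simp
  also have "\<dots> = m e g * m f h - m e h * m f g"
    using ne by (simp add: sign_id sign_swap_id numeral_2_eq_2 lessThan_Suc mult.commute)
  finally show ?thesis .
qed

lemma form_inner_add: "form_inner H (a + b) u = form_inner H a u + form_inner H b u"
  by (simp add: form_inner_def algebra_simps sum.distrib)
lemma form_inner_scale: "form_inner H (r *s a) u = r * form_inner H a u"
  by (simp add: form_inner_def sum_distrib_left mult.assoc)
lemma form_inner_add_right: "form_inner H u (a + b) = form_inner H u a + form_inner H u b"
  by (simp add: form_inner_def algebra_simps sum.distrib)
lemma form_inner_scale_right: "form_inner H u (r *s a) = cnj r * form_inner H u a"
  by (simp add: form_inner_def sum_distrib_left mult_ac)
lemma form_inner_0: "form_inner H 0 u = 0" "form_inner H u 0 = 0"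
  by (simp_all add: form_inner_def)
lemma form_inner_sum: "form_inner H (\<Sum>i\<in>S. f i) u = (\<Sum>i\<in>S. form_inner H (f i) u)"
  by (induction S rule: infinite_finite_induct) (simp_all add: form_inner_add form_inner_0)
lemma form_inner_sum_right: "form_inner H u (\<Sum>i\<in>S. f i) = (\<Sum>i\<in>S. form_inner H u (f i))"
  by (induction S rule: infinite_finite_induct) (simp_all add: form_inner_add_right form_inner_0)

lemma form_inner_axis:
  fixes H :: "'a::{finite,linorder} cmat"
  shows "form_inner H (axis I 1) (axis J 1) = minor (covec_inner H) I J"
proof -
  have inner: "(\<Sum>J'\<in>UNIV. 1 * cnj (axis J 1 $ J') * minor m I J') = minor m I J" for m :: "'a covec \<Rightarrow> 'a covec \<Rightarrow> complex"
  proof -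
    have "(\<Sum>J'\<in>UNIV. 1 * cnj (axis J 1 $ J') * minor m I J') = (\<Sum>J'\<in>UNIV. if J' = J then minor m I J else 0)"
      by (intro sum.cong refl) (auto simp: axis_nth_if)
    then show ?thesis by simp
  qed
  have "form_inner H (axis I 1) (axis J 1) =
      (\<Sum>I'\<in>UNIV. if I' = I then \<Sum>J'\<in>UNIV. 1 * cnj (axis J 1 $ J') * minor (covec_inner H) I J' else 0)"
    unfolding form_inner_def by (intro sum.cong refl) (simp add: axis_nth_if[of I])
  then show ?thesis by (simp only: inner) simp
qed

lemma covector_wedge: "e < f \<Longrightarrow> covector e \<^bold>\<and> covector f = axis {e, f} 1"
proof -
  assume "e < f"
  then have "{(i, j). i \<in> {e} \<and> j \<in> {f} \<and> j < i} = {}" by auto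
  then have "shuffle_sign {e} {f} = 1" by (simp only: shuffle_sign_def card.empty power_0)
  then show ?thesis using \<open>e < f\<close>
    by (simp add: covector_def axis_wedge_axis insert_commute)
qed

lemma less_covec_simps [simp]: "Dz i < Dzbar j" "Dz i < Dz j \<longleftrightarrow> i < j" "Dzbar i < Dzbar j \<longleftrightarrow> i < j"
  for i j :: "'n::linorder"
  by (auto simp: less_covec_def)

lemma form_inner_mixed:
  "form_inner H (covector (Dz l) \<^bold>\<and> covector (Dzbar b)) (covector (Dz j) \<^bold>\<and> covector (Dzbar k)) =
    matrix_inv H $ j $ l * matrix_inv H $ b $ k"
  by (simp add: covector_wedge form_inner_axis minor_pair)

text \<open>Every mixed entry of the covector inner product vanishes, and each term of the minor contains one.\<close>

lemma form_inner_antiholomorphic: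
  "form_inner H (covector (Dzbar l) \<^bold>\<and> covector (Dzbar b)) (covector (Dz j) \<^bold>\<and> covector (Dzbar k)) = 0"
proof -
  consider "l = b" | "l < b" | "b < l" by force
  then show ?thesis
  proof cases
    case 1
    then show ?thesis by (simp add: covector_def axis_wedge_axis form_inner_0)
  next
    case 2
    then show ?thesis by (simp add: covector_wedge form_inner_axis minor_pair)
  next
    case 3
    have "to_ext (covector (Dzbar l) \<^bold>\<and> covector (Dzbar b)) = to_ext ((-1) *s (covector (Dzbar b) \<^bold>\<and> covector (Dzbar l)))"
      using cv_anticommute[of "Dzbar l" "Dzbar b"] by (simp add: to_ext_simps to_ext_covector sc_simps)
    then have "covector (Dzbar l) \<^bold>\<and> covector (Dzbar b) = (-1) *s (covector (Dzbar b) \<^bold>\<and> covector (Dzbar l))"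
      by (simp only: to_ext_inject)
    then show ?thesis using 3
      by (simp only: form_inner_scale) (simp add: covector_wedge form_inner_axis minor_pair)
  qed
qed

text \<open>A vector in the kernel of \<open>H\<close> has zero length.\<close>

lemma hermitian_pos_matrix_inv:
  fixes H :: "'n::{finite,linorder} cmat"
  assumes "hermitian_pos H" shows "H ** matrix_inv H = mat 1" "matrix_inv H ** H = mat 1"
proof -
  have "H *v x = 0 \<Longrightarrow> x = 0" for x
  proof (rule ccontr)
    assume x: "H *v x = 0" "x \<noteq> 0"
    (* The second argument of the form enters conjugated, so conjugating x produces the vector H *v x. *)
    define y :: "'n cvec" where "y = (\<chi> i. cnj (x $ i))"
    have "(\<Sum>j k. H $ j $ k * y $ j * cnj (y $ k)) = (\<Sum>j. y $ j * (H *v x) $ j)"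
      unfolding matrix_vector_mult_def vec_lambda_beta sum_distrib_left
      by (intro sum.cong refl) (simp add: y_def mult_ac)
    also have "\<dots> = 0" by (simp add: x(1))
    finally have "Re (\<Sum>j k. H $ j $ k * y $ j * cnj (y $ k)) = 0" by simp
    moreover have "y \<noteq> 0" using x(2) by (auto simp: y_def vec_eq_iff)
    then have "0 < Re (\<Sum>j k. H $ j $ k * y $ j * cnj (y $ k))"
      using assms unfolding hermitian_pos_def by blast
    ultimately show False by linarith
  qed
  then have "invertible H" using matrix_left_invertible_ker invertible_left_inverse by blast
  then show "H ** matrix_inv H = mat 1" "matrix_inv H ** H = mat 1"
    using someI_ex[OF \<open>invertible H\<close>[unfolded invertible_def]] by (simp_all add: matrix_inv_def)
qed

text \<open>Only the \<open>(1,1)\<close>-part of \<open>d(\<phi> d\<zeta>\<^sub>b)\<close> is seen by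
  \<open>\<omega>\<close>, and pairing with \<open>\<omega>\<close> contracts it with the inverse
  metric.\<close>

lemma form_inner_ext_d_test:
  fixes \<phi> :: "'n::{finite,linorder} cvec \<Rightarrow> real"
  assumes H: "hermitian_pos H" and \<phi>: "\<phi> differentiable (at x)"
  shows "form_inner H (ext_d (\<lambda>y. of_real (\<phi> y) *s covector (Dzbar b)) x) (omega H) =
    - \<i> * (\<Sum>l. (1/2) * (of_real (frechet_derivative \<phi> (at x) (axis l 1))
       - \<i> * of_real (frechet_derivative \<phi> (at x) (axis l \<i>))) * matrix_inv H $ b $ l)"
proof -
  let ?w = "\<lambda>e. (1/2) * (of_real (frechet_derivative \<phi> (at x) (axis (covec_index e) 1))
       + covec_unit e * of_real (frechet_derivative \<phi> (at x) (axis (covec_index e) \<i>)))"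
  have bl: "bounded_linear (\<lambda>r. of_real r *s (covector (Dzbar b) :: 'n cform))"
    by (subst linear_conv_bounded_linear[symmetric])
      (auto intro!: linearI simp: vec_eq_iff algebra_simps scaleR_conv_of_real[where 'a = complex])
  have "(\<phi> has_derivative frechet_derivative \<phi> (at x)) (at x)"
    using \<phi> by (simp add: frechet_derivative_works)
  note d = bounded_linear.has_derivative[OF bl this]
  have w: "wirtinger e (\<lambda>y. of_real (\<phi> y) *s covector (Dzbar b)) x = ?w e *s covector (Dzbar b)" for e
    unfolding wirtinger_has_derivative[OF d] by (simp add: vec_eq_iff algebra_simps)
  let ?G = "matrix_inv H"
  have mixed: "form_inner H (covector (Dz l) \<^bold>\<and> covector (Dzbar b)) (omega H) = - \<i> * ?G $ b $ l" for l
  proof -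
    have "form_inner H (covector (Dz l) \<^bold>\<and> covector (Dzbar b)) (omega H) =
        (\<Sum>j k. cnj (\<i> * H $ j $ k) * (?G $ j $ l * ?G $ b $ k))"
      by (simp only: omega_def form_inner_sum_right form_inner_scale_right form_inner_mixed)
    also have "\<dots> = (\<Sum>j k. - \<i> * (?G $ b $ k * (H $ k $ j * ?G $ j $ l)))"
    proof (intro sum.cong refl)
      fix j k
      have "cnj (H $ j $ k) = H $ k $ j" using H unfolding hermitian_pos_def by metis
      then show "cnj (\<i> * H $ j $ k) * (?G $ j $ l * ?G $ b $ k) = - \<i> * (?G $ b $ k * (H $ k $ j * ?G $ j $ l))"
        by simp
    qed
    also have "\<dots> = - \<i> * (\<Sum>k. ?G $ b $ k * (H ** ?G) $ k $ l)"
      unfolding sum_distrib_left matrix_matrix_mult_def vec_lambda_beta by (rule sum.swap)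
    also have "\<dots> = - \<i> * ?G $ b $ l"
      by (simp add: hermitian_pos_matrix_inv[OF H] mat_def if_distrib[of "\<lambda>x. _ * x"] cong: if_cong)
    finally show ?thesis .
  qed
  have anti: "form_inner H (covector (Dzbar l) \<^bold>\<and> covector (Dzbar b)) (omega H) = 0" for l
    by (simp add: omega_def form_inner_sum_right form_inner_scale_right form_inner_antiholomorphic)
  show ?thesis
    unfolding ext_d_def del_def delbar_def w wedge_scale_right form_inner_add form_inner_sum form_inner_scale mixed anti
    by (simp add: sum_distrib_left mult_ac)
qed

section \<open>Integration by parts and the fundamental lemma\<close>

lemma integrable_continuous_compact_support:
  fixes f :: "'a::euclidean_space \<Rightarrow> 'b::{banach, second_countable_topology}"
  assumes "continuous_on UNIV f" "compact K" "\<And>x. x \<notin> K \<Longrightarrow> f x = 0"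
  shows "integrable lborel f"
proof -
  have "integrable lborel (\<lambda>x. indicator K x *\<^sub>R f x)"
    using borel_integrable_compact[OF assms(2) continuous_on_subset[OF assms(1)]] by simp
  moreover have "(\<lambda>x. indicator K x *\<^sub>R f x) = f"
    using assms(3) by (auto simp: fun_eq_iff indicator_def)
  ultimately show ?thesis by simp
qed

lemma lborel_integral_translate:
  fixes f :: "'a::euclidean_space \<Rightarrow> 'b::{banach, second_countable_topology}"
  assumes "continuous_on UNIV f"
  shows "(\<integral>x. f (c + x) \<partial>lborel) = (\<integral>x. f x \<partial>lborel)"
proof -
  have m: "f \<in> borel_measurable borel" using assms by (rule borel_measurable_continuous_onI)
  have "(\<integral>x. f x \<partial>lborel) = (\<integral>x. f x \<partial>distr lborel borel ((+) c))"
    by (simp add: lborel_distr_plus)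
  also have "\<dots> = (\<integral>x. f (c + x) \<partial>lborel)"
    by (rule integral_distr) (use m in auto)
  finally show ?thesis by simp
qed

text \<open>By translation invariance all difference quotients of \<open>u\<close> in direction
  \<open>v\<close> have integral zero. They converge to the derivative and are dominated by a
  constant on a ball.\<close>

lemma integral_directional_derivative_zero:
  fixes u :: "'a::euclidean_space \<Rightarrow> complex"
  assumes u: "\<And>x. (u has_derivative u' x) (at x)" and cont: "continuous_on UNIV (\<lambda>x. u' x v)"
    and K: "compact K" "\<And>x. x \<notin> K \<Longrightarrow> u x = 0" "\<And>x. x \<notin> K \<Longrightarrow> u' x v = 0"
  shows "(\<integral>x. u' x v \<partial>lborel) = 0"
proof -
  have ucont: "continuous_on UNIV u"
    using u has_derivative_continuous by (blast intro: continuous_at_imp_continuous_on)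
  obtain M where M: "\<And>x. norm (u' x v) \<le> M"
  proof -
    have "bounded ((\<lambda>x. u' x v) ` K)"
      by (intro compact_imp_bounded compact_continuous_image K continuous_on_subset[OF cont]) auto
    then obtain M where "\<forall>y\<in>(\<lambda>x. u' x v) ` K. norm y \<le> M" by (auto simp: bounded_iff)
    then have "norm (u' x v) \<le> max M 0" for x using K(3)[of x] by (cases "x \<in> K") force+
    then show ?thesis by (rule that)
  qed
  obtain R where R: "\<And>x. x \<in> K \<Longrightarrow> norm x \<le> R"
    using compact_imp_bounded[OF K(1)] by (auto simp: bounded_iff)
  let ?B = "cball (0::'a) (R + norm v)"
  have deriv: "((\<lambda>t. u (t *\<^sub>R v + x)) has_derivative (\<lambda>s. s *\<^sub>R u' (t *\<^sub>R v + x) v)) (at t within S)" for t x S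
  proof -
    have "((\<lambda>t. t *\<^sub>R v + x) has_derivative (\<lambda>s. s *\<^sub>R v)) (at t within S)"
      by (auto intro!: derivative_eq_intros)
    from has_derivative_compose[OF this u]
    have "((\<lambda>t. u (t *\<^sub>R v + x)) has_derivative (\<lambda>s. u' (t *\<^sub>R v + x) (s *\<^sub>R v))) (at t within S)" .
    moreover have "u' (t *\<^sub>R v + x) (s *\<^sub>R v) = s *\<^sub>R u' (t *\<^sub>R v + x) v" for s
      using has_derivative_linear[OF u[of "t *\<^sub>R v + x"]] by (rule linear_scale)
    ultimately show ?thesis by simp
  qed
  define f where "f k x = real (Suc k) *\<^sub>R (u ((1 / real (Suc k)) *\<^sub>R v + x) - u x)" for k x
  have "(\<lambda>k. \<integral>x. f k x \<partial>lborel) \<longlonglongrightarrow> (\<integral>x. u' x v \<partial>lborel)"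
  proof (rule integral_dominated_convergence[where w = "\<lambda>x. indicator ?B x *\<^sub>R M"])
    show "(\<lambda>x. u' x v) \<in> borel_measurable lborel"
      using borel_measurable_continuous_onI[OF cont] by simp
    have "continuous_on UNIV (\<lambda>x. u ((1 / real (Suc k)) *\<^sub>R v + x))" for k
      by (rule continuous_on_compose2[OF ucont]) (auto intro!: continuous_intros)
    then have "continuous_on UNIV (f k)" for k
      unfolding f_def by (intro continuous_intros ucont)
    then show "f k \<in> borel_measurable lborel" for k
      using borel_measurable_continuous_onI[of "f k"] by simp
    show "integrable lborel (\<lambda>x. indicator ?B x *\<^sub>R M)"
      by (intro borel_integrable_compact) auto
    show "AE x in lborel. (\<lambda>k. f k x) \<longlonglongrightarrow> u' x v"
    proof (rule AE_I2)
      fix x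
      have "((\<lambda>t. norm (u (t *\<^sub>R v + x) - u x - t *\<^sub>R u' x v) / norm t) \<longlongrightarrow> 0) (at 0)"
        using deriv[of x 0 UNIV] by (simp add: has_derivative_iff_norm)
      moreover have "norm (u (t *\<^sub>R v + x) - u x - t *\<^sub>R u' x v) / norm t =
          dist ((1 / t) *\<^sub>R (u (t *\<^sub>R v + x) - u x)) (u' x v)" if "t \<noteq> 0" for t
      proof -
        have "u (t *\<^sub>R v + x) - u x - t *\<^sub>R u' x v = t *\<^sub>R ((1 / t) *\<^sub>R (u (t *\<^sub>R v + x) - u x) - u' x v)"
          using that by (simp add: scaleR_right_diff_distrib)
        then have "norm (u (t *\<^sub>R v + x) - u x - t *\<^sub>R u' x v) =
            \<bar>t\<bar> * norm ((1 / t) *\<^sub>R (u (t *\<^sub>R v + x) - u x) - u' x v)"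
          by (simp only: norm_scaleR)
        then show ?thesis using that by (simp add: dist_norm)
      qed
      ultimately have "((\<lambda>t. dist ((1 / t) *\<^sub>R (u (t *\<^sub>R v + x) - u x)) (u' x v)) \<longlongrightarrow> 0) (at 0)"
        by (elim Lim_transform_eventually) (simp add: eventually_at_filter)
      then have "((\<lambda>t. (1 / t) *\<^sub>R (u (t *\<^sub>R v + x) - u x)) \<longlongrightarrow> u' x v) (at 0)"
        by (subst tendsto_dist_iff)
      then have "(\<lambda>k. (1 / (1 / real (Suc k))) *\<^sub>R (u ((1 / real (Suc k)) *\<^sub>R v + x) - u x)) \<longlonglongrightarrow> u' x v"
      proof (rule filterlim_compose)
        have "(\<lambda>k. 1 / real (Suc k)) \<longlonglongrightarrow> 0"
          using LIMSEQ_inverse_real_of_nat by (simp only: inverse_eq_divide)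
        then show "filterlim (\<lambda>k. 1 / real (Suc k)) (at 0) sequentially"
          by (simp add: filterlim_at del: of_nat_Suc)
      qed
      then show "(\<lambda>k. f k x) \<longlonglongrightarrow> u' x v" by (simp add: f_def)
    qed
    show "AE x in lborel. norm (f k x) \<le> indicator ?B x *\<^sub>R M" for k
    proof (rule AE_I2)
      fix x
      let ?t = "1 / real (Suc k)"
      show "norm (f k x) \<le> indicator ?B x *\<^sub>R M"
      proof (cases "x \<in> ?B")
        case True
        have "norm (u (?t *\<^sub>R v + x) - u (0 *\<^sub>R v + x)) \<le> M * norm (?t - 0)"
        proof (rule differentiable_bound[where S = UNIV and f = "\<lambda>t. u (t *\<^sub>R v + x)"])
          show "((\<lambda>t. u (t *\<^sub>R v + x)) has_derivative (\<lambda>s. s *\<^sub>R u' (t *\<^sub>R v + x) v)) (at t within UNIV)" for t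
            by (rule deriv)
          show "onorm (\<lambda>s. s *\<^sub>R u' (t *\<^sub>R v + x) v) \<le> M" for t
          proof (rule onorm_le)
            fix s :: real
            have "\<bar>s\<bar> * norm (u' (t *\<^sub>R v + x) v) \<le> \<bar>s\<bar> * M" by (intro mult_left_mono M) auto
            then show "norm (s *\<^sub>R u' (t *\<^sub>R v + x) v) \<le> M * norm s" by (simp add: mult.commute)
          qed
        qed auto
        then have "real (Suc k) * norm (u (?t *\<^sub>R v + x) - u x) \<le> real (Suc k) * (M * ?t)"
          by (intro mult_left_mono) auto
        moreover have "norm (f k x) = real (Suc k) * norm (u (?t *\<^sub>R v + x) - u x)"
          by (simp only: f_def norm_scaleR abs_of_nat)
        moreover have "real (Suc k) * (M * ?t) = M" by simp
        ultimately show ?thesis using True by (simp only: indicator_simps scaleR_one)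
      next
        case False
        then have big: "norm x > R + norm v" by (simp add: dist_norm)
        have "norm (?t *\<^sub>R v) = ?t * norm v" by simp
        also have "\<dots> \<le> 1 * norm v" by (rule mult_right_mono) auto
        finally have "norm (?t *\<^sub>R v) \<le> norm v" by simp
        moreover have "norm x \<le> norm (?t *\<^sub>R v + x) + norm (?t *\<^sub>R v)"
          using norm_triangle_ineq4[of "?t *\<^sub>R v + x" "?t *\<^sub>R v"] by simp
        ultimately have "norm (?t *\<^sub>R v + x) > R" using big by linarith
        then have "?t *\<^sub>R v + x \<notin> K" using R by force
        moreover have "x \<notin> K" using R[of x] big norm_ge_zero[of v] by linarith
        ultimately show ?thesis using False by (simp add: f_def K(2))
      qed
    qed
  qed
  moreover have "(\<integral>x. f k x \<partial>lborel) = 0" for k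
  proof -
    let ?c = "(1 / real (Suc k)) *\<^sub>R v"
    have i: "integrable lborel u" by (rule integrable_continuous_compact_support[OF ucont K(1,2)])
    have "continuous_on UNIV (\<lambda>x. u (?c + x))"
      by (rule continuous_on_compose2[OF ucont]) (auto intro!: continuous_intros)
    moreover have "compact ((+) (- ?c) ` K)" by (intro compact_translation K)
    moreover have "u (?c + x) = 0" if "x \<notin> (+) (- ?c) ` K" for x
    proof (rule K(2), rule notI)
      assume "?c + x \<in> K"
      then have "- ?c + (?c + x) \<in> (+) (- ?c) ` K" by blast
      then show False using that by simp
    qed
    ultimately have "integrable lborel (\<lambda>x. u (?c + x))"
      by (rule integrable_continuous_compact_support)
    then have "(\<integral>x. f k x \<partial>lborel) = real (Suc k) *\<^sub>R ((\<integral>x. u (?c + x) \<partial>lborel) - (\<integral>x. u x \<partial>lborel))"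
      unfolding f_def using i by simp
    then show ?thesis by (simp add: lborel_integral_translate[OF ucont])
  qed
  ultimately have "(\<lambda>k. 0) \<longlonglongrightarrow> (\<integral>x. u' x v \<partial>lborel)" by simp
  then show ?thesis using LIMSEQ_unique[OF _ tendsto_const] by metis
qed

text \<open>If \<open>F x0 \<noteq> 0\<close>, the real part of \<open>cnj (F x0) F\<close> is positive near
  \<open>x0\<close>, and so is its integral against a bump function supported there.\<close>

lemma continuous_bump_orthogonal_zero:
  fixes F :: "'a::euclidean_space \<Rightarrow> complex"
  assumes \<Omega>: "open \<Omega>" and F: "continuous_on \<Omega> F" and x0: "x0 \<in> \<Omega>"
    and orth: "\<And>r. 0 < r \<Longrightarrow> cball x0 r \<subseteq> \<Omega> \<Longrightarrow>
      (\<integral>x. indicator \<Omega> x *\<^sub>R (of_real (bump x0 r x) * F x) \<partial>lborel) = 0"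
  shows "F x0 = 0"
proof (rule ccontr)
  assume F0: "F x0 \<noteq> 0"
  (* G is positive near x0, which a complex-valued F cannot be. *)
  define G where "G x = Re (cnj (F x0) * F x)" for x
  have G0: "G x0 > 0"
    using F0 by (simp add: G_def sum_squares_gt_zero_iff complex_eq_iff)
  have Gc: "continuous_on \<Omega> G" unfolding G_def by (intro continuous_intros F)
  have "open {x \<in> \<Omega>. G x > 0}"
    using continuous_open_preimage[OF Gc \<Omega> open_greaterThan[of 0]] by (simp add: vimage_def Int_def)
  then obtain r where r: "r > 0" "cball x0 r \<subseteq> {x \<in> \<Omega>. G x > 0}"
    using G0 x0 by (metis (mono_tags, lifting) mem_Collect_eq open_contains_cball)
  let ?g = "\<lambda>x. indicator \<Omega> x *\<^sub>R (of_real (bump x0 r x) * F x)"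
  have bump_out: "bump x0 r x = 0" if "x \<notin> cball x0 r" for x
    using bump_nonzero_iff[OF r(1), of x0 x] that by auto
  have int: "integrable lborel ?g"
  proof -
    have "continuous_on (cball x0 r) (\<lambda>x. of_real (bump x0 r x) * F x)"
      using r by (intro continuous_intros continuous_on_subset[OF F]
          continuous_on_subset[OF smooth_on_imp_continuous_on[OF smooth_on_bump]]) auto
    then have "integrable lborel (\<lambda>x. indicator (cball x0 r) x *\<^sub>R (of_real (bump x0 r x) * F x))"
      by (intro borel_integrable_compact) auto
    moreover have "(\<lambda>x. indicator (cball x0 r) x *\<^sub>R (of_real (bump x0 r x) * F x)) = ?g"
      using bump_out r(2) by (auto simp: fun_eq_iff indicator_def)
    ultimately show ?thesis by simp
  qed
  have nonneg: "0 \<le> Re (cnj (F x0) * ?g x)" for x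
  proof (cases "x \<in> cball x0 r")
    case True
    then have "0 \<le> bump x0 r x * G x" using r(2) bump_nonneg[of x0 r x] by (intro mult_nonneg_nonneg) auto
    moreover have "Re (cnj (F x0) * ?g x) = bump x0 r x * G x"
      using True r(2) by (auto simp: G_def indicator_def algebra_simps)
    ultimately show ?thesis by simp
  qed (simp add: bump_out)
  have int': "integrable lborel (\<lambda>x. Re (cnj (F x0) * ?g x))"
    by (rule integrable_bounded_linear[OF bounded_linear_compose[OF bounded_linear_Re bounded_linear_mult_right] int])
  have "(\<integral>x. Re (cnj (F x0) * ?g x) \<partial>lborel) = Re (cnj (F x0) * (\<integral>x. ?g x \<partial>lborel))"
    by (rule integral_bounded_linear[OF bounded_linear_compose[OF bounded_linear_Re bounded_linear_mult_right] int])
  also have "\<dots> = 0"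
  proof -
    have "cball x0 r \<subseteq> \<Omega>" using r(2) by blast
    then show ?thesis by (simp only: orth[OF r(1)] mult_zero_right zero_complex.sel)
  qed
  finally have "AE x in lborel. Re (cnj (F x0) * ?g x) = 0"
    by (rule integral_nonneg_eq_0_iff_AE[OF int' AE_I2[OF nonneg], THEN iffD1])
  then have "AE x in lborel. x \<notin> ball x0 r"
  proof eventually_elim
    case (elim x)
    show "x \<notin> ball x0 r"
    proof
      assume x: "x \<in> ball x0 r"
      then have "x \<in> cball x0 r" by auto
      then have "Re (cnj (F x0) * ?g x) = bump x0 r x * G x" "G x > 0"
        using r(2) by (auto simp: G_def indicator_def algebra_simps)
      then show False using elim x bump_nonzero_iff[OF r(1), of x0 x] by auto
    qed
  qed
  then have "ball x0 r \<in> null_sets lborel" by (subst (asm) AE_iff_null_sets[symmetric]) auto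
  then have "negligible (ball x0 r)"
    by (auto simp: negligible_iff_null_sets intro: null_sets_completionI)
  then show False using r(1) by (simp add: negligible_iff_measure content_ball_pos)
qed

text \<open>The open sets \<open>\<Omega>\<close> and \<open>- K\<close> cover the space, and the function is
  continuous on both.\<close>

lemma continuous_on_extend_zero:
  fixes g :: "'a::t2_space \<Rightarrow> 'b::{topological_space, zero}"
  assumes "open \<Omega>" "compact K" "K \<subseteq> \<Omega>" "continuous_on \<Omega> g" "\<And>x. x \<in> \<Omega> \<Longrightarrow> x \<notin> K \<Longrightarrow> g x = 0"
  shows "continuous_on UNIV (\<lambda>x. if x \<in> \<Omega> then g x else 0)"
proof -
  let ?f = "\<lambda>x. if x \<in> \<Omega> then g x else 0"
  have "continuous_on \<Omega> ?f" by (rule continuous_on_eq[OF assms(4)]) simp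
  moreover have "continuous_on (- K) ?f" by (rule continuous_on_eq[OF continuous_on_const[of _ 0]]) (use assms in auto)
  ultimately have "continuous_on (\<Omega> \<union> - K) ?f"
    by (intro continuous_on_open_Un assms(1) open_Compl compact_imp_closed assms(2))
  moreover have "\<Omega> \<union> - K = UNIV" using assms(3) by auto
  ultimately show ?thesis by simp
qed

lemma frechet_derivative_zero_outside:
  assumes "compact K" "\<And>x. x \<notin> K \<Longrightarrow> \<phi> x = 0" "x \<notin> K"
  shows "frechet_derivative \<phi> (at x) v = (0::'b::real_normed_vector)"
proof -
  have "frechet_derivative \<phi> (at x) = frechet_derivative (\<lambda>x. 0) (at x)"
    by (rule frechet_derivative_cong_open[of "- K"]) (use assms in \<open>auto intro: compact_imp_closed\<close>)
  then show ?thesis by simp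
qed

text \<open>The product \<open>\<phi> N\<close>, extended by zero outside \<open>\<Omega>\<close>, is
  differentiable everywhere with compact support, so its directional derivative integrates to zero.\<close>

lemma integration_by_parts:
  fixes \<phi> :: "'a::euclidean_space \<Rightarrow> real" and N :: "'a \<Rightarrow> complex"
  assumes \<Omega>: "open \<Omega>" and N: "smooth_on \<Omega> N" and \<phi>: "smooth_on UNIV \<phi>"
    and K: "compact K" "K \<subseteq> \<Omega>" "\<And>x. x \<notin> K \<Longrightarrow> \<phi> x = 0"
  shows "integrable lborel (\<lambda>x. indicator \<Omega> x *\<^sub>R (of_real (\<phi> x) * frechet_derivative N (at x) v))"
    and "integrable lborel (\<lambda>x. indicator \<Omega> x *\<^sub>R (of_real (frechet_derivative \<phi> (at x) v) * N x))"
    and "(\<integral>x. indicator \<Omega> x *\<^sub>R (of_real (\<phi> x) * frechet_derivative N (at x) v) \<partial>lborel) =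
      - (\<integral>x. indicator \<Omega> x *\<^sub>R (of_real (frechet_derivative \<phi> (at x) v) * N x) \<partial>lborel)"
proof -
  have ind: "indicator \<Omega> x *\<^sub>R z = (if x \<in> \<Omega> then z else 0)" for x and z :: complex by simp
  have out: "frechet_derivative \<phi> (at x) v = 0" if "x \<notin> K" for x v
    by (rule frechet_derivative_zero_outside[OF K(1) K(3) that])
  have cont: "continuous_on \<Omega> N" "continuous_on \<Omega> (\<lambda>x. frechet_derivative N (at x) v)"
    "continuous_on \<Omega> \<phi>" "continuous_on \<Omega> (\<lambda>x. frechet_derivative \<phi> (at x) v)"
    using smooth_on_imp_continuous_on[OF N] smooth_on_imp_continuous_on[OF smooth_on_frechet[OF N]]
      smooth_on_imp_continuous_on[OF \<phi>] smooth_on_imp_continuous_on[OF smooth_on_frechet[OF \<phi>]]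
    by (auto intro: continuous_on_subset)
  let ?f1 = "\<lambda>x. if x \<in> \<Omega> then of_real (\<phi> x) * frechet_derivative N (at x) v else 0"
  let ?f2 = "\<lambda>x. if x \<in> \<Omega> then of_real (frechet_derivative \<phi> (at x) v) * N x else 0"
  have c1: "continuous_on UNIV ?f1"
    by (rule continuous_on_extend_zero[OF \<Omega> K(1,2)]) (auto intro!: continuous_intros cont simp: K(3))
  have c2: "continuous_on UNIV ?f2"
    by (rule continuous_on_extend_zero[OF \<Omega> K(1,2)]) (auto intro!: continuous_intros cont simp: out)
  have i1: "integrable lborel ?f1" and i2: "integrable lborel ?f2"
    by (rule integrable_continuous_compact_support[OF c1 K(1)], use K(3) in simp)
      (rule integrable_continuous_compact_support[OF c2 K(1)], use out in simp)
  show "integrable lborel (\<lambda>x. indicator \<Omega> x *\<^sub>R (of_real (\<phi> x) * frechet_derivative N (at x) v))"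
    unfolding ind by (rule i1)
  show "integrable lborel (\<lambda>x. indicator \<Omega> x *\<^sub>R (of_real (frechet_derivative \<phi> (at x) v) * N x))"
    unfolding ind by (rule i2)
  define u where "u x = (if x \<in> \<Omega> then of_real (\<phi> x) * N x else 0)" for x
  define u' where "u' x w = (if x \<in> \<Omega> then of_real (\<phi> x) * frechet_derivative N (at x) w
      + of_real (frechet_derivative \<phi> (at x) w) * N x else 0)" for x w
  have "(\<integral>x. u' x v \<partial>lborel) = 0"
  proof (rule integral_directional_derivative_zero)
    show "(u has_derivative u' x) (at x)" for x
    proof (cases "x \<in> \<Omega>")
      case True
      have "((\<lambda>x. of_real (\<phi> x) :: complex) has_derivative (\<lambda>w. of_real (frechet_derivative \<phi> (at x) w))) (at x)"
        by (rule bounded_linear.has_derivative[OF bounded_linear_of_real smooth_onD(1)[OF \<phi>]]) simp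
      from has_derivative_mult[OF this smooth_onD(1)[OF N True]]
      have "((\<lambda>x. of_real (\<phi> x) * N x) has_derivative u' x) (at x)"
        using True by (simp add: u'_def[abs_def])
      then show ?thesis
        by (rule has_derivative_transform_within_open[OF _ \<Omega> True]) (simp add: u_def)
    next
      case False
      then have "x \<in> - K" using K(2) by auto
      have "u' x = (\<lambda>w. 0)" using False by (simp add: u'_def[abs_def])
      moreover have "(u has_derivative (\<lambda>w. 0)) (at x)"
      proof (rule has_derivative_transform_within_open[OF has_derivative_const])
        show "open (- K)" using K(1) by (simp add: compact_imp_closed open_Compl)
        show "x \<in> - K" by fact
        show "0 = u y" if "y \<in> - K" for y using that K(3)[of y] by (simp add: u_def)
      qed
      ultimately show ?thesis by simp
    qed
    have "u' x v = ?f1 x + ?f2 x" for x by (simp add: u'_def)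
    then show "continuous_on UNIV (\<lambda>x. u' x v)"
      using continuous_on_add[OF c1 c2] by simp
    show "u x = 0" if "x \<notin> K" for x using K(3)[OF that] by (simp add: u_def)
    show "u' x v = 0" if "x \<notin> K" for x using K(3)[OF that] out[OF that] by (simp add: u'_def)
  qed (rule K(1))
  moreover have "u' x v = ?f1 x + ?f2 x" for x by (simp add: u'_def)
  ultimately have "(\<integral>x. ?f1 x + ?f2 x \<partial>lborel) = 0" by simp
  then have "(\<integral>x. ?f1 x \<partial>lborel) + (\<integral>x. ?f2 x \<partial>lborel) = 0"
    by (simp only: Bochner_Integration.integral_add[OF i1 i2])
  then show "(\<integral>x. indicator \<Omega> x *\<^sub>R (of_real (\<phi> x) * frechet_derivative N (at x) v) \<partial>lborel) =
      - (\<integral>x. indicator \<Omega> x *\<^sub>R (of_real (frechet_derivative \<phi> (at x) v) * N x) \<partial>lborel)"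
    unfolding ind by (simp only: eq_neg_iff_add_eq_0)
qed

lemma integral_half_combination:
  fixes P Q :: "'n::finite \<Rightarrow> 'a \<Rightarrow> complex"
  assumes "\<And>l. integrable M (P l)" "\<And>l. integrable M (Q l)"
  shows "(\<integral>x. (\<Sum>l. (1/2) * P l x - (\<i>/2) * Q l x) \<partial>M) =
    (\<Sum>l. (1/2) * (\<integral>x. P l x \<partial>M) - (\<i>/2) * (\<integral>x. Q l x \<partial>M))"
  using assms by (simp add: Bochner_Integration.integral_sum Bochner_Integration.integral_diff)

text \<open>After integration by parts the hypothesis says that the divergence, a continuous function, is
  orthogonal to all bump functions around \<open>x0\<close>.\<close>

lemma weak_divergence_zero:
  fixes N :: "'n::finite \<Rightarrow> 'n cvec \<Rightarrow> complex"
  assumes \<Omega>: "open \<Omega>" and N: "\<And>l. smooth_on \<Omega> (N l)" and x0: "x0 \<in> \<Omega>"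
    and weak: "\<And>r. 0 < r \<Longrightarrow> cball x0 r \<subseteq> \<Omega> \<Longrightarrow>
      (\<integral>x. indicator \<Omega> x *\<^sub>R (\<Sum>l. (1/2) * (of_real (frechet_derivative (bump x0 r) (at x) (axis l 1))
        - \<i> * of_real (frechet_derivative (bump x0 r) (at x) (axis l \<i>))) * N l x) \<partial>lborel) = 0"
  shows "(\<Sum>l. (1/2) * (frechet_derivative (N l) (at x0) (axis l 1)
       - \<i> * frechet_derivative (N l) (at x0) (axis l \<i>))) = 0"
proof (rule continuous_bump_orthogonal_zero[OF \<Omega> _ x0, where F = "\<lambda>x. \<Sum>l. (1/2) * (frechet_derivative (N l) (at x) (axis l 1)
       - \<i> * frechet_derivative (N l) (at x) (axis l \<i>))"])
  show "continuous_on \<Omega> (\<lambda>x. \<Sum>l. (1/2) * (frechet_derivative (N l) (at x) (axis l 1)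
       - \<i> * frechet_derivative (N l) (at x) (axis l \<i>)))"
    by (intro continuous_intros smooth_on_imp_continuous_on smooth_on_frechet N)
next
  fix r :: real assume r: "0 < r" "cball x0 r \<subseteq> \<Omega>"
  let ?\<phi> = "bump x0 r"
  have out: "?\<phi> x = 0" if "x \<notin> cball x0 r" for x using bump_nonzero_iff[OF r(1), of x0 x] that by auto
  note ibp = integration_by_parts[OF \<Omega> N smooth_on_bump compact_cball r(2)]
  have parts1: "integrable lborel (\<lambda>x. indicator \<Omega> x *\<^sub>R (of_real (?\<phi> x) * frechet_derivative (N l) (at x) v))"
    and parts2: "integrable lborel (\<lambda>x. indicator \<Omega> x *\<^sub>R (of_real (frechet_derivative ?\<phi> (at x) v) * N l x))" for l v
    by (rule ibp(1), rule out, assumption) (rule ibp(2), rule out, assumption)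
  let ?P = "\<lambda>l v. \<integral>x. indicator \<Omega> x *\<^sub>R (of_real (?\<phi> x) * frechet_derivative (N l) (at x) v) \<partial>lborel"
  let ?Q = "\<lambda>l v. \<integral>x. indicator \<Omega> x *\<^sub>R (of_real (frechet_derivative ?\<phi> (at x) v) * N l x) \<partial>lborel"
  have "(\<integral>x. indicator \<Omega> x *\<^sub>R (of_real (?\<phi> x) * (\<Sum>l. (1/2) * (frechet_derivative (N l) (at x) (axis l 1)
       - \<i> * frechet_derivative (N l) (at x) (axis l \<i>)))) \<partial>lborel)
    = (\<integral>x. (\<Sum>l. (1/2) * (indicator \<Omega> x *\<^sub>R (of_real (?\<phi> x) * frechet_derivative (N l) (at x) (axis l 1)))
       - (\<i>/2) * (indicator \<Omega> x *\<^sub>R (of_real (?\<phi> x) * frechet_derivative (N l) (at x) (axis l \<i>)))) \<partial>lborel)"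
    by (intro Bochner_Integration.integral_cong refl)
      (simp add: sum_distrib_left scaleR_sum_right indicator_def algebra_simps)
  also have "\<dots> = (\<Sum>l. (1/2) * ?P l (axis l 1) - (\<i>/2) * ?P l (axis l \<i>))"
    by (rule integral_half_combination[OF parts1 parts1])
  also have "\<dots> = - (\<Sum>l. (1/2) * ?Q l (axis l 1) - (\<i>/2) * ?Q l (axis l \<i>))"
  proof -
    have "?P l v = - ?Q l v" for l v by (rule ibp(3), rule out, assumption)
    then show ?thesis by (simp only:) (simp add: sum_negf[symmetric])
  qed
  also have "(\<Sum>l. (1/2) * ?Q l (axis l 1) - (\<i>/2) * ?Q l (axis l \<i>)) =
    (\<integral>x. (\<Sum>l. (1/2) * (indicator \<Omega> x *\<^sub>R (of_real (frechet_derivative ?\<phi> (at x) (axis l 1)) * N l x))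
       - (\<i>/2) * (indicator \<Omega> x *\<^sub>R (of_real (frechet_derivative ?\<phi> (at x) (axis l \<i>)) * N l x))) \<partial>lborel)"
    by (rule integral_half_combination[OF parts2 parts2, symmetric])
  also have "\<dots> = (\<integral>x. indicator \<Omega> x *\<^sub>R (\<Sum>l. (1/2) * (of_real (frechet_derivative ?\<phi> (at x) (axis l 1))
        - \<i> * of_real (frechet_derivative ?\<phi> (at x) (axis l \<i>))) * N l x) \<partial>lborel)"
    by (intro Bochner_Integration.integral_cong refl)
      (simp add: sum_distrib_left scaleR_sum_right indicator_def algebra_simps)
  also have "\<dots> = 0" by (rule weak[OF r])
  finally show "(\<integral>x. indicator \<Omega> x *\<^sub>R (of_real (?\<phi> x) * (\<Sum>l. (1/2) * (frechet_derivative (N l) (at x) (axis l 1)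
       - \<i> * frechet_derivative (N l) (at x) (axis l \<i>)))) \<partial>lborel) = 0" by simp
qed

section \<open>Torsion trace of a balanced metric\<close>

lemma smooth_on_det:
  fixes M :: "'a::real_normed_vector \<Rightarrow> complex^'n^'n"
  assumes "open S" "\<And>i j. smooth_on S (\<lambda>x. M x $ i $ j)"
  shows "smooth_on S (\<lambda>x. det (M x))"
  unfolding det_def
  by (intro smooth_on_sum smooth_on_mult smooth_on_const smooth_on_prod assms)

text \<open>Cramer's rule. The right-hand side is a polynomial in the entries of \<open>H\<close>, hence as
  smooth as they are.\<close>

lemma adjugate_entry:
  fixes H G :: "complex^'n^'n"
  assumes "H ** G = mat 1"
  shows "det H * G $ b $ l = det (\<chi> i j. if j = b then (axis l 1 :: complex^'n) $ i else H $ i $ j)"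
proof -
  have 1: "(H *v (\<chi> k. G $ k $ l)) = axis l 1"
    using assms by (simp add: vec_eq_iff matrix_vector_mult_def matrix_matrix_mult_def mat_def axis_nth_if)
  show ?thesis
    using cramer_lemma[of b H "\<chi> k. G $ k $ l"] unfolding 1 by (simp add: mult.commute)
qed

text \<open>Differentiating the Leibniz formula replaces one row of the matrix by its derivative. That row is
  a combination of the rows of \<open>h x\<close>, and only the multiple of the replaced row itself
  contributes to the determinant.\<close>

lemma jacobi_formula:
  fixes h :: "'a::real_normed_vector \<Rightarrow> complex^'n^'n"
  assumes h: "(h has_derivative h') (at x)" and G: "G ** h x = mat 1"
  shows "((\<lambda>y. det (h y)) has_derivative
    (\<lambda>v. det (h x) * (\<Sum>c d. G $ d $ c * h' v $ c $ d))) (at x)"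
proof -
  have entry: "((\<lambda>y. h y $ i $ j) has_derivative (\<lambda>v. h' v $ i $ j)) (at x)" for i j
    using bounded_linear.has_derivative[OF bounded_linear_vec_nth bounded_linear.has_derivative[OF bounded_linear_vec_nth h]] .
  have row: "(\<Sum>p | p permutes UNIV. of_int (sign p) * (h' v $ i $ p i * (\<Prod>j\<in>UNIV - {i}. h x $ j $ p j))) =
      det (h x) * (\<Sum>d. G $ d $ i * h' v $ i $ d)" for v i
  proof -
    let ?x = "\<chi> c. (h' v ** G) $ i $ c"
    (* The rows of the derivative as combinations of the rows of h x. *)
    have "h' v = (h' v ** G) ** h x" by (simp add: matrix_mul_assoc[symmetric] G)
    then have "h' v $ i $ s = (\<Sum>c. (h' v ** G) $ i $ c * h x $ c $ s)" for s
      by (simp add: matrix_matrix_mult_def[of "h' v ** G"] vec_eq_iff)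
    then have "(\<chi> r. if r = i then \<Sum>c. ?x $ c *s row c (h x) else row r (h x)) =
        (\<chi> r s. if r = i then h' v $ i $ s else h x $ r $ s)"
      by (simp add: vec_eq_iff row_def)
    then have "det (\<chi> r s. if r = i then h' v $ i $ s else h x $ r $ s) = ?x $ i * det (h x)"
      using cramer_lemma_transpose[of i ?x "h x"] by (simp only:)
    moreover have "det (\<chi> r s. if r = i then h' v $ i $ s else h x $ r $ s) =
       (\<Sum>p | p permutes UNIV. of_int (sign p) * (h' v $ i $ p i * (\<Prod>j\<in>UNIV - {i}. h x $ j $ p j)))"
      unfolding det_def
    proof (intro sum.cong refl)
      fix p
      have "(\<Prod>r\<in>UNIV. (\<chi> r s. if r = i then h' v $ i $ s else h x $ r $ s) $ r $ p r) =
          h' v $ i $ p i * (\<Prod>j\<in>UNIV - {i}. if j = i then h' v $ i $ p j else h x $ j $ p j)"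
        by (subst prod.remove[of _ i]) auto
      also have "(\<Prod>j\<in>UNIV - {i}. if j = i then h' v $ i $ p j else h x $ j $ p j) = (\<Prod>j\<in>UNIV - {i}. h x $ j $ p j)"
        by (rule prod.cong) auto
      finally show "of_int (sign p) * (\<Prod>r\<in>UNIV. (\<chi> r s. if r = i then h' v $ i $ s else h x $ r $ s) $ r $ p r) =
          of_int (sign p) * (h' v $ i $ p i * (\<Prod>j\<in>UNIV - {i}. h x $ j $ p j))" by simp
    qed
    ultimately show ?thesis by (simp add: matrix_matrix_mult_def mult.commute)
  qed
  have "((\<lambda>y. det (h y)) has_derivative (\<lambda>v. \<Sum>p | p permutes UNIV. of_int (sign p) *
      (\<Sum>i. h' v $ i $ p i * (\<Prod>j\<in>UNIV - {i}. h x $ j $ p j)))) (at x)"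
    unfolding det_def
    by (intro has_derivative_sum has_derivative_mult_right has_derivative_prod entry)
  moreover have "(\<Sum>p | p permutes UNIV. of_int (sign p) *
      (\<Sum>i. h' v $ i $ p i * (\<Prod>j\<in>UNIV - {i}. h x $ j $ p j))) =
      det (h x) * (\<Sum>c d. G $ d $ c * h' v $ c $ d)" for v
  proof -
    have "(\<Sum>p | p permutes UNIV. of_int (sign p) *
      (\<Sum>i. h' v $ i $ p i * (\<Prod>j\<in>UNIV - {i}. h x $ j $ p j))) =
      (\<Sum>i. \<Sum>p | p permutes UNIV. of_int (sign p) * (h' v $ i $ p i * (\<Prod>j\<in>UNIV - {i}. h x $ j $ p j)))"
      unfolding sum_distrib_left by (rule sum.swap)
    then show ?thesis by (simp only: row sum_distrib_left)
  qed
  ultimately show ?thesis by simp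
qed

text \<open>Obtained by differentiating \<open>h (det h \<cdot> G) = det h\<close>, which avoids
  differentiating the inverse \<open>G\<close>.\<close>

lemma adjugate_derivative:
  fixes h :: "'a::real_normed_vector \<Rightarrow> complex^'n^'n"
  assumes S: "open S" "x \<in> S" and h: "(h has_derivative h') (at x)"
    and G: "\<And>y. y \<in> S \<Longrightarrow> h y ** G y = mat 1"
    and N: "\<And>b l. ((\<lambda>y. det (h y) * G y $ b $ l) has_derivative N' b l) (at x)"
  shows "N' a l v = det (h x) * ((\<Sum>c d. G x $ d $ c * h' v $ c $ d) * G x $ a $ l
      - (\<Sum>c d. G x $ a $ c * h' v $ c $ d * G x $ d $ l))"
proof -
  have G': "G x ** h x = mat 1" using G[OF S(2)] by (simp add: matrix_left_right_inverse)
  let ?t = "\<lambda>v. det (h x) * (\<Sum>c d. G x $ d $ c * h' v $ c $ d)"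
  have entry: "((\<lambda>y. h y $ i $ j) has_derivative (\<lambda>v. h' v $ i $ j)) (at x)" for i j
    using bounded_linear.has_derivative[OF bounded_linear_vec_nth bounded_linear.has_derivative[OF bounded_linear_vec_nth h]] .
  have eq: "(\<Sum>b. h x $ c $ b * N' b l v + h' v $ c $ b * (det (h x) * G x $ b $ l)) = of_bool (c = l) * ?t v" for c
  proof -
    have "((\<lambda>y. \<Sum>b. h y $ c $ b * (det (h y) * G y $ b $ l)) has_derivative
        (\<lambda>v. \<Sum>b. h x $ c $ b * N' b l v + h' v $ c $ b * (det (h x) * G x $ b $ l))) (at x)"
      by (intro has_derivative_sum has_derivative_mult entry N)
    then have "((\<lambda>y. of_bool (c = l) * det (h y)) has_derivative
        (\<lambda>v. \<Sum>b. h x $ c $ b * N' b l v + h' v $ c $ b * (det (h x) * G x $ b $ l))) (at x)"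
    proof (rule has_derivative_transform_within_open[OF _ S])
      fix y assume "y \<in> S"
      have "(\<Sum>b. h y $ c $ b * (det (h y) * G y $ b $ l)) = det (h y) * (h y ** G y) $ c $ l"
        by (simp add: matrix_matrix_mult_def sum_distrib_left mult_ac)
      then show "(\<Sum>b. h y $ c $ b * (det (h y) * G y $ b $ l)) = of_bool (c = l) * det (h y)"
        by (simp add: G[OF \<open>y \<in> S\<close>] mat_def)
    qed
    from has_derivative_unique[OF this has_derivative_mult_right[OF jacobi_formula[OF h G'], of "of_bool (c = l)"]]
    show ?thesis by (rule fun_cong)
  qed
  have "(\<Sum>c. G x $ a $ c * (\<Sum>b. h x $ c $ b * N' b l v + h' v $ c $ b * (det (h x) * G x $ b $ l)))
      = (\<Sum>c. G x $ a $ c * (of_bool (c = l) * ?t v))"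
    by (simp only: eq)
  also have "\<dots> = G x $ a $ l * ?t v"
    by (simp add: of_bool_def if_distrib[of "\<lambda>x. _ * x"] if_distrib[of "\<lambda>x. x * _"] cong: if_cong)
  finally have 1: "(\<Sum>c. G x $ a $ c * (\<Sum>b. h x $ c $ b * N' b l v + h' v $ c $ b * (det (h x) * G x $ b $ l)))
      = G x $ a $ l * ?t v" .
  have "(\<Sum>c. G x $ a $ c * (\<Sum>b. h x $ c $ b * N' b l v)) = (\<Sum>b. (G x ** h x) $ a $ b * N' b l v)"
  proof -
    have "(\<Sum>c b. G x $ a $ c * (h x $ c $ b * N' b l v)) = (\<Sum>b c. G x $ a $ c * (h x $ c $ b * N' b l v))"
      by (rule sum.swap)
    then show ?thesis by (simp add: matrix_matrix_mult_def sum_distrib_left sum_distrib_right mult.assoc)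
  qed
  also have "\<dots> = N' a l v"
    by (simp add: G' mat_def if_distrib[of "\<lambda>x. x * _"] cong: if_cong)
  finally have 2: "(\<Sum>c. G x $ a $ c * (\<Sum>b. h x $ c $ b * N' b l v)) = N' a l v" .
  have 3: "(\<Sum>c. G x $ a $ c * (\<Sum>b. h' v $ c $ b * (det (h x) * G x $ b $ l))) =
      det (h x) * (\<Sum>c d. G x $ a $ c * h' v $ c $ d * G x $ d $ l)"
    unfolding sum_distrib_left by (intro sum.cong refl) (simp add: mult_ac)
  from 1 have "N' a l v + det (h x) * (\<Sum>c d. G x $ a $ c * h' v $ c $ d * G x $ d $ l) = G x $ a $ l * ?t v"
    by (simp only: sum.distrib distrib_left 2 3)
  then show ?thesis by (simp add: algebra_simps)
qed

text \<open>Renaming indices, the hypothesis says that \<open>G\<close> annihilates the vector of torsion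
  traces, and \<open>G\<close> is invertible.\<close>

lemma divergence_imp_trace:
  fixes H G :: "complex^'n^'n" and D :: "'n \<Rightarrow> 'n \<Rightarrow> 'n \<Rightarrow> complex"
  assumes HG: "H ** G = mat 1"
    and div: "\<And>b. (\<Sum>l. (\<Sum>c d. G $ d $ c * D l c d) * G $ b $ l
      - (\<Sum>c d. G $ b $ c * D l c d * G $ d $ l)) = 0"
  shows "(\<Sum>c d. G $ d $ c * (D a c d - D c a d)) = 0"
proof -
  define t where "t a = (\<Sum>c d. G $ d $ c * (D a c d - D c a d))" for a
  have Gt: "(\<Sum>l. G $ b $ l * t l) = 0" for b
  proof -
    have "(\<Sum>l c d. G $ b $ c * D l c d * G $ d $ l) =
        (\<Sum>l c d. G $ b $ l * D c l d * G $ d $ c)"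
      by (rule sum.swap)
    also have "\<dots> = (\<Sum>l. G $ b $ l * (\<Sum>c d. G $ d $ c * D c l d))"
      unfolding sum_distrib_left by (intro sum.cong refl) (simp add: mult_ac)
    finally have "(\<Sum>l. (\<Sum>c d. G $ d $ c * D l c d) * G $ b $ l) -
        (\<Sum>l. G $ b $ l * (\<Sum>c d. G $ d $ c * D c l d)) = 0"
      using div[of b] by (simp only: sum_subtractf)
    then show ?thesis
      unfolding t_def right_diff_distrib sum_subtractf by (simp add: mult.commute[of "G $ b $ _"])
  qed
  have "t a = (\<Sum>l. (H ** G) $ a $ l * t l)"
    by (simp add: HG mat_def if_distrib[of "\<lambda>x. x * _"] cong: if_cong)
  also have "\<dots> = (\<Sum>l b. H $ a $ b * (G $ b $ l * t l))"
    by (simp add: matrix_matrix_mult_def sum_distrib_right mult.assoc)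
  also have "\<dots> = (\<Sum>b. H $ a $ b * (\<Sum>l. G $ b $ l * t l))"
    unfolding sum_distrib_left by (rule sum.swap)
  finally have "t a = 0" by (simp add: Gt)
  then show ?thesis unfolding t_def .
qed

lemma det_hermitian_real:
  assumes "hermitian_pos H" shows "complex_of_real (Re (det H)) = det H"
proof -
  have "cnj (det H) = det (transpose H)"
  proof -
    have "cnj (H $ i $ j) = transpose H $ i $ j" for i j
      using assms unfolding hermitian_pos_def transpose_def by (metis vec_lambda_beta)
    then show ?thesis by (simp add: det_def cnj_sum cnj_prod)
  qed
  then show ?thesis by (metis Reals_cnj_iff det_transpose of_real_Re)
qed

context complex_manifold
begin

text \<open>With the test forms \<open>\<phi> d\<zeta>\<^sub>b\<close>, the integrand of
  \<open>(d\<alpha>, \<omega>)\<close> is up to a constant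
  \<open>\<Sum>l \<partial>\<phi>/\<partial>z\<^sub>l N b l\<close>, where \<open>N b l\<close> is
  the entry of the adjugate matrix of the metric: the determinant comes from the volume and the
  inverse matrix from the inner product. So the rows of the adjugate matrix are divergence free.\<close>

lemma balanced_torsion_trace:
  assumes h: "hermitian_metric A h" and bal: "balanced X A h" and c: "c \<in> A" and x0: "x0 \<in> chart_image c"
  shows "(\<Sum>i d. matrix_inv (h c x0) $ d $ i * (dmetric (h c) x0 a i d - dmetric (h c) x0 i a d)) = 0"
proof -
  let ?\<Omega> = "chart_image c" and ?G = "\<lambda>y. matrix_inv (h c y)"
  have \<Omega>: "open ?\<Omega>" by (rule complex_chartD(2)[OF chart[OF c]])
  have sm: "smooth_on ?\<Omega> (h c)" using h c by (simp add: hermitian_metric_def)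
  have pos: "hermitian_pos (h c y)" if "y \<in> ?\<Omega>" for y
    using h c that unfolding hermitian_metric_def hermitian_pos_def by blast
  note inv = hermitian_pos_matrix_inv[OF pos]
  define N where "N b l y = det (h c y) * ?G y $ b $ l" for b l y
  have N_smooth: "smooth_on ?\<Omega> (N b l)" for b l
  proof (rule smooth_on_cong[OF \<Omega>])
    show "det (\<chi> i j. if j = b then (axis l 1 :: 'n cvec) $ i else h c y $ i $ j) = N b l y" if "y \<in> ?\<Omega>" for y
      using adjugate_entry[OF inv(1)[OF that]] by (simp add: N_def)
    have "smooth_on ?\<Omega> (\<lambda>y. if j = b then (axis l 1 :: 'n cvec) $ i else h c y $ i $ j)" for i j
      by (cases "j = b") (simp_all add: smooth_on_const[OF \<Omega>] smooth_on_nth[OF \<Omega> smooth_on_nth[OF \<Omega> sm]])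
    then show "smooth_on ?\<Omega> (\<lambda>y. det (\<chi> i j. if j = b then (axis l 1 :: 'n cvec) $ i else h c y $ i $ j))"
      by (intro smooth_on_det \<Omega>) simp
  qed
  have div: "(\<Sum>l. (1/2) * (frechet_derivative (N b l) (at x0) (axis l 1)
       - \<i> * frechet_derivative (N b l) (at x0) (axis l \<i>))) = 0" for b
  proof (rule weak_divergence_zero[OF \<Omega> N_smooth x0])
    fix r :: real assume r: "0 < r" "cball x0 r \<subseteq> ?\<Omega>"
    let ?a = "\<lambda>y. complex_of_real (bump x0 r y) *s (covector (Dzbar b) :: 'n cform)"
    let ?g = "\<lambda>x. \<Sum>l. (1/2) * (of_real (frechet_derivative (bump x0 r) (at x) (axis l 1))
        - \<i> * of_real (frechet_derivative (bump x0 r) (at x) (axis l \<i>))) * N b l x"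
    have bl: "bounded_linear (\<lambda>r. complex_of_real r *s (covector (Dzbar b) :: 'n cform))"
      by (subst linear_conv_bounded_linear[symmetric])
        (auto intro!: linearI simp: vec_eq_iff algebra_simps scaleR_conv_of_real[where 'a = complex])
    have "(LINT x:?\<Omega>|lborel. volume_density (h c x) *\<^sub>R form_inner (h c x) (ext_d ?a x) (fundamental_form h c x)) = 0"
    proof (rule codifferential_zero_local[OF _ c compact_cball r(2)])
      show "is_codifferential X A h 1 (fundamental_form h) (\<lambda>_ _. 0)" using bal by (simp add: balanced_def)
      show "smooth_on UNIV ?a" by (rule smooth_on_bounded_linear[OF open_UNIV bl smooth_on_bump])
      show "?a y $ I = 0" if "card I \<noteq> 1" for y I using that by (auto simp: covector_def axis_nth_if)
      show "?a y = 0" if "y \<notin> cball x0 r" for y using bump_nonzero_iff[OF r(1), of x0 y] that by auto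
    qed
    moreover have "indicator ?\<Omega> x *\<^sub>R (volume_density (h c x) *\<^sub>R form_inner (h c x) (ext_d ?a x) (fundamental_form h c x))
        = (- \<i> * 2 ^ CARD('n)) * (indicator ?\<Omega> x *\<^sub>R ?g x)" for x
    proof (cases "x \<in> ?\<Omega>")
      case True
      have "volume_density (h c x) *\<^sub>R form_inner (h c x) (ext_d ?a x) (fundamental_form h c x) =
          (2 ^ CARD('n) * complex_of_real (Re (det (h c x)))) * form_inner (h c x) (ext_d ?a x) (omega (h c x))"
        by (simp add: volume_density_def scaleR_conv_of_real fundamental_form_omega)
      also have "\<dots> = (- \<i> * 2 ^ CARD('n)) * ?g x"
        unfolding det_hermitian_real[OF pos[OF True]]
          form_inner_ext_d_test[OF pos[OF True] smooth_onD(2)[OF smooth_on_bump UNIV_I]] N_def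
        by (simp add: sum_distrib_left mult_ac)
      finally show ?thesis using True by simp
    qed simp
    ultimately have "(\<integral>x. (- \<i> * 2 ^ CARD('n)) * (indicator ?\<Omega> x *\<^sub>R ?g x) \<partial>lborel) = 0"
      unfolding set_lebesgue_integral_def by (simp only:)
    then have "(- \<i> * 2 ^ CARD('n)) * (\<integral>x. indicator ?\<Omega> x *\<^sub>R ?g x \<partial>lborel) = 0"
      by (simp only: integral_mult_right_zero)
    then show "(\<integral>x. indicator ?\<Omega> x *\<^sub>R ?g x \<partial>lborel) = 0" by (simp only: mult_eq_0_iff) simp
  qed
  note dN = smooth_onD(1)[OF N_smooth x0, unfolded N_def[abs_def]]
  have N': "frechet_derivative (\<lambda>y. det (h c y) * ?G y $ b $ l) (at x0) v =
      det (h c x0) * ((\<Sum>i d. ?G x0 $ d $ i * frechet_derivative (h c) (at x0) v $ i $ d) * ?G x0 $ b $ l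
      - (\<Sum>i d. ?G x0 $ b $ i * frechet_derivative (h c) (at x0) v $ i $ d * ?G x0 $ d $ l))" for b l v
    by (rule adjugate_derivative[OF \<Omega> x0 smooth_onD(1)[OF sm x0]]) (erule inv(1), rule dN)
  let ?D = "dmetric (h c) x0"
  have lin: "(1/2) * (frechet_derivative (N b l) (at x0) (axis l 1)
       - \<i> * frechet_derivative (N b l) (at x0) (axis l \<i>)) =
     det (h c x0) * ((\<Sum>i d. ?G x0 $ d $ i * ?D l i d) * ?G x0 $ b $ l
      - (\<Sum>i d. ?G x0 $ b $ i * ?D l i d * ?G x0 $ d $ l))" for b l
  proof -
    let ?h1 = "frechet_derivative (h c) (at x0) (axis l 1)" and ?h2 = "frechet_derivative (h c) (at x0) (axis l \<i>)"
    have s1: "(\<Sum>i d. ?G x0 $ d $ i * ?D l i d) =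
      (1/2) * ((\<Sum>i d. ?G x0 $ d $ i * ?h1 $ i $ d) - \<i> * (\<Sum>i d. ?G x0 $ d $ i * ?h2 $ i $ d))"
      unfolding dmetric_def sum_distrib_left sum_subtractf[symmetric] by (intro sum.cong refl) (simp add: algebra_simps)
    have s2: "(\<Sum>i d. ?G x0 $ b $ i * ?D l i d * ?G x0 $ d $ l) =
      (1/2) * ((\<Sum>i d. ?G x0 $ b $ i * ?h1 $ i $ d * ?G x0 $ d $ l) -
        \<i> * (\<Sum>i d. ?G x0 $ b $ i * ?h2 $ i $ d * ?G x0 $ d $ l))"
      unfolding dmetric_def sum_distrib_left sum_subtractf[symmetric] by (intro sum.cong refl) (simp add: algebra_simps)
    have "(1/2) * (\<rho> * (t1 * g - q1) - \<i> * (\<rho> * (t2 * g - q2))) =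
        \<rho> * ((1/2) * (t1 - \<i> * t2) * g - (1/2) * (q1 - \<i> * q2))" for \<rho> g t1 t2 q1 q2 :: complex
      by (simp add: field_simps)
    then show ?thesis unfolding s1 s2 N_def[abs_def] N' .
  qed
  (* Dividing by the determinant leaves the contraction with the inverse metric. *)
  have det: "det (h c x0) \<noteq> 0"
    using inv(1)[OF x0] invertible_det_nz unfolding invertible_def by (metis matrix_left_right_inverse)
  show ?thesis
  proof (rule divergence_imp_trace[OF inv(1)[OF x0]])
    fix b
    have "det (h c x0) * (\<Sum>l. (\<Sum>i d. ?G x0 $ d $ i * ?D l i d) * ?G x0 $ b $ l
      - (\<Sum>i d. ?G x0 $ b $ i * ?D l i d * ?G x0 $ d $ l)) = 0"
      using div[of b] unfolding lin by (simp only: sum_distrib_left)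
    then show "(\<Sum>l. (\<Sum>i d. ?G x0 $ d $ i * ?D l i d) * ?G x0 $ b $ l
      - (\<Sum>i d. ?G x0 $ b $ i * ?D l i d * ?G x0 $ d $ l)) = 0"
      using det by (simp only: mult_eq_0_iff) simp
  qed
qed

end

theorem corollary1p16:
  fixes X :: "'a topology"
    and A :: "('a, 'n::{finite,linorder}) chart set"
    and h :: "('a, 'n) metric"
    and k n :: nat
  assumes "n = CARD('n)"
    and "compact_hermitian_manifold X A h"
    and "1 \<le> k" and "k + 2 \<le> n"
    and "k_gauduchon k A h"
    and "balanced X A h"
  shows "kaehler A h"
proof -
  have h: "hermitian_metric A h" and X: "compact_complex_manifold X A"
    using assms(2) by (auto simp: compact_hermitian_manifold_def)
  interpret complex_manifold X A by unfold_locales (rule X)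
  show ?thesis
    unfolding kaehler_def
  proof (intro ballI)
    fix c x assume c: "c \<in> A" and x: "x \<in> chart_image c"
    have "fundamental_form h c = (\<lambda>y. omega (h c y))" by (simp add: fun_eq_iff fundamental_form_omega)
    moreover have "ext_d (\<lambda>y. omega (h c y)) x = 0"
    proof (rule torsion_trace_gauduchon_imp_closed[where S = "chart_image c" and k = k])
      show "open (chart_image c)" by (rule complex_chartD(2)[OF chart[OF c]])
      show "smooth_on (chart_image c) (h c)" using h c by (simp add: hermitian_metric_def)
      show "hermitian_pos (h c y)" if "y \<in> chart_image c" for y
        using h c that unfolding hermitian_metric_def hermitian_pos_def by blast
      show "(\<Sum>i d. matrix_inv (h c y) $ d $ i * (dmetric (h c) y a i d - dmetric (h c) y i a d)) = 0"
        if "y \<in> chart_image c" for y a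
        by (rule balanced_torsion_trace[OF h assms(6) c that])
      show "\<i> *s (wedge_power (omega (h c x)) (CARD('n) - k - 1) \<^bold>\<and>
          del (delbar (\<lambda>y. wedge_power (omega (h c y)) k)) x) = 0"
        using assms(5) c x unfolding k_gauduchon_def fundamental_form_omega by blast
    qed (use assms x in auto)
    ultimately show "ext_d (fundamental_form h c) x = 0" by simp
  qed
qed

end
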